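(* Let $M$ be a primely generated conical refinement monoid, and let $\mathcal J_M=(\mathbb P,\le^*,(G_p)_{p\in\mathbb P},\varphi_{pq}\,(q<^*p))$ be the $\mathbb P$-system associated to $M$. Then there is a natural isomorphism of monoids $$M(\mathcal J_M)\longrightarrow M.$$
   Context: All monoids and semigroups are commutative, written additively; $\mathbb N=\{1,2,\dots\}$. For a monoid $M$, $x\le y$ means $y=x+z$ for some $z\in M$. $M$ is conical if $x+y=0$ implies $x=y=0$. $M$ is a refinement monoid if whenever $a+b=c+d$ there are $w,x,y,z\in M$ with $a=w+x$, $b=y+z$, $c=w+y$, $d=x+z$. An element $p$ is prime if it is not invertible and $p\le a+b$ implies $p\le a$ or $p\le b$. $M$ is primely generated if every non-invertible element is a sum of primes. An element $x$ is regular if $2x\le x$, and free if $nx\le mx$ implies $n\le m$; in a primely generated refinement monoid every element is free or regular. The archimedian component $M_a$ of $a\in M$ is the set of $x\in M$ with $a\le nx$ and $x\le ma$ for some $n,m\in\mathbb N$. $G(S)$ denotes the Grothendieck group of a semigroup $S$. $I$-systems. Let $(I,\le)$ be a poset. An $I$-system $\mathcal J=(I,\le,(G_i)_{i\in I},\varphi_{ji}\,(i<j))$ consists of: (a) a partition $I=I_{\rm free}\sqcup I_{\rm reg}$ (one part may be empty); (b) abelian groups $G_i$, $i\in I$; put $M_i=\widehat G_i=G_i$ if $i\in I_{\rm reg}$, and $M_i=\mathbb N\times G_i$, $\widehat G_i=\mathbb Z\times G_i$ if $i\in I_{\rm free}$; $G_i$ is viewed as the subgroup $\{0\}\times G_i$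 of $\widehat G_i$ when $i$ is free; (c) semigroup homomorphisms $\varphi_{ji}\colon M_i\to G_j$ for $i<j$, with unique extensions to group homomorphisms $\widehat\varphi_{ji}\colon\widehat G_i\to G_j\subseteq\widehat G_j$, such that: (c1) $i\mapsto\widehat G_i$, $(i<j)\mapsto\widehat\varphi_{ji}$, with $\widehat\varphi_{ii}=\mathrm{id}$, is a functor from $I$ to abelian groups; (c2) for each $i\in I_{\rm free}$, every element of $G_i$ is a finite sum of elements $\varphi_{ik}(x)$ with $k<i$, $x\in M_k$ (for $i$ minimal this means that $G_i$ is trivial). The monoid $M(\mathcal J)$. Let $A(I)$ be the set of lower subsets $a$ of $I$ such that the set $\mathrm{Max}(a)$ of maximal elements of $a$ is finite and every element of $a$ lies below some element of $\mathrm{Max}(a)$ (including $a=\emptyset$). For $a\in A(I)$ let $\widehat H_a=\bigoplus_{i\in a}\widehat G_i$; for $i\in a$, $u\in\widehat G_i$ let $\chi(a,i,u)\in\widehat H_a$ have $i$-th component $u$ and all other components $0$; let $U_a$ be the subgroup generated by all $\chi(a,i,u)-\chi(a,j,\widehat\varphi_{ji}(u))$ with $i<j$, $j\in\mathrm{Max}(a)$, $u\in\widehat G_i$. Let $H_a$ be the subsemigroup of all $(z_i)_{i\in a}\in\widehat H_a$ with $z_i\in\mathbb N\times G_i$ for each free $i\in\mathrm{Max}(a)$ and $z_i\in\{(0,0_i)\}\cup(\mathbb N\times G_i)$ for each free $i\in a\setminus\mathrm{Max}(a)$ (no condition for regular $i$). Put $M_a=H_a/{\sim}$, where $x\sim y$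 iff $x-y\in U_a$. With $f_a^b\colon\widehat H_a\to\widehat H_b$ the canonical embedding for $a\subseteq b$, $M(\mathcal J)=\bigsqcup_{a\in A(I)}M_a$ with $[x]+[y]=[f_a^{a\cup b}(x)+f_b^{a\cup b}(y)]\in M_{a\cup b}$. The system $\mathcal J_M$. Let $\overline M$ be the quotient of $M$ by the congruence $x\equiv y\iff x\le y\le x$, with $\overline x$ the class of $x$. Write $x<^*y$ if $\overline x<\overline y$ in $\overline M$, and $x\le^*y$ if $x<^*y$ or $x=y$. Let $\mathbb P$ be a set consisting of one chosen representative $p\in M$ for each prime $\overline p$ of $\overline M$; every $p\in\mathbb P$ is prime in $M$, and for $p$ regular the chosen representative is the unique idempotent lifting $\overline p$. The poset is $(\mathbb P,\le^* )$, partitioned into its free and regular elements. If $p\in\mathbb P$ is regular, the archimedian component $M_p$ is an abelian group and $G_p:=M_p$. If $p\in\mathbb P$ is free, $G_p:=\{(p+\alpha)-p:\alpha\in M,\ p+\alpha\le p\}$, a subgroup of $G(M_p)$, and $\mathbb N\times G_p$ is identified with the archimedian component $M_p$ via the isomorphism $(n,(p+\alpha)-p)\mapsto np+\alpha$. For $q<^*p$ in $\mathbb P$, $\varphi_{pq}\colon M_q\to G_p$ is $\varphi_{pq}(x)=(p+x)-p\in G_p\subseteq G(M_p)$. These data form a $\mathbb P$-system. *)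

theory Defs
  imports "HOL-Algebra.Product_Groups" "HOL-Algebra.Weak_Morphisms"
begin

section \<open>Commutative monoids\<close>

text \<open>
  The monoid \<open>M\<close> is a type of class \<^class>\<open>comm_monoid_add\<close>; the groups and monoids constructed
  from it are records of type \<^typ>\<open>'b monoid\<close>, hence written multiplicatively.
  Throughout, \<open>\<nat>\<close> starts at 1.
\<close>

definition alg_le :: "'a::comm_monoid_add \<Rightarrow> 'a \<Rightarrow> bool"  (infix \<open>\<preceq>\<close> 50)
  where "x \<preceq> y \<longleftrightarrow> (\<exists>z. y = x + z)"

definition nmult :: "nat \<Rightarrow> 'a::comm_monoid_add \<Rightarrow> 'a"
  where "nmult n x = (\<Sum>i<n. x)"

definition invertible_elt :: "'a::comm_monoid_add \<Rightarrow> bool"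
  where "invertible_elt x \<longleftrightarrow> (\<exists>y. x + y = 0)"

definition prime_elt :: "'a::comm_monoid_add \<Rightarrow> bool"
  where "prime_elt p \<longleftrightarrow>
    \<not> invertible_elt p \<and> (\<forall>a b. p \<preceq> a + b \<longrightarrow> p \<preceq> a \<or> p \<preceq> b)"

definition regular_elt :: "'a::comm_monoid_add \<Rightarrow> bool"
  where "regular_elt x \<longleftrightarrow> nmult 2 x \<preceq> x"

definition free_elt :: "'a::comm_monoid_add \<Rightarrow> bool"
  where "free_elt x \<longleftrightarrow> (\<forall>n>0. \<forall>m>0. nmult n x \<preceq> nmult m x \<longrightarrow> n \<le> m)"

definition conical :: "'a::comm_monoid_add itself \<Rightarrow> bool"
  where "conical _ \<longleftrightarrow> (\<forall>x y::'a. x + y = 0 \<longrightarrow> x = 0 \<and> y = 0)"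

definition refinement_monoid :: "'a::comm_monoid_add itself \<Rightarrow> bool"
  where "refinement_monoid _ \<longleftrightarrow>
    (\<forall>a b c d::'a. a + b = c + d \<longrightarrow>
      (\<exists>w x y z. a = w + x \<and> b = y + z \<and> c = w + y \<and> d = x + z))"

definition primely_generated :: "'a::comm_monoid_add itself \<Rightarrow> bool"
  where "primely_generated _ \<longleftrightarrow>
    (\<forall>x::'a. \<not> invertible_elt x \<longrightarrow> (\<exists>ps. (\<forall>p\<in>set ps. prime_elt p) \<and> x = sum_list ps))"

definition arch_comp :: "'a::comm_monoid_add \<Rightarrow> 'a set"
  where "arch_comp a = {x. \<exists>n>0. \<exists>m>0. a \<preceq> nmult n x \<and> x \<preceq> nmult m a}"

text \<open>The monoid \<^typ>\<open>'a\<close> as a record, written multiplicatively.\<close>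

definition as_monoid :: "'a::comm_monoid_add monoid"
  where "as_monoid = \<lparr>carrier = UNIV, monoid.mult = (+), one = 0\<rparr>"


section \<open>The antisymmetric quotient\<close>

definition alg_equiv :: "'a::comm_monoid_add \<Rightarrow> 'a \<Rightarrow> bool"
  where "alg_equiv x y \<longleftrightarrow> x \<preceq> y \<and> y \<preceq> x"

lemma alg_le_refl: "x \<preceq> x"
  unfolding alg_le_def by (metis add_0_right)

lemma alg_le_trans: "x \<preceq> y \<Longrightarrow> y \<preceq> z \<Longrightarrow> x \<preceq> z"
  unfolding alg_le_def by (metis add.assoc)

lemma alg_le_add_mono: "x \<preceq> y \<Longrightarrow> x' \<preceq> y' \<Longrightarrow> x + x' \<preceq> y + y'"
  unfolding alg_le_def by (metis add.assoc add.left_commute)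

lemma equivp_alg_equiv: "equivp (alg_equiv :: 'a::comm_monoid_add \<Rightarrow> 'a \<Rightarrow> bool)"
  by (rule equivpI)
     (auto simp: alg_equiv_def reflp_def symp_def transp_def intro: alg_le_refl alg_le_trans)

quotient_type (overloaded) 'a antisym_quot = "'a::comm_monoid_add" / alg_equiv
  morphisms rep_antisym_quot bar
  by (rule equivp_alg_equiv)

instantiation antisym_quot :: (comm_monoid_add) comm_monoid_add
begin

lift_definition zero_antisym_quot :: "'a antisym_quot" is 0 .

lift_definition plus_antisym_quot :: "'a antisym_quot \<Rightarrow> 'a antisym_quot \<Rightarrow> 'a antisym_quot" is "(+)"
  by (auto simp: alg_equiv_def intro: alg_le_add_mono)

instance
  by standard (transfer; simp add: ac_simps alg_equiv_def alg_le_refl)+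

end

definition lt_star :: "'a::comm_monoid_add \<Rightarrow> 'a \<Rightarrow> bool"
  where "lt_star x y \<longleftrightarrow> bar x \<preceq> bar y \<and> bar x \<noteq> bar y"

definition le_star :: "'a::comm_monoid_add \<Rightarrow> 'a \<Rightarrow> bool"
  where "le_star x y \<longleftrightarrow> lt_star x y \<or> x = y"


section \<open>Grothendieck groups\<close>

text \<open>
  For a subsemigroup \<open>S\<close>, the class \<open>gdiff S x y\<close> is the formal difference \<open>x - y\<close> in \<open>G(S)\<close>.
\<close>

definition groth_rel :: "'a::comm_monoid_add set \<Rightarrow> (('a \<times> 'a) \<times> ('a \<times> 'a)) set"
  where "groth_rel S = {((x, y), (x', y')). x \<in> S \<and> y \<in> S \<and> x' \<in> S \<and> y' \<in> S \<and>
    (\<exists>k\<in>S. x + y' + k = x' + y + k)}"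

definition gdiff :: "'a::comm_monoid_add set \<Rightarrow> 'a \<Rightarrow> 'a \<Rightarrow> ('a \<times> 'a) set"
  where "gdiff S x y = groth_rel S `` {(x, y)}"

definition groth :: "'a::comm_monoid_add set \<Rightarrow> ('a \<times> 'a) set monoid"
  where "groth S = \<lparr>
    carrier = (S \<times> S) // groth_rel S,
    monoid.mult = (\<lambda>A B. \<Union>(x, y)\<in>A. \<Union>(x', y')\<in>B. gdiff S (x + x') (y + y')),
    one = (\<Union>x\<in>S. gdiff S x x)\<rparr>"


section \<open>\<open>I\<close>-systems\<close>

text \<open>
  The set of regular indices is the complement of \<open>Free\<close> in \<open>Idx\<close>. All groups \<open>\<widehat>G\<^sub>i\<close> are
  realised inside pairs of type \<^typ>\<open>int \<times> 'g\<close>: \<open>\<int> \<times> G\<^sub>i\<close> for free \<open>i\<close>, and \<open>{0} \<times> G\<^sub>i\<close>, standing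
  for \<open>G\<^sub>i\<close>, for regular \<open>i\<close>. In both cases \<open>G\<^sub>i\<close> sits in \<open>\<widehat>G\<^sub>i\<close> as \<open>{0} \<times> G\<^sub>i\<close>.
  The map \<open>\<phi>\<^sub>j\<^sub>i : M\<^sub>i \<rightarrow> G\<^sub>j\<close> for \<open>i < j\<close> is \<open>Phi J j i\<close>.
\<close>

record ('i, 'g) isystem =
  Idx :: "'i set"
  Le :: "'i \<Rightarrow> 'i \<Rightarrow> bool"
  Free :: "'i set"
  Grp :: "'i \<Rightarrow> 'g monoid"
  Phi :: "'i \<Rightarrow> 'i \<Rightarrow> int \<times> 'g \<Rightarrow> 'g"

definition Lt :: "('i, 'g) isystem \<Rightarrow> 'i \<Rightarrow> 'i \<Rightarrow> bool"
  where "Lt J i j \<longleftrightarrow> Le J i j \<and> i \<noteq> j"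

definition Ghat :: "('i, 'g) isystem \<Rightarrow> 'i \<Rightarrow> (int \<times> 'g) monoid"
  where "Ghat J i = (if i \<in> Free J then integer_group else singleton_group 0) \<times>\<times> Grp J i"

definition Msemi :: "('i, 'g) isystem \<Rightarrow> 'i \<Rightarrow> (int \<times> 'g) set"
  where "Msemi J i = (if i \<in> Free J then {1..} else {0}) \<times> carrier (Grp J i)"

text \<open>
  \<open>Phi_ext J j i\<close> is the unique extension of \<open>\<phi>\<^sub>j\<^sub>i\<close> to a group homomorphism \<open>\<widehat>G\<^sub>i \<rightarrow> G\<^sub>j\<close>, and
  \<open>Phi_hat J j i\<close> is that extension followed by the inclusion \<open>G\<^sub>j \<subseteq> \<widehat>G\<^sub>j\<close>.
\<close>

definition Phi_ext :: "('i, 'g) isystem \<Rightarrow> 'i \<Rightarrow> 'i \<Rightarrow> int \<times> 'g \<Rightarrow> 'g"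
  where "Phi_ext J j i = (THE h. h \<in> hom (Ghat J i) (Grp J j) \<and>
    h \<in> extensional (carrier (Ghat J i)) \<and> (\<forall>x\<in>Msemi J i. h x = Phi J j i x))"

definition Phi_hat :: "('i, 'g) isystem \<Rightarrow> 'i \<Rightarrow> 'i \<Rightarrow> int \<times> 'g \<Rightarrow> int \<times> 'g"
  where "Phi_hat J j i u = (if i = j then u else (0, Phi_ext J j i u))"

definition is_isystem :: "('i, 'g) isystem \<Rightarrow> bool"
  where "is_isystem J \<longleftrightarrow>
    reflp_on (Idx J) (Le J) \<and> antisymp_on (Idx J) (Le J) \<and> transp_on (Idx J) (Le J) \<and>
    Free J \<subseteq> Idx J \<and>
    (\<forall>i\<in>Idx J. comm_group (Grp J i)) \<and>
    (\<forall>i\<in>Idx J. \<forall>j\<in>Idx J. Lt J i j \<longrightarrow>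
      Phi J j i \<in> hom ((Ghat J i)\<lparr>carrier := Msemi J i\<rparr>) (Grp J j)) \<and>
    (\<forall>i\<in>Idx J. \<forall>j\<in>Idx J. \<forall>k\<in>Idx J. Le J i j \<longrightarrow> Le J j k \<longrightarrow>
      (\<forall>u\<in>carrier (Ghat J i). Phi_hat J k j (Phi_hat J j i u) = Phi_hat J k i u)) \<and>
    (\<forall>i\<in>Free J. \<forall>g\<in>carrier (Grp J i). \<exists>(n::nat) s.
      (\<forall>l<n. \<exists>k\<in>Idx J. Lt J k i \<and> s l \<in> Phi J i k ` Msemi J k) \<and>
      g = finprod (Grp J i) s {..<n})"


section \<open>The monoid of an \<open>I\<close>-system\<close>

definition Max_elts :: "('i, 'g) isystem \<Rightarrow> 'i set \<Rightarrow> 'i set"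
  where "Max_elts J a = {i\<in>a. \<forall>j\<in>a. Le J i j \<longrightarrow> j = i}"

definition lower_sets :: "('i, 'g) isystem \<Rightarrow> 'i set set"
  where "lower_sets J = {a. a \<subseteq> Idx J \<and> (\<forall>i\<in>a. \<forall>k\<in>Idx J. Le J k i \<longrightarrow> k \<in> a) \<and>
    finite (Max_elts J a) \<and> (\<forall>i\<in>a. \<exists>j\<in>Max_elts J a. Le J i j)}"

definition Hhat :: "('i, 'g) isystem \<Rightarrow> 'i set \<Rightarrow> ('i \<Rightarrow> int \<times> 'g) monoid"
  where "Hhat J a = sum_group a (Ghat J)"

definition chi :: "('i, 'g) isystem \<Rightarrow> 'i set \<Rightarrow> 'i \<Rightarrow> int \<times> 'g \<Rightarrow> 'i \<Rightarrow> int \<times> 'g"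
  where "chi J a i u = (\<lambda>k\<in>a. if k = i then u else \<one>\<^bsub>Ghat J k\<^esub>)"

definition Usub :: "('i, 'g) isystem \<Rightarrow> 'i set \<Rightarrow> ('i \<Rightarrow> int \<times> 'g) set"
  where "Usub J a = generate (Hhat J a)
    {chi J a i u \<otimes>\<^bsub>Hhat J a\<^esub> inv\<^bsub>Hhat J a\<^esub> (chi J a j (Phi_hat J j i u)) | i j u.
      i \<in> a \<and> j \<in> Max_elts J a \<and> Lt J i j \<and> u \<in> carrier (Ghat J i)}"

definition Hsemi :: "('i, 'g) isystem \<Rightarrow> 'i set \<Rightarrow> ('i \<Rightarrow> int \<times> 'g) set"
  where "Hsemi J a = {z \<in> carrier (Hhat J a). \<forall>i\<in>a \<inter> Free J.
    (if i \<in> Max_elts J a then z i \<in> {1..} \<times> carrier (Grp J i)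
     else z i \<in> {(0, \<one>\<^bsub>Grp J i\<^esub>)} \<union> {1..} \<times> carrier (Grp J i))}"

definition sim :: "('i, 'g) isystem \<Rightarrow> 'i set \<Rightarrow> (('i \<Rightarrow> int \<times> 'g) \<times> ('i \<Rightarrow> int \<times> 'g)) set"
  where "sim J a = {(x, y). x \<in> Hsemi J a \<and> y \<in> Hsemi J a \<and>
    x \<otimes>\<^bsub>Hhat J a\<^esub> inv\<^bsub>Hhat J a\<^esub> y \<in> Usub J a}"

definition emb :: "('i, 'g) isystem \<Rightarrow> 'i set \<Rightarrow> 'i set \<Rightarrow> ('i \<Rightarrow> int \<times> 'g) \<Rightarrow> 'i \<Rightarrow> int \<times> 'g"
  where "emb J a b x = (\<lambda>k\<in>b. if k \<in> a then x k else \<one>\<^bsub>Ghat J k\<^esub>)"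

text \<open>
  The disjoint union of the components \<open>M\<^sub>a = H\<^sub>a/\<sim>\<close> is realised by tagging each class with \<open>a\<close>.
\<close>

definition cls :: "('i, 'g) isystem \<Rightarrow> 'i set \<Rightarrow> ('i \<Rightarrow> int \<times> 'g) \<Rightarrow> 'i set \<times> ('i \<Rightarrow> int \<times> 'g) set"
  where "cls J a x = (a, sim J a `` {x})"

definition sys_monoid :: "('i, 'g) isystem \<Rightarrow> ('i set \<times> ('i \<Rightarrow> int \<times> 'g) set) monoid"
  where "sys_monoid J = \<lparr>
    carrier = (SIGMA a:lower_sets J. Hsemi J a // sim J a),
    monoid.mult = (\<lambda>(a, X) (b, Y). (a \<union> b, \<Union>x\<in>X. \<Union>y\<in>Y.
      sim J (a \<union> b) `` {emb J a (a \<union> b) x \<otimes>\<^bsub>Hhat J (a \<union> b)\<^esub> emb J b (a \<union> b) y})),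
    one = cls J {} \<one>\<^bsub>Hhat J {}\<^esub>\<rparr>"

text \<open>The canonical map \<open>M\<^sub>i \<rightarrow> M(J)\<close> onto the component of the principal lower set of \<open>i\<close>.\<close>

definition down :: "('i, 'g) isystem \<Rightarrow> 'i \<Rightarrow> 'i set"
  where "down J i = {k\<in>Idx J. Le J k i}"

definition gen_elt :: "('i, 'g) isystem \<Rightarrow> 'i \<Rightarrow> int \<times> 'g \<Rightarrow> 'i set \<times> ('i \<Rightarrow> int \<times> 'g) set"
  where "gen_elt J i u = cls J (down J i) (chi J (down J i) i u)"


section \<open>The system of a monoid\<close>

text \<open>
  Representatives of the primes of the antisymmetric quotient; they are automatically prime in
  \<open>M\<close>.
\<close>

definition prime_reps :: "'a::comm_monoid_add set \<Rightarrow> bool"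
  where "prime_reps P \<longleftrightarrow> bij_betw bar P {c :: 'a antisym_quot. prime_elt c} \<and>
    (\<forall>p\<in>P. regular_elt p \<longrightarrow> p + p = p)"

text \<open>
  The groups of the system consist of elements of \<open>M\<close> (regular case) or of a Grothendieck group
  (free case), and \<open>Inl\<close> and \<open>Inr\<close> put them in one type. A regular representative \<open>p\<close> is idempotent
  and is the identity of the group \<open>M\<^sub>p\<close>.
\<close>

type_synonym 'a grp_elt = "'a + ('a \<times> 'a) set"

definition Gfree :: "'a::comm_monoid_add \<Rightarrow> ('a \<times> 'a) set monoid"
  where "Gfree p = (groth (arch_comp p))
    \<lparr>carrier := {gdiff (arch_comp p) (p + \<alpha>) p | \<alpha>. p + \<alpha> \<preceq> p}\<rparr>"

definition Greg :: "'a::comm_monoid_add \<Rightarrow> 'a monoid"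
  where "Greg p = \<lparr>carrier = arch_comp p, monoid.mult = (+), one = p\<rparr>"

definition Gprime :: "'a::comm_monoid_add \<Rightarrow> 'a grp_elt monoid"
  where "Gprime p = (if free_elt p then image_group Inr (Gfree p) else image_group Inl (Greg p))"

text \<open>
  The identification of the semigroup \<open>M\<^sub>p\<close> of the system (a set of pairs, see above) with the
  archimedian component of \<open>p\<close> in \<open>M\<close>: it sends \<open>(n, (p + \<alpha>) - p)\<close> to \<open>n p + \<alpha>\<close> for \<open>p\<close> free and
  \<open>(0, x)\<close> to \<open>x\<close> for \<open>p\<close> regular.
\<close>

fun ident :: "'a::comm_monoid_add \<Rightarrow> int \<times> 'a grp_elt \<Rightarrow> 'a"
  where
    "ident p (n, Inr g) = (THE y. \<exists>\<alpha>. p + \<alpha> \<preceq> p \<and> g = gdiff (arch_comp p) (p + \<alpha>) p \<and>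
        y = nmult (nat n) p + \<alpha>)"
  | "ident p (n, Inl x) = x"

text \<open>
  \<open>\<phi>\<^sub>p\<^sub>q(x) = (p + x) - p\<close>; for \<open>p\<close> regular, the difference is taken in the group \<open>M\<^sub>p\<close> itself.
\<close>

definition Phi_prime :: "'a::comm_monoid_add \<Rightarrow> 'a \<Rightarrow> int \<times> 'a grp_elt \<Rightarrow> 'a grp_elt"
  where "Phi_prime p q u =
    (if free_elt p then Inr (gdiff (arch_comp p) (p + ident q u) p)
     else Inl ((p + ident q u) \<otimes>\<^bsub>Greg p\<^esub> inv\<^bsub>Greg p\<^esub> p))"

definition sys_of :: "'a::comm_monoid_add set \<Rightarrow> ('a, 'a grp_elt) isystem"
  where "sys_of P = \<lparr>Idx = P, Le = le_star, Free = {p\<in>P. free_elt p},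
    Grp = Gprime, Phi = Phi_prime\<rparr>"

end

theory Submission
  imports Defs
begin

text \<open>
  In a refinement monoid every prime \<open>p\<close> is free or regular, and \<open>p\<close> can be cancelled from
  \<open>p + x = p + y\<close> when \<open>p \<le> x\<close> and \<open>p \<le> y\<close>. Hence \<open>G\<^sub>p\<close> is the quotient of the ideal
  \<open>{\<alpha>. p + \<alpha> \<le> p}\<close> by the relation \<open>p + \<alpha> = p + \<beta>\<close>, for free and regular \<open>p\<close> alike.

  For \<open>a \<in> A(I)\<close>, evaluate \<open>z \<in> H\<^sub>a\<close> in \<open>M\<close> by adding up its components. The congruence \<open>\<sim>\<close> on
  \<open>H\<^sub>a\<close> is exactly the kernel of this evaluation. If \<open>x - y \<in> U\<^sub>a\<close>, then \<open>x\<close> and \<open>y\<close> have the same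
  value because the archimedian component containing the values of \<open>H\<^sub>a\<close> is cancellative. Conversely,
  sending an element of \<open>M\<^sub>p\<close> to its class in \<open>\<widehat>H\<^sub>a/U\<^sub>a\<close> is additive along every decomposition of that
  element into elements of components \<open>M\<^sub>q\<close> with \<open>q \<le> p\<close>; by refinement it extends to sums, so the
  value of \<open>z\<close> determines its class. Finally \<open>a\<close> is recovered from the value \<open>x\<close> of \<open>z\<close> as the set of
  primes below \<open>x\<close>, and every element of \<open>M\<close> is a value since \<open>M\<close> is primely generated.
\<close>

section \<open>Prime elements of refinement monoids\<close>

text \<open>Adding up all components makes no sense when \<open>a\<close> is infinite: at a regular
  index the neutral coordinate is a nonzero idempotent of M. The sum therefore runs over the maximal
  indices and the indices with non-neutral coordinate, a finite set; whatever is left out is 0 or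
  lies below a maximal index and is absorbed. Conversely, a coordinate of degree at most 0 at a free
  index, unless neutral, names no element of M. Statements about the extended maps and about
  \<open>U_a\<close> are therefore shifted into M_p or \<open>H_a\<close> by adding an element of
  sufficient degree, and the shift is cancelled afterwards. Cancellation is possible because every
  value of \<open>H_a\<close> lies between e and a multiple of e, where e is the sum of the maximal
  indices. Additivity along a decomposition of an element of M_p rests on the primality of p: one
  summand must lie in M_p itself, and the others enter it through the maps phi, which are the
  identifications that generate \<open>U_a\<close>.\<close>

lemma alg_leI: "y = x + z \<Longrightarrow> x \<preceq> y"
  unfolding alg_le_def by blast

lemma alg_leE: assumes "x \<preceq> y" obtains z where "y = x + z"
  using assms unfolding alg_le_def by blast

lemma zero_alg_le: "0 \<preceq> x"
  unfolding alg_le_def by (metis add_0_left)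

lemma alg_le_add_right: "x \<preceq> y \<Longrightarrow> x \<preceq> y + z"
  unfolding alg_le_def by (metis add.assoc)

lemma alg_le_add_left: "x \<preceq> y \<Longrightarrow> x \<preceq> z + y"
  using alg_le_add_right by (metis add.commute)

lemma nmult_0 [simp]: "nmult 0 x = 0"
  by (simp add: nmult_def)

lemma nmult_Suc [simp]: "nmult (Suc n) x = x + nmult n x"
  by (simp add: nmult_def add.commute)

lemma nmult_add: "nmult (m + n) x = nmult m x + nmult n x"
  by (induction m) (auto simp: add.assoc)

lemma nmult_mono_left: "m \<le> n \<Longrightarrow> nmult m x \<preceq> nmult n x"
  by (rule alg_leI[of _ _ "nmult (n - m) x"]) (simp flip: nmult_add)

lemma nmult_mono: "x \<preceq> y \<Longrightarrow> nmult n x \<preceq> nmult n y"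
  by (induction n) (auto intro: alg_le_add_mono alg_le_refl)

lemma self_alg_le_nmult: "0 < n \<Longrightarrow> x \<preceq> nmult n x"
  by (cases n) (auto intro: alg_leI)

lemma summand_alg_le_sum:
  assumes "finite T" "i \<in> T"
  shows "f i \<preceq> sum f T"
  using sum.remove[OF assms] by (metis alg_leI)

lemma summand_alg_le_sum_list: "x \<in> set xs \<Longrightarrow> x \<preceq> sum_list xs"
  by (induction xs) (auto intro: alg_leI alg_le_add_left)

section \<open>Order and primes of the antisymmetric quotient\<close>

text \<open>An equation \<open>bar y = bar (x + z)\<close> already contains
  \<open>x + z \<preceq> y\<close>, and every class is of the form \<open>bar z\<close>. So the
  poset of primes can be handled with \<open>\<preceq>\<close> on representatives in M.\<close>

lemma bar_alg_le_iff: "bar x \<preceq> bar y \<longleftrightarrow> x \<preceq> y"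
proof
  assume "bar x \<preceq> bar y"
  then obtain c where "bar y = bar x + c" by (rule alg_leE)
  moreover obtain z where "c = bar z"
    by (metis Quotient3_antisym_quot Quotient3_abs_rep)
  ultimately have "bar y = bar (x + z)"
    by (simp add: plus_antisym_quot.abs_eq)
  then have "x + z \<preceq> y"
    by (simp add: antisym_quot.abs_eq_iff alg_equiv_def)
  then show "x \<preceq> y"
    by (meson alg_leI alg_le_trans)
next
  assume "x \<preceq> y"
  then show "bar x \<preceq> bar y"
    by (metis alg_leE alg_leI plus_antisym_quot.abs_eq)
qed

lemma bar_eq_iff: "bar x = bar y \<longleftrightarrow> x \<preceq> y \<and> y \<preceq> x"
  by (simp add: antisym_quot.abs_eq_iff alg_equiv_def)

lemma bar_surj: obtains x where "c = bar x"
  by (metis Quotient3_antisym_quot Quotient3_abs_rep)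

lemma invertible_elt_iff: "invertible_elt x \<longleftrightarrow> x \<preceq> 0"
  unfolding invertible_elt_def alg_le_def by metis

lemma prime_elt_bar_iff: "prime_elt (bar p) \<longleftrightarrow> prime_elt p"
proof -
  have "invertible_elt (bar p) \<longleftrightarrow> invertible_elt p"
    by (simp add: invertible_elt_iff zero_antisym_quot_def bar_alg_le_iff)
  moreover have "(\<forall>a b. bar p \<preceq> a + b \<longrightarrow> bar p \<preceq> a \<or> bar p \<preceq> b) \<longleftrightarrow>
      (\<forall>a b. p \<preceq> a + b \<longrightarrow> p \<preceq> a \<or> p \<preceq> b)"
    by (metis bar_surj bar_alg_le_iff plus_antisym_quot.abs_eq)
  ultimately show ?thesis
    by (simp add: prime_elt_def)
qed

lemma prime_elt_add: "prime_elt p \<Longrightarrow> p \<preceq> a + b \<Longrightarrow> p \<preceq> a \<or> p \<preceq> b"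
  unfolding prime_elt_def by blast

lemma prime_elt_not_le_0: "prime_elt p \<Longrightarrow> \<not> p \<preceq> 0"
  unfolding prime_elt_def invertible_elt_iff by blast

lemma prime_elt_nmult: "prime_elt p \<Longrightarrow> p \<preceq> nmult n x \<Longrightarrow> p \<preceq> x"
  by (induction n) (auto dest: prime_elt_not_le_0 prime_elt_add)

lemma prime_elt_sum_list: "prime_elt p \<Longrightarrow> p \<preceq> sum_list xs \<Longrightarrow> \<exists>x\<in>set xs. p \<preceq> x"
  by (induction xs) (auto dest: prime_elt_not_le_0 prime_elt_add)

lemma prime_elt_sum: "prime_elt p \<Longrightarrow> finite T \<Longrightarrow> p \<preceq> sum f T \<Longrightarrow> \<exists>i\<in>T. p \<preceq> f i"
  by (induction T rule: infinite_finite_induct) (auto dest: prime_elt_not_le_0 prime_elt_add)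

lemma regular_elt_iff: "regular_elt x \<longleftrightarrow> x + x \<preceq> x"
  by (simp add: regular_elt_def numeral_2_eq_2)

section \<open>Refinement applied to multiples of a prime\<close>

lemma refinementE:
  assumes "refinement_monoid TYPE('a::comm_monoid_add)" "(a::'a) + b = c + d"
  obtains w x y z where "a = w + x" "b = y + z" "c = w + y" "d = x + z"
  using assms unfolding refinement_monoid_def by meson

lemma riesz_decomposition:
  assumes "refinement_monoid TYPE('a::comm_monoid_add)" "(x::'a) \<preceq> y + z"
  obtains u v where "x = u + v" "u \<preceq> y" "v \<preceq> z"
proof -
  obtain c where "x + c = y + z" using assms(2) by (metis alg_leE)
  then obtain w s t u where "x = w + s" "y = w + t" "z = s + u"
    using refinementE[OF assms(1)] by metis
  with that[of w s] show thesis by (metis alg_leI add.commute)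
qed

text \<open>Copies of \<open>p\<close> are distributed one at a time: refinement cuts a copy into
  \<open>w + s\<close> with \<open>w\<close> below \<open>y\<close> and \<open>s\<close> below
  \<open>z\<close>, and primality puts \<open>p\<close> itself below one of the two pieces.\<close>

lemma nmult_prime_le_add:
  assumes ref: "refinement_monoid TYPE('a::comm_monoid_add)" and p: "prime_elt (p::'a)"
    and "nmult m p \<preceq> y + z"
  shows "\<exists>i j. i + j = m \<and> nmult i p \<preceq> y \<and> nmult j p \<preceq> z"
  using assms(3)
proof (induction m arbitrary: y z)
  case 0
  then show ?case by (auto intro: zero_alg_le)
next
  case (Suc m)
  then obtain c where "p + (nmult m p + c) = y + z"
    by (metis alg_leE nmult_Suc add.assoc)
  then obtain w s t v where eqs: "p = w + s" "nmult m p + c = t + v" "y = w + t" "z = s + v"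
    using refinementE[OF ref] by metis
  then obtain i j where ij: "i + j = m" "nmult i p \<preceq> t" "nmult j p \<preceq> v"
    using Suc.IH by (metis alg_leI)
  have "p \<preceq> w \<or> p \<preceq> s"
    using eqs(1) p prime_elt_add alg_le_refl by metis
  then show ?case
  proof
    assume "p \<preceq> w"
    then have "nmult (Suc i) p \<preceq> y" "nmult j p \<preceq> z"
      using ij eqs by (auto intro: alg_le_add_mono alg_le_add_left)
    then show ?thesis using ij by (metis add_Suc)
  next
    assume "p \<preceq> s"
    then have "nmult i p \<preceq> y" "nmult (Suc j) p \<preceq> z"
      using ij eqs by (auto intro: alg_le_add_mono alg_le_add_left)
    then show ?thesis using ij by (metis add_Suc_right)
  qed
qed

text \<open>Descent on \<open>m\<close>. One copy of \<open>p\<close> cannot simply be cancelled on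
  both sides, so the equation is refined, and the copies of \<open>p\<close> in the other summand
  are distributed between \<open>y\<close>, which is below \<open>p\<close>, and \<open>z\<close>,
  which is below \<open>?b\<close>.\<close>

lemma regular_eltI_nmult:
  assumes ref: "refinement_monoid TYPE('a::comm_monoid_add)" and p: "prime_elt (p::'a)"
    and "nmult (Suc (Suc m)) p \<preceq> nmult (Suc m) p"
  shows "regular_elt p"
  using assms(3)
proof (induction m)
  case 0
  then show ?case by (simp add: regular_elt_iff)
next
  case (Suc k)
  let ?b = "nmult (Suc k) p"
  obtain c where "p + (nmult (Suc (Suc k)) p + c) = p + ?b"
    using Suc.prems by (metis alg_leE nmult_Suc add.assoc)
  then obtain w x y z where eqs: "p = w + x" "nmult (Suc (Suc k)) p + c = y + z" "p = w + y" "?b = x + z"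
    using refinementE[OF ref] by metis
  then obtain i j where ij: "i + j = Suc (Suc k)" "nmult i p \<preceq> y" "nmult j p \<preceq> z"
    using nmult_prime_le_add[OF ref p] by (metis alg_leI)
  have y: "y \<preceq> p" and z: "z \<preceq> ?b"
    using eqs by (metis alg_leI add.commute)+
  \<comment> \<open>No copy in \<open>y\<close> gives the inequality for \<open>k\<close>; two
    copies give \<open>2p \<preceq> p\<close> at once. Exactly one copy leaves
    \<open>p \<preceq> y\<close> and \<open>?b \<preceq> z\<close>, and then it matters which half
    of \<open>p = w + x\<close> contains \<open>p\<close>.\<close>
  consider "i = 0" | "i = 1" | "2 \<le> i" by linarith
  then show ?case
  proof cases
    case 1
    then show ?thesis using Suc.IH ij z alg_le_trans by (metis add_0)
  next
    case 3
    then have "nmult 2 p \<preceq> p"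
      using ij y nmult_mono_left alg_le_trans by metis
    then show ?thesis by (simp add: regular_elt_def)
  next
    case 2
    then have py: "p \<preceq> y" and bz: "?b \<preceq> z"
      using ij by (auto simp: numeral_eq_Suc)
    have "p \<preceq> w \<or> p \<preceq> x"
      using eqs(1) p prime_elt_add alg_le_refl by metis
    then show ?thesis
    proof
      assume "p \<preceq> w"
      then have "p + p \<preceq> p" using py eqs(3) alg_le_add_mono by metis
      then show ?thesis by (simp add: regular_elt_iff)
    next
      assume "p \<preceq> x"
      then have "p + ?b \<preceq> ?b" using bz eqs(4) alg_le_add_mono by metis
      then show ?thesis using Suc.IH by simp
    qed
  qed
qed

lemma prime_free_or_regular:
  assumes ref: "refinement_monoid TYPE('a::comm_monoid_add)" and p: "prime_elt (p::'a)"
  shows "free_elt p \<or> regular_elt p"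
proof (rule disjCI)
  assume "\<not> regular_elt p"
  show "free_elt p"
    unfolding free_elt_def
  proof (intro allI impI, rule ccontr)
    fix n m :: nat
    assume *: "0 < n" "0 < m" "nmult n p \<preceq> nmult m p" "\<not> n \<le> m"
    then have "nmult (Suc m) p \<preceq> nmult m p"
      using nmult_mono_left[of "Suc m" n p] alg_le_trans by fastforce
    with * have "regular_elt p"
      using regular_eltI_nmult[OF ref p, of "m - 1"] by (cases m) auto
    with \<open>\<not> regular_elt p\<close> show False ..
  qed
qed

lemma free_not_regular: "free_elt p \<Longrightarrow> \<not> regular_elt p"
proof
  assume "free_elt p" "regular_elt p"
  then have "(2::nat) \<le> 1"
    unfolding free_elt_def regular_elt_def
    by (metis One_nat_def add_0_right nmult_0 nmult_Suc zero_less_numeral zero_less_one)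
  then show False by simp
qed

text \<open>As \<open>2p\<close> is not below \<open>p\<close>, each decomposition of
  \<open>p\<close> in the refinement has exactly one part above \<open>p\<close>. If this is the
  common part \<open>w\<close>, then \<open>p + s = p + t\<close>, and the copy of \<open>p\<close>
  needed to use this is found in \<open>z\<close>. Otherwise \<open>s\<close> and \<open>t\<close>
  both contain \<open>p\<close>, and the same computation gives \<open>s = t\<close>.\<close>

lemma prime_cancel_free:
  assumes ref: "refinement_monoid TYPE('a::comm_monoid_add)" and p: "prime_elt (p::'a)"
    and nreg: "\<not> regular_elt p" and eq: "p + x = p + y" and px: "p \<preceq> x" and py: "p \<preceq> y"
  shows "x = y"
proof -
  obtain w s t z where e: "p = w + s" "x = t + z" "p = w + t" "y = s + z"
    using refinementE[OF ref eq] by metis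
  have no2: "\<not> p + p \<preceq> p" using nreg by (simp add: regular_elt_iff)
  have "p \<preceq> w \<or> p \<preceq> s"
    using e(1) p prime_elt_add alg_le_refl by metis
  then show ?thesis
  proof
    assume w: "p \<preceq> w"
    then obtain c where c: "w = p + c" by (rule alg_leE)
    have "\<not> p \<preceq> t"
      using w no2 e(3) alg_le_add_mono by metis
    then have "p \<preceq> z"
      using px e(2) p prime_elt_add by metis
    then obtain z' where z': "z = p + z'" by (rule alg_leE)
    have 1: "p = p + c + s" and 2: "p = p + c + t"
      using e(1,3) unfolding c .
    have "p + s = (p + c + t) + s" by (rule arg_cong[OF 2, of "\<lambda>u. u + s"])
    also have "\<dots> = (p + c + s) + t" by (simp add: ac_simps)
    also have "\<dots> = p + t" by (rule arg_cong[OF 1[symmetric], of "\<lambda>u. u + t"])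
    finally have "p + s = p + t" .
    then have "t + (p + z') = s + (p + z')"
      by (metis add.assoc add.commute)
    then show ?thesis unfolding e(2,4) z' .
  next
    assume s: "p \<preceq> s"
    show ?thesis
    proof (cases "p \<preceq> t")
      case True
      obtain s' where s': "s = p + s'" using s by (rule alg_leE)
      obtain t' where t': "t = p + t'" using True by (rule alg_leE)
      have 1: "p = w + (p + s')" and 2: "p = w + (p + t')"
        using e(1,3) unfolding s' t' .
      have "p + t' = (w + (p + s')) + t'" by (rule arg_cong[OF 1, of "\<lambda>u. u + t'"])
      also have "\<dots> = (w + (p + t')) + s'" by (simp add: ac_simps)
      also have "\<dots> = p + s'" by (rule arg_cong[OF 2[symmetric], of "\<lambda>u. u + s'"])
      finally show ?thesis unfolding e(2,4) s' t' by simp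
    next
      case False
      then have "p \<preceq> w" using e(3) p prime_elt_add alg_le_refl by metis
      then show ?thesis using s e(1) no2 alg_le_add_mono by metis
    qed
  qed
qed

lemma nmult_cancel:
  assumes cancel: "\<And>x y. p + x = p + y \<Longrightarrow> p \<preceq> x \<Longrightarrow> p \<preceq> y \<Longrightarrow> x = y"
    and "nmult n p + x = nmult n p + y" "p \<preceq> x" "p \<preceq> y"
  shows "x = y"
  using assms(2)
proof (induction n)
  case (Suc n)
  then have "p + (nmult n p + x) = p + (nmult n p + y)" by (simp add: ac_simps)
  then have "nmult n p + x = nmult n p + y"
    using cancel assms(3,4) alg_le_add_left by blast
  then show ?case by (rule Suc.IH)
qed simp

section \<open>Representatives of the primes: order, cancellation, absorption\<close>

locale prime_system =
  fixes P :: "'a::comm_monoid_add set"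
  assumes conical: "conical TYPE('a)"
    and refinement: "refinement_monoid TYPE('a)"
    and primely_generated: "primely_generated TYPE('a)"
    and prime_reps: "prime_reps P"
begin

lemma le_zero: "(x::'a) \<preceq> 0 \<Longrightarrow> x = 0"
  using conical unfolding conical_def alg_le_def by metis

lemma sum_of_primes: obtains ps where "\<forall>p\<in>set ps. prime_elt (p::'a)" "x = sum_list ps"
proof (cases "x = 0")
  case True
  then show thesis using that[of "[]"] by simp
next
  case False
  then have "\<not> invertible_elt x" using le_zero invertible_elt_iff by blast
  then show thesis using that primely_generated unfolding primely_generated_def by metis
qed

lemma rep_prime: "p \<in> P \<Longrightarrow> prime_elt p"
  using prime_reps prime_elt_bar_iff unfolding prime_reps_def bij_betw_def by blast

lemma rep_exists:
  assumes "prime_elt (q::'a)"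
  obtains p where "p \<in> P" "p \<preceq> q" "q \<preceq> p"
proof -
  have "bar q \<in> bar ` P"
    using assms prime_reps unfolding prime_reps_def bij_betw_def by (simp add: prime_elt_bar_iff)
  then show thesis using that by (auto simp: bar_eq_iff)
qed

lemma rep_unique: "p \<in> P \<Longrightarrow> q \<in> P \<Longrightarrow> p \<preceq> q \<Longrightarrow> q \<preceq> p \<Longrightarrow> p = q"
  using prime_reps unfolding prime_reps_def bij_betw_def
  by (metis bar_eq_iff inj_on_def)

lemma lt_star_iff: "p \<in> P \<Longrightarrow> q \<in> P \<Longrightarrow> lt_star p q \<longleftrightarrow> p \<preceq> q \<and> p \<noteq> q"
  unfolding lt_star_def by (metis bar_alg_le_iff bar_eq_iff rep_unique)

lemma le_star_iff: "p \<in> P \<Longrightarrow> q \<in> P \<Longrightarrow> le_star p q \<longleftrightarrow> p \<preceq> q"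
  unfolding le_star_def by (metis lt_star_iff alg_le_refl)

lemma not_free_idem: "p \<in> P \<Longrightarrow> \<not> free_elt p \<Longrightarrow> p + p = p"
  using prime_free_or_regular[OF refinement rep_prime] prime_reps
  unfolding prime_reps_def by blast

lemma free_not_double: "free_elt (p::'a) \<Longrightarrow> \<not> p + p \<preceq> p"
  using free_not_regular regular_elt_iff by blast

lemma idem_absorb: assumes "(p::'a) + p = p" "p \<preceq> x" shows "p + x = x"
  using assms by (metis add.assoc alg_leE)

text \<open>The lower bounds on \<open>x\<close> and \<open>y\<close> are essential: an idempotent
  \<open>p\<close> satisfies \<open>p + 0 = p + p\<close>. With them, an idempotent \<open>p\<close>
  is absorbed on both sides.\<close>

lemma rep_cancel:
  assumes "p \<in> P" "p + x = p + y" "p \<preceq> x" "p \<preceq> y"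
  shows "x = y"
proof (cases "free_elt p")
  case True
  then show ?thesis
    using prime_cancel_free[OF refinement rep_prime] assms free_not_regular by blast
next
  case False
  then show ?thesis using assms not_free_idem idem_absorb by metis
qed

lemma reps_cancel:
  assumes "finite T" "f ` T \<subseteq> P" "sum f T + x = sum f T + y" "\<forall>i\<in>T. f i \<preceq> x \<and> f i \<preceq> y"
  shows "x = y"
  using assms
proof (induction T)
  case (insert i T)
  then have "f i + (sum f T + x) = f i + (sum f T + y)" by (simp add: ac_simps)
  then have "sum f T + x = sum f T + y"
    using rep_cancel insert.prems by (metis image_insert insert_subset insertI1 alg_le_add_left)
  then show ?case using insert by simp
qed simp

text \<open>The order ideal \<open>absorbed p\<close> surjects onto \<open>G\<^sub>p\<close> via \<open>\<alpha> \<mapsto> (p + \<alpha>) - p\<close>.\<close>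

definition absorbed :: "'a \<Rightarrow> 'a set"
  where "absorbed p = {x. p + x \<preceq> p}"

lemma absorbed_0 [simp]: "0 \<in> absorbed p"
  by (simp add: absorbed_def alg_le_refl)

lemma absorbed_add: "x \<in> absorbed p \<Longrightarrow> y \<in> absorbed p \<Longrightarrow> x + y \<in> absorbed p"
  unfolding absorbed_def mem_Collect_eq
  by (metis add.assoc alg_le_add_mono alg_le_refl alg_le_trans)

lemma absorbed_mono: "x \<preceq> y \<Longrightarrow> y \<in> absorbed p \<Longrightarrow> x \<in> absorbed p"
  unfolding absorbed_def mem_Collect_eq by (meson alg_le_add_mono alg_le_refl alg_le_trans)

lemma absorbed_nmult: "x \<in> absorbed p \<Longrightarrow> nmult n x \<in> absorbed p"
  by (induction n) (auto intro: absorbed_add)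

text \<open>In \<open>p = q + c\<close> primality puts \<open>p\<close> below \<open>q\<close> or
  below \<open>c\<close>; the first is excluded by uniqueness of representatives. Adding
  \<open>q\<close> to \<open>p \<preceq> c\<close> gives the bound.\<close>

lemma absorbed_lower:
  assumes "p \<in> P" "q \<in> P" "q \<preceq> p" "q \<noteq> p" shows "q \<in> absorbed p"
proof -
  obtain c where c: "p = q + c" using assms(3) by (rule alg_leE)
  then have "p \<preceq> q \<or> p \<preceq> c"
    using rep_prime[OF assms(1)] prime_elt_add alg_le_refl by metis
  then have "p \<preceq> c" using assms rep_unique by blast
  then have "q + p \<preceq> p" using c alg_le_add_mono alg_le_refl by metis
  then show ?thesis by (simp add: absorbed_def add.commute)
qed

text \<open>The complement \<open>c\<close> of \<open>p + x\<close> in \<open>p\<close> is again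
  absorbed; it represents the inverse of the class of \<open>x\<close> in G_p.\<close>

lemma absorbed_inverse:
  assumes "x \<in> absorbed p"
  obtains c where "c \<in> absorbed p" "p + (x + c) = p"
proof -
  obtain c where c: "p = p + x + c" using assms unfolding absorbed_def by (auto elim: alg_leE)
  then have "p + c + x = p" by (simp add: ac_simps)
  then have "p + c \<preceq> p" by (metis alg_leI)
  with that[of c] c show thesis by (simp add: absorbed_def add.assoc)
qed

lemma absorbed_not_ge: "free_elt p \<Longrightarrow> x \<in> absorbed p \<Longrightarrow> \<not> p \<preceq> x"
  using free_not_double unfolding absorbed_def mem_Collect_eq
  by (meson alg_le_add_mono alg_le_refl alg_le_trans)

text \<open>Riesz decomposition cuts \<open>x\<close> into pieces \<open>u\<close> below single
  copies of \<open>p\<close>. In \<open>p = u + b\<close> the prime \<open>p\<close> is not below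
  \<open>u\<close>, hence below \<open>b\<close>, and so \<open>u + p \<preceq> p\<close>.\<close>

lemma absorbed_of_le:
  assumes "p \<in> P" "x \<preceq> nmult m p" "\<not> p \<preceq> x" shows "x \<in> absorbed p"
  using assms(2,3)
proof (induction m arbitrary: x)
  case 0
  then show ?case by (auto dest: le_zero)
next
  case (Suc m)
  then obtain u v where uv: "x = u + v" "u \<preceq> p" "v \<preceq> nmult m p"
    using riesz_decomposition[OF refinement] by (metis nmult_Suc)
  then have nle: "\<not> p \<preceq> u" "\<not> p \<preceq> v"
    using Suc.prems alg_le_add_left alg_le_add_right by blast+
  obtain b where b: "p = u + b" using uv(2) by (rule alg_leE)
  then have "p \<preceq> b"
    using nle rep_prime[OF assms(1)] prime_elt_add alg_le_refl by metis
  then have "u + p \<preceq> p" using b alg_le_add_mono alg_le_refl by metis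
  then have "u \<in> absorbed p" by (simp add: absorbed_def add.commute)
  then show ?case using Suc.IH uv nle absorbed_add by simp
qed

section \<open>Archimedian components of primes: degree and absorbed part\<close>

definition base_mult :: "'a \<Rightarrow> int \<Rightarrow> 'a"
  where "base_mult p n = (if free_elt p then nmult (nat n) p else p)"

text \<open>The single degree 0 of a regular prime matches the trivial first factor of
  \<open>Ghat\<close>; \<open>base_mult\<close> ignores it and returns the idempotent.\<close>

definition degrees :: "'a \<Rightarrow> int set"
  where "degrees p = (if free_elt p then {1..} else {0})"

lemma base_mult_ge: "n \<in> degrees p \<Longrightarrow> p \<preceq> base_mult p n"
  by (auto simp: base_mult_def degrees_def alg_le_refl self_alg_le_nmult split: if_splits)

lemma base_mult_le: "n \<in> degrees p \<Longrightarrow> \<exists>m>0. base_mult p n \<preceq> nmult m p"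
  unfolding base_mult_def degrees_def
  by (cases "free_elt p"; force intro: exI[of _ "nat n"] exI[of _ 1] alg_le_refl)

lemma base_mult_add:
  "p \<in> P \<Longrightarrow> n \<in> degrees p \<Longrightarrow> m \<in> degrees p \<Longrightarrow> base_mult p (n + m) = base_mult p n + base_mult p m"
  by (auto simp: base_mult_def degrees_def not_free_idem nmult_add nat_add_distrib split: if_splits)

lemma base_mult_absorbed:
  assumes "n \<in> degrees p" "p + x = p + y"
  shows "base_mult p n + x = base_mult p n + y"
proof -
  obtain c where "base_mult p n = p + c" using assms(1) base_mult_ge alg_leE by metis
  then show ?thesis using assms(2) by (metis add.assoc add.commute)
qed

lemma arch_comp_iff: "p \<in> P \<Longrightarrow> x \<in> arch_comp p \<longleftrightarrow> p \<preceq> x \<and> (\<exists>m>0. x \<preceq> nmult m p)"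
  unfolding arch_comp_def
  using rep_prime prime_elt_nmult self_alg_le_nmult[of 1] by (auto 4 4)

text \<open>For free \<open>p\<close> the degree is the largest \<open>n\<close> with
  \<open>np \<preceq> x\<close>: the remainder is then not above \<open>p\<close>, hence absorbed.
  For regular \<open>p\<close> one has \<open>x \<preceq> p\<close> and \<open>x = p + x\<close>, so
  \<open>x\<close> is its own absorbed part.\<close>

lemma arch_comp_iff_absorbed:
  assumes p: "p \<in> P"
  shows "x \<in> arch_comp p \<longleftrightarrow> (\<exists>n\<in>degrees p. \<exists>\<alpha>\<in>absorbed p. x = base_mult p n + \<alpha>)"
proof
  assume "x \<in> arch_comp p"
  then obtain m where m: "p \<preceq> x" "0 < m" "x \<preceq> nmult m p" using arch_comp_iff[OF p] by blast
  show "\<exists>n\<in>degrees p. \<exists>\<alpha>\<in>absorbed p. x = base_mult p n + \<alpha>"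
  proof (cases "free_elt p")
    case True
    define n where "n = Greatest (\<lambda>n. nmult n p \<preceq> x)"
    have bound: "n \<le> m" if "nmult n p \<preceq> x" for n
    proof (cases "n = 0")
      case False
      then show ?thesis using True that m alg_le_trans unfolding free_elt_def by blast
    qed simp
    have n1: "nmult 1 p \<preceq> x" using m by simp
    have le: "nmult n p \<preceq> x"
      unfolding n_def by (rule GreatestI_nat[where P="\<lambda>n. nmult n p \<preceq> x", OF n1 bound])
    have ge: "1 \<le> n"
      unfolding n_def by (rule Greatest_le_nat[where P="\<lambda>n. nmult n p \<preceq> x", OF n1 bound])
    obtain \<alpha> where x: "x = nmult n p + \<alpha>" using le by (rule alg_leE)
    have "\<not> p \<preceq> \<alpha>"
    proof
      assume "p \<preceq> \<alpha>"
      then have "nmult (Suc n) p \<preceq> x"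
        using x by (simp add: add.commute alg_le_add_mono alg_le_refl)
      then have "Suc n \<le> n"
        unfolding n_def by (rule Greatest_le_nat[where P="\<lambda>n. nmult n p \<preceq> x", OF _ bound])
      then show False by simp
    qed
    moreover have "\<alpha> \<preceq> nmult m p" using m(3) x alg_le_trans alg_le_add_left alg_le_refl by blast
    ultimately have "\<alpha> \<in> absorbed p" using absorbed_of_le[OF p] by blast
    then show ?thesis
      using x ge True
      by (intro bexI[of _ "int n"] bexI[of _ \<alpha>]) (auto simp: base_mult_def degrees_def)
  next
    case False
    have "nmult k p = p" if "0 < k" for k
      using that by (induction k rule: nat_induct_non_zero) (auto simp: not_free_idem p False)
    then have "x \<preceq> p" using m by simp
    moreover have "p + x = x" using m(1) not_free_idem[OF p False] by (rule idem_absorb[rotated])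
    ultimately show ?thesis
      using False by (intro bexI[of _ 0] bexI[of _ x]) (auto simp: base_mult_def degrees_def absorbed_def)
  qed
next
  assume "\<exists>n\<in>degrees p. \<exists>\<alpha>\<in>absorbed p. x = base_mult p n + \<alpha>"
  then obtain n \<alpha> where x: "n \<in> degrees p" "\<alpha> \<in> absorbed p" "x = base_mult p n + \<alpha>" by blast
  obtain m where "base_mult p n \<preceq> nmult m p" using base_mult_le x(1) by blast
  moreover have "\<alpha> \<preceq> p"
    using x(2) unfolding absorbed_def mem_Collect_eq by (meson alg_le_trans alg_le_add_left alg_le_refl)
  ultimately have "x \<preceq> nmult (m + 1) p"
    unfolding x(3) nmult_add using alg_le_add_mono by force
  then show "x \<in> arch_comp p"
    using x base_mult_ge alg_le_add_right arch_comp_iff[OF p] by (metis add_gr_0 zero_less_one)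
qed

lemma arch_comp_add:
  assumes p: "p \<in> P" and x: "x \<in> arch_comp p" and y: "y \<in> arch_comp p"
  shows "x + y \<in> arch_comp p"
proof -
  obtain m n where "x \<preceq> nmult m p" "y \<preceq> nmult n p" "0 < m"
    using x y arch_comp_iff[OF p] by blast
  then have "x + y \<preceq> nmult (m + n) p" "0 < m + n"
    unfolding nmult_add by (auto intro: alg_le_add_mono)
  then show ?thesis using x arch_comp_iff[OF p] alg_le_add_right by blast
qed

lemma plus_absorbed_arch_comp: "p \<in> P \<Longrightarrow> \<alpha> \<in> absorbed p \<Longrightarrow> p + \<alpha> \<in> arch_comp p"
  unfolding arch_comp_iff_absorbed
  by (cases "free_elt p")
    (auto simp: base_mult_def degrees_def intro!: bexI[of _ "1::int"] bexI[of _ \<alpha>])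

lemma rep_arch_comp: "p \<in> P \<Longrightarrow> p \<in> arch_comp p"
  using plus_absorbed_arch_comp[of p 0] by simp

text \<open>Enlarging \<open>k\<close> to a multiple of \<open>p\<close> leaves only copies of
  \<open>p\<close> to be cancelled, one by one.\<close>

lemma arch_comp_cancel:
  assumes p: "p \<in> P" and k: "k \<in> arch_comp p" and x: "x \<in> arch_comp p" and y: "y \<in> arch_comp p"
    and eq: "x + k = y + k"
  shows "x = y"
proof -
  obtain m where "k \<preceq> nmult m p" using k arch_comp_iff[OF p] by blast
  then obtain c where "nmult m p = k + c" by (rule alg_leE)
  then have "nmult m p + x = nmult m p + y" using eq by (metis add.assoc add.commute)
  then show ?thesis
    using nmult_cancel[of p m x y] rep_cancel[OF p] x y arch_comp_iff[OF p] by blast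
qed

text \<open>For free \<open>p\<close>, \<open>n \<ge> 1\<close> and absorbed
  \<open>\<alpha>\<close>, the element \<open>np + \<alpha>\<close> is both above and below
  \<open>np\<close>, so freeness determines the degree; \<open>\<alpha>\<close> is determined only
  up to adding \<open>p\<close>.\<close>

lemma base_mult_eq_iff:
  assumes p: "p \<in> P" and "n \<in> degrees p" "m \<in> degrees p" "\<alpha> \<in> absorbed p" "\<beta> \<in> absorbed p"
  shows "base_mult p n + \<alpha> = base_mult p m + \<beta> \<longleftrightarrow> n = m \<and> p + \<alpha> = p + \<beta>"
proof
  assume eq: "base_mult p n + \<alpha> = base_mult p m + \<beta>"
  show "n = m \<and> p + \<alpha> = p + \<beta>"
  proof (cases "free_elt p")
    case True
    have le: "i \<le> j" if "0 < i" "0 < j" "\<gamma> \<in> absorbed p" "nmult i p + \<delta> = nmult j p + \<gamma>" for i j \<gamma> \<delta>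
    proof -
      obtain j' where "j = Suc j'" using \<open>0 < j\<close> by (cases j) auto
      then have "nmult j p + \<gamma> = nmult j' p + (p + \<gamma>)" by (simp add: ac_simps)
      also have "\<dots> \<preceq> nmult j' p + p"
        using that(3) by (auto simp: absorbed_def intro: alg_le_add_mono alg_le_refl)
      finally have "nmult j p + \<gamma> \<preceq> nmult j p" using \<open>j = Suc j'\<close> by (simp add: add.commute)
      then have "nmult i p \<preceq> nmult j p" using that(4) by (metis alg_leI alg_le_trans)
      then show ?thesis using True that unfolding free_elt_def by blast
    qed
    have nm: "nat n = nat m" "0 < nat n"
      using le[of "nat n" "nat m" \<beta> \<alpha>] le[of "nat m" "nat n" \<alpha> \<beta>] eq assms True
      by (auto simp: base_mult_def degrees_def)
    \<comment> \<open>\<open>k\<close> is one less than the degree: one copy of \<open>p\<close>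
      stays with \<open>\<alpha>\<close> and \<open>\<beta>\<close>, to supply the lower bounds that
      cancelling the other copies requires.\<close>
    obtain k where k: "nat n = Suc k" using nm(2) gr0_conv_Suc by blast
    have "nmult k p + (p + \<alpha>) = nmult k p + (p + \<beta>)"
      using eq True nm(1) k nmult_Suc[of k p] by (simp add: base_mult_def ac_simps del: nmult_Suc)
    then have "p + \<alpha> = p + \<beta>"
      using nmult_cancel[of p k "p + \<alpha>" "p + \<beta>"] rep_cancel[OF p] by (meson alg_leI)
    then show ?thesis using nm by auto
  next
    case False
    then show ?thesis using eq assms by (auto simp: base_mult_def degrees_def)
  qed
qed (use assms base_mult_absorbed in blast)

end

section \<open>The groups of the system\<close>

text \<open>Cancellation removes the auxiliary summand \<open>k\<close> of \<open>groth_rel\<close>,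
  so that equality of formal differences is equality of cross sums.\<close>

locale cancellative_subsemigroup =
  fixes S :: "'a::comm_monoid_add set"
  assumes add_closed: "x \<in> S \<Longrightarrow> y \<in> S \<Longrightarrow> x + y \<in> S"
    and cancel: "x \<in> S \<Longrightarrow> y \<in> S \<Longrightarrow> k \<in> S \<Longrightarrow> x + k = y + k \<Longrightarrow> x = y"
begin

lemma mem_gdiff_iff:
  assumes "x \<in> S" "y \<in> S"
  shows "(u, v) \<in> gdiff S x y \<longleftrightarrow> u \<in> S \<and> v \<in> S \<and> x + v = u + y"
proof -
  have "(\<exists>k\<in>S. x + v + k = u + y + k) \<longleftrightarrow> x + v = u + y" if "u \<in> S" "v \<in> S"
    using cancel[of "x + v" "u + y"] add_closed assms that by auto
  then show ?thesis using assms unfolding gdiff_def groth_rel_def by auto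
qed

lemma gdiff_eq_iff:
  assumes "x \<in> S" "y \<in> S" "x' \<in> S" "y' \<in> S"
  shows "gdiff S x y = gdiff S x' y' \<longleftrightarrow> x + y' = x' + y"
proof
  assume "gdiff S x y = gdiff S x' y'"
  moreover have "(x', y') \<in> gdiff S x' y'" using assms mem_gdiff_iff by blast
  ultimately show "x + y' = x' + y" using assms mem_gdiff_iff by blast
next
  assume eq: "x + y' = x' + y"
  have "x + v = u + y \<longleftrightarrow> x' + v = u + y'" if "u \<in> S" "v \<in> S" for u v
  proof
    assume "x + v = u + y"
    then have "(x' + y) + (x + v) = (x + y') + (u + y)" using eq by simp
    then have "(x' + v) + (x + y) = (u + y') + (x + y)" by (simp add: ac_simps)
    then show "x' + v = u + y'"
      using cancel[of "x' + v" "u + y'" "x + y"] that assms add_closed by simp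
  next
    assume "x' + v = u + y'"
    then have "(x + y') + (x' + v) = (x' + y) + (u + y')" using eq by simp
    then have "(x + v) + (x' + y') = (u + y) + (x' + y')" by (simp add: ac_simps)
    then show "x + v = u + y"
      using cancel[of "x + v" "u + y" "x' + y'"] that assms add_closed by simp
  qed
  then show "gdiff S x y = gdiff S x' y'"
    using assms by (auto simp: set_eq_iff mem_gdiff_iff)
qed

lemma groth_mult:
  assumes "x \<in> S" "y \<in> S" "x' \<in> S" "y' \<in> S"
  shows "gdiff S x y \<otimes>\<^bsub>groth S\<^esub> gdiff S x' y' = gdiff S (x + x') (y + y')"
proof -
  have "gdiff S (u + u') (v + v') = gdiff S (x + x') (y + y')"
    if "(u, v) \<in> gdiff S x y" "(u', v') \<in> gdiff S x' y'" for u v u' v'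
  proof -
    have uv: "u \<in> S" "v \<in> S" "u' \<in> S" "v' \<in> S" "x + v = u + y" "x' + v' = u' + y'"
      using that assms mem_gdiff_iff by auto
    have "(u + u') + (y + y') = (u + y) + (u' + y')" by (simp add: ac_simps)
    also have "\<dots> = (x + v) + (x' + v')" using uv by simp
    also have "\<dots> = (x + x') + (v + v')" by (simp add: ac_simps)
    finally show ?thesis using uv assms add_closed by (subst gdiff_eq_iff) auto
  qed
  moreover have "(x, y) \<in> gdiff S x y" "(x', y') \<in> gdiff S x' y'"
    using assms mem_gdiff_iff by auto
  ultimately have "(\<Union>(u, v)\<in>gdiff S x y. \<Union>(u', v')\<in>gdiff S x' y'. gdiff S (u + u') (v + v'))
      = gdiff S (x + x') (y + y')"
    by (intro SUP_eq_const) (blast, clarify, intro SUP_eq_const, blast, clarify, blast)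
  then show ?thesis
    unfolding groth_def by simp
qed

lemma groth_one:
  assumes "s \<in> S"
  shows "\<one>\<^bsub>groth S\<^esub> = gdiff S s s"
proof -
  have "gdiff S x x = gdiff S s s" if "x \<in> S" for x
    using that assms by (simp add: gdiff_eq_iff add.commute)
  moreover have "S \<noteq> {}" using assms by blast
  ultimately show ?thesis unfolding groth_def by (auto intro!: SUP_eq_const)
qed

end

lemma image_group_mult:
  assumes "inj f" "x \<in> carrier G" "y \<in> carrier G"
  shows "f x \<otimes>\<^bsub>image_group f G\<^esub> f y = f (x \<otimes>\<^bsub>G\<^esub> y)"
  using assms by (simp add: image_group_def inv_into_f_f inj_on_subset[OF _ subset_UNIV])

lemma sys_of_simps [simp]:
  "Idx (sys_of P) = P" "Le (sys_of P) = le_star" "Free (sys_of P) = {p \<in> P. free_elt p}"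
  "Grp (sys_of P) = Gprime" "Phi (sys_of P) = Phi_prime"
  by (simp_all add: sys_of_def)

context prime_system
begin

section \<open>The groups G_p as quotients of the absorbed elements\<close>

lemma cancellative_arch_comp: "p \<in> P \<Longrightarrow> cancellative_subsemigroup (arch_comp p)"
  by unfold_locales (fact arch_comp_add, blast intro: arch_comp_cancel)

text \<open>For regular \<open>p\<close> the element \<open>p + \<alpha>\<close> is already the
  difference \<open>(p + \<alpha>) - p\<close>, because \<open>p\<close> is neutral in M_p. Free and
  regular primes thus obey the same rules for equality, product and carrier.\<close>

definition gam :: "'a \<Rightarrow> 'a \<Rightarrow> 'a grp_elt"
  where "gam p \<alpha> = (if free_elt p then Inr (gdiff (arch_comp p) (p + \<alpha>) p) else Inl (p + \<alpha>))"

lemma gdiff_plus_eq_iff: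
  assumes p: "p \<in> P" and "\<alpha> \<in> absorbed p" "\<beta> \<in> absorbed p"
  shows "gdiff (arch_comp p) (p + \<alpha>) p = gdiff (arch_comp p) (p + \<beta>) p \<longleftrightarrow> p + \<alpha> = p + \<beta>"
proof -
  interpret cancellative_subsemigroup "arch_comp p" using p by (rule cancellative_arch_comp)
  show ?thesis
    using assms gdiff_eq_iff[of "p + \<alpha>" p "p + \<beta>" p] cancel[of "p + \<alpha>" "p + \<beta>" p]
      plus_absorbed_arch_comp rep_arch_comp by auto
qed

lemma gam_eq_iff:
  "p \<in> P \<Longrightarrow> \<alpha> \<in> absorbed p \<Longrightarrow> \<beta> \<in> absorbed p \<Longrightarrow> gam p \<alpha> = gam p \<beta> \<longleftrightarrow> p + \<alpha> = p + \<beta>"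
  by (simp add: gam_def gdiff_plus_eq_iff)

lemma regular_arch_comp:
  assumes "p \<in> P" "\<not> free_elt p"
  shows "arch_comp p = (+) p ` absorbed p"
  using arch_comp_iff_absorbed[OF assms(1)] assms(2)
  by (auto simp: degrees_def base_mult_def)

lemma carrier_Gprime: "p \<in> P \<Longrightarrow> carrier (Gprime p) = gam p ` absorbed p"
  by (cases "free_elt p")
    (auto simp: Gprime_def gam_def image_group_def Gfree_def Greg_def absorbed_def regular_arch_comp)

lemma gam_closed: "p \<in> P \<Longrightarrow> \<alpha> \<in> absorbed p \<Longrightarrow> gam p \<alpha> \<in> carrier (Gprime p)"
  by (simp add: carrier_Gprime)

lemma gam_mult:
  assumes p: "p \<in> P" and \<alpha>: "\<alpha> \<in> absorbed p" and \<beta>: "\<beta> \<in> absorbed p"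
  shows "gam p \<alpha> \<otimes>\<^bsub>Gprime p\<^esub> gam p \<beta> = gam p (\<alpha> + \<beta>)"
proof -
  interpret cancellative_subsemigroup "arch_comp p" using p by (rule cancellative_arch_comp)
  note arch = plus_absorbed_arch_comp[OF p]
  show ?thesis
  proof (cases "free_elt p")
    case True
    let ?g = "\<lambda>\<alpha>. gdiff (arch_comp p) (p + \<alpha>) p"
    have "?g \<alpha> \<otimes>\<^bsub>Gfree p\<^esub> ?g \<beta> = gdiff (arch_comp p) (p + \<alpha> + (p + \<beta>)) (p + p)"
      using arch[OF \<alpha>] arch[OF \<beta>] rep_arch_comp[OF p] by (simp add: Gfree_def groth_mult)
    also have "\<dots> = ?g (\<alpha> + \<beta>)"
      using arch[OF \<alpha>] arch[OF \<beta>] arch[OF absorbed_add[OF \<alpha> \<beta>]] rep_arch_comp[OF p]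
      by (simp add: gdiff_eq_iff add_closed) (simp only: ac_simps)
    finally have "?g \<alpha> \<otimes>\<^bsub>Gfree p\<^esub> ?g \<beta> = ?g (\<alpha> + \<beta>)" .
    moreover have "?g \<alpha> \<in> carrier (Gfree p)" "?g \<beta> \<in> carrier (Gfree p)"
      using \<alpha> \<beta> by (auto simp: Gfree_def absorbed_def)
    ultimately show ?thesis
      using True image_group_mult[OF inj_Inr, of "?g \<alpha>" "Gfree p" "?g \<beta>"]
      by (simp add: gam_def Gprime_def)
  next
    case False
    have "p + \<alpha> + (p + \<beta>) = (p + p) + (\<alpha> + \<beta>)" by (simp only: ac_simps)
    also have "\<dots> = p + (\<alpha> + \<beta>)" by (simp only: not_free_idem[OF p False])
    finally show ?thesis
      using False arch[OF \<alpha>] arch[OF \<beta>] image_group_mult[OF inj_Inl, of "p + \<alpha>" "Greg p" "p + \<beta>"]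
      by (simp add: gam_def Gprime_def Greg_def)
  qed
qed

lemma one_Gprime: "p \<in> P \<Longrightarrow> \<one>\<^bsub>Gprime p\<^esub> = gam p 0"
  using cancellative_subsemigroup.groth_one[OF cancellative_arch_comp rep_arch_comp]
  by (simp add: Gprime_def gam_def image_group_def Gfree_def Greg_def)

lemma comm_group_Gprime: assumes p: "p \<in> P" shows "comm_group (Gprime p)"
proof (rule comm_groupI)
  fix x assume "x \<in> carrier (Gprime p)"
  then obtain \<alpha> where \<alpha>: "\<alpha> \<in> absorbed p" "x = gam p \<alpha>" using carrier_Gprime[OF p] by auto
  then obtain c where c: "c \<in> absorbed p" "p + (\<alpha> + c) = p" using absorbed_inverse by metis
  then have "gam p c \<otimes>\<^bsub>Gprime p\<^esub> x = \<one>\<^bsub>Gprime p\<^esub>"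
    using \<alpha> p by (simp add: gam_mult one_Gprime gam_eq_iff absorbed_add add.commute)
  then show "\<exists>y\<in>carrier (Gprime p). y \<otimes>\<^bsub>Gprime p\<^esub> x = \<one>\<^bsub>Gprime p\<^esub>"
    using c p gam_closed by blast
qed (use p in \<open>auto simp: carrier_Gprime gam_mult one_Gprime absorbed_add ac_simps\<close>)

text \<open>The definite description in \<open>ident\<close> ranges over all \<open>\<alpha>\<close>
  presenting the same group element. Two of them agree after adding \<open>p\<close>, and
  \<open>base_mult p n\<close> contains a copy of \<open>p\<close>, so the value is unique.\<close>

lemma ident_gam:
  assumes p: "p \<in> P" and n: "n \<in> degrees p" and \<alpha>: "\<alpha> \<in> absorbed p"
  shows "ident p (n, gam p \<alpha>) = base_mult p n + \<alpha>"
proof (cases "free_elt p")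
  case True
  have uniq: "base_mult p n + \<beta> = base_mult p n + \<alpha>"
    if "\<beta> \<in> absorbed p" "gdiff (arch_comp p) (p + \<alpha>) p = gdiff (arch_comp p) (p + \<beta>) p" for \<beta>
    using that \<alpha> gdiff_plus_eq_iff[OF p] base_mult_absorbed[OF n] by metis
  have "(THE y. \<exists>\<beta>. p + \<beta> \<preceq> p \<and> gdiff (arch_comp p) (p + \<alpha>) p = gdiff (arch_comp p) (p + \<beta>) p
      \<and> y = nmult (nat n) p + \<beta>) = nmult (nat n) p + \<alpha>"
  proof (rule the_equality)
    fix y assume "\<exists>\<beta>. p + \<beta> \<preceq> p \<and> gdiff (arch_comp p) (p + \<alpha>) p = gdiff (arch_comp p) (p + \<beta>) p
      \<and> y = nmult (nat n) p + \<beta>"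
    then show "y = nmult (nat n) p + \<alpha>"
      using uniq True unfolding absorbed_def base_mult_def by auto
  qed (use \<alpha> in \<open>auto simp: absorbed_def\<close>)
  then show ?thesis using True by (simp add: gam_def base_mult_def)
next
  case False
  then show ?thesis by (simp add: gam_def base_mult_def)
qed

section \<open>The groups Ghat, the semigroups M_p and their identification with components of
  M\<close>

abbreviation J :: "('a, 'a grp_elt) isystem" where "J \<equiv> sys_of P"

lemma Msemi_J: "p \<in> P \<Longrightarrow> Msemi J p = degrees p \<times> gam p ` absorbed p"
  by (simp add: Msemi_def degrees_def carrier_Gprime)

lemma Msemi_cases:
  assumes "p \<in> P" "u \<in> Msemi J p"
  obtains n \<alpha> where "n \<in> degrees p" "\<alpha> \<in> absorbed p" "u = (n, gam p \<alpha>)"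
  using assms Msemi_J by auto

lemma comm_group_Ghat: "p \<in> P \<Longrightarrow> comm_group (Ghat J p)"
proof (rule group.group_comm_groupI)
  assume p: "p \<in> P"
  then interpret G: comm_group "Gprime p" by (rule comm_group_Gprime)
  show "Group.group (Ghat J p)"
    by (simp add: Ghat_def DirProd_group)
  show "x \<otimes>\<^bsub>Ghat J p\<^esub> y = y \<otimes>\<^bsub>Ghat J p\<^esub> x"
    if "x \<in> carrier (Ghat J p)" "y \<in> carrier (Ghat J p)" for x y
    using that by (auto simp: Ghat_def mult_DirProd' singleton_group_def G.m_comm)
qed

lemma group_Ghat: "p \<in> P \<Longrightarrow> Group.group (Ghat J p)"
  using comm_group_Ghat comm_group.axioms(2) by blast

lemma Ghat_mult:
  assumes "p \<in> P" "(n, g) \<in> carrier (Ghat J p)" "(m, h) \<in> carrier (Ghat J p)"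
  shows "(n, g) \<otimes>\<^bsub>Ghat J p\<^esub> (m, h) = (n + m, g \<otimes>\<^bsub>Gprime p\<^esub> h)"
  using assms by (auto simp: Ghat_def singleton_group_def split: if_splits)

lemma one_Ghat: "p \<in> P \<Longrightarrow> \<one>\<^bsub>Ghat J p\<^esub> = (0, \<one>\<^bsub>Gprime p\<^esub>)"
  by (simp add: Ghat_def singleton_group_def)

lemma carrier_Ghat:
  "p \<in> P \<Longrightarrow> carrier (Ghat J p) = (if free_elt p then UNIV else {0}) \<times> carrier (Gprime p)"
  by (simp add: Ghat_def singleton_group_def)

lemma Msemi_subset_Ghat: "p \<in> P \<Longrightarrow> Msemi J p \<subseteq> carrier (Ghat J p)"
  by (auto simp: Msemi_def carrier_Ghat)

lemma zero_gam_in_Ghat: "p \<in> P \<Longrightarrow> \<alpha> \<in> absorbed p \<Longrightarrow> (0, gam p \<alpha>) \<in> carrier (Ghat J p)"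
  by (auto simp: carrier_Ghat gam_closed)

lemma Msemi_mult_closed:
  assumes "p \<in> P" "u \<in> Msemi J p" "v \<in> Msemi J p"
  shows "u \<otimes>\<^bsub>Ghat J p\<^esub> v \<in> Msemi J p"
proof -
  obtain n \<alpha> m \<beta> where *: "n \<in> degrees p" "\<alpha> \<in> absorbed p" "u = (n, gam p \<alpha>)"
      "m \<in> degrees p" "\<beta> \<in> absorbed p" "v = (m, gam p \<beta>)"
    using Msemi_cases assms by metis
  then have "u \<otimes>\<^bsub>Ghat J p\<^esub> v = (n + m, gam p (\<alpha> + \<beta>))"
    using assms Msemi_subset_Ghat by (auto simp: gam_mult Ghat_mult subset_iff)
  then show ?thesis
    using * assms(1) by (auto simp: Msemi_J absorbed_add degrees_def split: if_splits)
qed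

lemma ident_mult:
  assumes "p \<in> P" "u \<in> Msemi J p" "v \<in> Msemi J p"
  shows "ident p (u \<otimes>\<^bsub>Ghat J p\<^esub> v) = ident p u + ident p v"
proof -
  obtain n \<alpha> m \<beta> where *: "n \<in> degrees p" "\<alpha> \<in> absorbed p" "u = (n, gam p \<alpha>)"
      "m \<in> degrees p" "\<beta> \<in> absorbed p" "v = (m, gam p \<beta>)"
    using Msemi_cases assms by metis
  then have "u \<otimes>\<^bsub>Ghat J p\<^esub> v = (n + m, gam p (\<alpha> + \<beta>))"
    using assms Msemi_subset_Ghat by (auto simp: gam_mult Ghat_mult subset_iff)
  moreover have "n + m \<in> degrees p"
    using * by (auto simp: degrees_def split: if_splits)
  ultimately show ?thesis
    using * assms(1) by (simp add: ident_gam absorbed_add base_mult_add ac_simps)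
qed

text \<open>This is the action of G_p on M_p; the images of the maps phi act on M_p in this
  way.\<close>

lemma ident_mult_gam:
  assumes "p \<in> P" "u \<in> Msemi J p" "\<beta> \<in> absorbed p"
  shows "u \<otimes>\<^bsub>Ghat J p\<^esub> (0, gam p \<beta>) \<in> Msemi J p"
    and "ident p (u \<otimes>\<^bsub>Ghat J p\<^esub> (0, gam p \<beta>)) = ident p u + \<beta>"
proof -
  obtain n \<alpha> where *: "n \<in> degrees p" "\<alpha> \<in> absorbed p" "u = (n, gam p \<alpha>)"
    using Msemi_cases assms by metis
  then have eq: "u \<otimes>\<^bsub>Ghat J p\<^esub> (0, gam p \<beta>) = (n, gam p (\<alpha> + \<beta>))"
    using assms Msemi_subset_Ghat zero_gam_in_Ghat by (auto simp: gam_mult Ghat_mult subset_iff)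
  show "u \<otimes>\<^bsub>Ghat J p\<^esub> (0, gam p \<beta>) \<in> Msemi J p"
    using eq * assms by (simp add: Msemi_J absorbed_add)
  show "ident p (u \<otimes>\<^bsub>Ghat J p\<^esub> (0, gam p \<beta>)) = ident p u + \<beta>"
    unfolding eq using * assms by (simp add: ident_gam absorbed_add add.assoc)
qed

lemma ident_bij: assumes p: "p \<in> P" shows "bij_betw (ident p) (Msemi J p) (arch_comp p)"
  unfolding bij_betw_def
proof
  show "inj_on (ident p) (Msemi J p)"
  proof (rule inj_onI)
    fix u v assume uv: "u \<in> Msemi J p" "v \<in> Msemi J p" and eq: "ident p u = ident p v"
    obtain n \<alpha> m \<beta> where *: "n \<in> degrees p" "\<alpha> \<in> absorbed p" "u = (n, gam p \<alpha>)"
      "m \<in> degrees p" "\<beta> \<in> absorbed p" "v = (m, gam p \<beta>)"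
      using Msemi_cases[OF p uv(1)] Msemi_cases[OF p uv(2)] by metis
    have "base_mult p n + \<alpha> = base_mult p m + \<beta>"
      using eq * p by (simp add: ident_gam)
    then have "n = m" "p + \<alpha> = p + \<beta>"
      using base_mult_eq_iff[OF p] * by blast+
    then show "u = v" using * gam_eq_iff[OF p] by blast
  qed
  show "ident p ` Msemi J p = arch_comp p"
  proof
    show "ident p ` Msemi J p \<subseteq> arch_comp p"
    proof (rule image_subsetI)
      fix u assume "u \<in> Msemi J p"
      then obtain n \<alpha> where "n \<in> degrees p" "\<alpha> \<in> absorbed p" "u = (n, gam p \<alpha>)"
        by (rule Msemi_cases[OF p])
      then show "ident p u \<in> arch_comp p"
        using arch_comp_iff_absorbed[OF p] ident_gam[OF p] by blast
    qed
    show "arch_comp p \<subseteq> ident p ` Msemi J p"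
    proof
      fix x assume "x \<in> arch_comp p"
      then obtain n \<alpha> where *: "n \<in> degrees p" "\<alpha> \<in> absorbed p" "x = base_mult p n + \<alpha>"
        using arch_comp_iff_absorbed[OF p] by blast
      then have "(n, gam p \<alpha>) \<in> Msemi J p" "x = ident p (n, gam p \<alpha>)"
        using p by (auto simp: Msemi_J ident_gam)
      then show "x \<in> ident p ` Msemi J p" by blast
    qed
  qed
qed

lemma ident_arch_comp: "p \<in> P \<Longrightarrow> u \<in> Msemi J p \<Longrightarrow> ident p u \<in> arch_comp p"
  using ident_bij bij_betw_apply by fastforce

lemma rep_le_ident: "p \<in> P \<Longrightarrow> u \<in> Msemi J p \<Longrightarrow> p \<preceq> ident p u"
  using ident_arch_comp arch_comp_iff by blast

lemma arch_comp_absorbed: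
  assumes "p \<in> P" "q \<in> P" "q \<preceq> p" "q \<noteq> p" "x \<in> arch_comp q"
  shows "x \<in> absorbed p"
  using assms(5) absorbed_mono absorbed_nmult[OF absorbed_lower[OF assms(1-4)]]
    arch_comp_iff[OF assms(2)] by blast

lemma ident_absorbed:
  "p \<in> P \<Longrightarrow> q \<in> P \<Longrightarrow> q \<preceq> p \<Longrightarrow> q \<noteq> p \<Longrightarrow> u \<in> Msemi J q \<Longrightarrow> ident q u \<in> absorbed p"
  using arch_comp_absorbed ident_arch_comp by blast

text \<open>In the regular case the subtracted \<open>p\<close> is the neutral element of M_p, hence
  its own inverse, and the extra copy disappears by idempotency.\<close>

lemma Phi_prime_eq:
  assumes p: "p \<in> P" and "ident q u \<in> absorbed p"
  shows "Phi_prime p q u = gam p (ident q u)"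
proof (cases "free_elt p")
  case False
  note idem = not_free_idem[OF p False]
  have "y + p = y" if "y \<in> arch_comp p" for y
    using that idem_absorb[OF idem, of y] arch_comp_iff[OF p] by (simp add: add.commute)
  then have "inv\<^bsub>Greg p\<^esub> p = p"
    unfolding m_inv_def
    using rep_arch_comp[OF p] idem by (intro the_equality) (auto simp: Greg_def)
  moreover have "p + ident q u + p = (p + p) + ident q u" by (simp only: ac_simps)
  ultimately show ?thesis
    using False by (simp add: Phi_prime_def gam_def Greg_def not_free_idem[OF p False])
qed (simp add: Phi_prime_def gam_def)

end

section \<open>The system of a monoid is a system\<close>

text \<open>The formula is forced: \<open>(n, g)\<close> is \<open>(1, g)\<close> times a power of
  degree \<open>n - 1\<close> of the element whose image is \<open>t\<close>. It starts from degree
  1 because \<open>\<phi>\<close> has no values in degree 0. Multiplicativity comes from two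
  factorisations of one element of degree 2.\<close>

lemma hom_extension_from_positive:
  fixes G :: "('g, 'b) monoid_scheme" and K :: "('k, 'c) monoid_scheme"
  assumes "Group.group G" "comm_group K"
    and \<phi>: "\<phi> \<in> hom ((integer_group \<times>\<times> G)\<lparr>carrier := {1..} \<times> carrier G\<rparr>) K"
  obtains h where "h \<in> hom (integer_group \<times>\<times> G) K" "\<And>x. x \<in> {1..} \<times> carrier G \<Longrightarrow> h x = \<phi> x"
proof -
  interpret G: Group.group G by fact
  interpret K: comm_group K by fact
  define t where "t = \<phi> (1, \<one>\<^bsub>G\<^esub>)"
  define h where "h = (\<lambda>(n, g). \<phi> (1, g) \<otimes>\<^bsub>K\<^esub> (t [^]\<^bsub>K\<^esub> (n - 1 :: int)))"
  have \<phi>_closed: "\<phi> (n, g) \<in> carrier K" if "1 \<le> n" "g \<in> carrier G" for n g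
    using \<phi> that by (auto simp: hom_def)
  have \<phi>_mult: "\<phi> (n + m, g \<otimes>\<^bsub>G\<^esub> g') = \<phi> (n, g) \<otimes>\<^bsub>K\<^esub> \<phi> (m, g')"
    if "1 \<le> n" "1 \<le> m" "g \<in> carrier G" "g' \<in> carrier G" for n m g g'
    using \<phi> that by (auto simp: hom_def)
  have t: "t \<in> carrier K" using \<phi>_closed by (simp add: t_def)
  have \<phi>_eq: "\<phi> (n, g) = h (n, g)" if "1 \<le> n" "g \<in> carrier G" for n g
    using that
  proof (induction n rule: int_ge_induct)
    case base
    then show ?case using \<phi>_closed by (simp add: h_def)
  next
    case (step n)
    have "\<phi> (n + 1, g) = \<phi> (n, g) \<otimes>\<^bsub>K\<^esub> t"
      using \<phi>_mult[of n 1 g "\<one>\<^bsub>G\<^esub>"] step by (simp add: t_def)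
    also have "\<dots> = \<phi> (1, g) \<otimes>\<^bsub>K\<^esub> (t [^]\<^bsub>K\<^esub> (n - 1) \<otimes>\<^bsub>K\<^esub> t [^]\<^bsub>K\<^esub> (1::int))"
      using step t \<phi>_closed by (simp add: h_def K.m_assoc)
    also have "t [^]\<^bsub>K\<^esub> (n - 1) \<otimes>\<^bsub>K\<^esub> t [^]\<^bsub>K\<^esub> (1::int) = t [^]\<^bsub>K\<^esub> n"
      using t by (subst K.int_pow_mult[symmetric]) auto
    finally show ?case by (simp add: h_def)
  qed
  have h_mult: "h (n + m, g \<otimes>\<^bsub>G\<^esub> g') = h (n, g) \<otimes>\<^bsub>K\<^esub> h (m, g')"
    if g: "g \<in> carrier G" "g' \<in> carrier G" for n m g g'
  proof -
    note cl = \<phi>_closed[of 1 g] \<phi>_closed[of 1 g'] \<phi>_closed[of 1 "g \<otimes>\<^bsub>G\<^esub> g'"]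
    \<comment> \<open>The exponents \<open>n - 1\<close> and \<open>m - 1\<close> add up to one less
      than \<open>n + m - 1\<close>. The spare factor \<open>t\<close> is what turns the image of a
      product in degree 1 into the product of the two images.\<close>
    have pow_add: "t [^]\<^bsub>K\<^esub> (n + m - 1) = t \<otimes>\<^bsub>K\<^esub> (t [^]\<^bsub>K\<^esub> (n - 1) \<otimes>\<^bsub>K\<^esub> t [^]\<^bsub>K\<^esub> (m - 1))"
    proof -
      have "t [^]\<^bsub>K\<^esub> (n + m - 1) = t [^]\<^bsub>K\<^esub> (1 + ((n - 1) + (m - 1)))" by (simp add: algebra_simps)
      also have "\<dots> = t [^]\<^bsub>K\<^esub> (1::int) \<otimes>\<^bsub>K\<^esub> (t [^]\<^bsub>K\<^esub> (n - 1) \<otimes>\<^bsub>K\<^esub> t [^]\<^bsub>K\<^esub> (m - 1))"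
        using t by (simp only: K.int_pow_mult)
      finally show ?thesis using t by simp
    qed
    have "\<phi> (1, g \<otimes>\<^bsub>G\<^esub> g') \<otimes>\<^bsub>K\<^esub> t = \<phi> (1 + 1, g \<otimes>\<^bsub>G\<^esub> g')"
      using \<phi>_mult[of 1 1 "g \<otimes>\<^bsub>G\<^esub> g'" "\<one>\<^bsub>G\<^esub>"] g by (simp add: t_def)
    also have "\<dots> = \<phi> (1, g) \<otimes>\<^bsub>K\<^esub> \<phi> (1, g')"
      using \<phi>_mult[of 1 1 g g'] g by simp
    finally have "\<phi> (1, g \<otimes>\<^bsub>G\<^esub> g') \<otimes>\<^bsub>K\<^esub> t [^]\<^bsub>K\<^esub> (n + m - 1)
        = (\<phi> (1, g) \<otimes>\<^bsub>K\<^esub> \<phi> (1, g')) \<otimes>\<^bsub>K\<^esub> (t [^]\<^bsub>K\<^esub> (n - 1) \<otimes>\<^bsub>K\<^esub> t [^]\<^bsub>K\<^esub> (m - 1))"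
      unfolding pow_add using t g cl by (simp add: K.m_assoc[symmetric])
    also have "\<dots> = h (n, g) \<otimes>\<^bsub>K\<^esub> h (m, g')"
      using t g cl by (simp add: h_def K.m_ac)
    finally show ?thesis by (simp add: h_def)
  qed
  show thesis
  proof (rule that)
    show "h \<in> hom (integer_group \<times>\<times> G) K"
      using t \<phi>_closed h_mult by (auto simp: hom_def h_def)
    show "h x = \<phi> x" if "x \<in> {1..} \<times> carrier G" for x
      using that \<phi>_eq by auto
  qed
qed

context prime_system
begin

text \<open>Every element of \<open>Ghat\<close> is thereby a difference of two elements of M_p,
  which makes extensions from M_p unique.\<close>

lemma Msemi_cofinal:
  assumes p: "p \<in> P" and "u \<in> carrier (Ghat J p)"
  obtains v where "v \<in> Msemi J p" "u \<otimes>\<^bsub>Ghat J p\<^esub> v \<in> Msemi J p"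
proof -
  interpret G: comm_group "Gprime p" using p by (rule comm_group_Gprime)
  obtain n g where u: "u = (n, g)" "g \<in> carrier (Gprime p)" "free_elt p \<or> n = 0"
    using assms by (auto simp: carrier_Ghat split: if_splits)
  show thesis
    \<comment> \<open>Degree \<open>\<bar>n\<bar> + 1\<close> makes both \<open>v\<close> and its
      product with \<open>u\<close> have positive degree.\<close>
    by (rule that[of "(if free_elt p then \<bar>n\<bar> + 1 else 0, \<one>\<^bsub>Gprime p\<^esub>)"])
      (use u p in \<open>auto simp: Msemi_def Ghat_mult carrier_Ghat\<close>)
qed

lemma hom_eq_on_Ghat:
  assumes p: "p \<in> P" and "Group.group K" and h: "h \<in> hom (Ghat J p) K" "h' \<in> hom (Ghat J p) K"
    and eq: "\<And>u. u \<in> Msemi J p \<Longrightarrow> h u = h' u" and u: "u \<in> carrier (Ghat J p)"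
  shows "h u = h' u"
proof -
  interpret K: Group.group K by fact
  obtain v where v: "v \<in> Msemi J p" "u \<otimes>\<^bsub>Ghat J p\<^esub> v \<in> Msemi J p"
    using Msemi_cofinal[OF p u] .
  have v': "v \<in> carrier (Ghat J p)" using v Msemi_subset_Ghat[OF p] by blast
  have "h u \<otimes>\<^bsub>K\<^esub> h v = h' u \<otimes>\<^bsub>K\<^esub> h v"
    using hom_mult[OF h(1) u v'] hom_mult[OF h(2) u v'] eq v by simp
  then show ?thesis
    using hom_in_carrier[OF h(1) u] hom_in_carrier[OF h(2) u] hom_in_carrier[OF h(1) v'] by simp
qed

lemma Phi_prime_hom:
  assumes "p \<in> P" "q \<in> P" "q \<preceq> p" "q \<noteq> p"
  shows "Phi_prime p q \<in> hom ((Ghat J q)\<lparr>carrier := Msemi J q\<rparr>) (Gprime p)"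
proof (rule homI)
  have eq: "Phi_prime p q u = gam p (ident q u)" if "u \<in> Msemi J q" for u
    using that Phi_prime_eq ident_absorbed assms by blast
  show "Phi_prime p q u \<in> carrier (Gprime p)"
    if "u \<in> carrier ((Ghat J q)\<lparr>carrier := Msemi J q\<rparr>)" for u
    using that eq ident_absorbed assms gam_closed by simp
  show "Phi_prime p q (u \<otimes>\<^bsub>(Ghat J q)\<lparr>carrier := Msemi J q\<rparr>\<^esub> v) = Phi_prime p q u \<otimes>\<^bsub>Gprime p\<^esub> Phi_prime p q v"
    if "u \<in> carrier ((Ghat J q)\<lparr>carrier := Msemi J q\<rparr>)"
      "v \<in> carrier ((Ghat J q)\<lparr>carrier := Msemi J q\<rparr>)" for u v
    using that eq ident_absorbed assms by (simp add: Msemi_mult_closed ident_mult gam_mult)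
qed

lemma Phi_ext_char:
  assumes p: "p \<in> P" and q: "q \<in> P" and lt: "q \<preceq> p" "q \<noteq> p"
  shows Phi_ext_hom: "Phi_ext J p q \<in> hom (Ghat J q) (Gprime p)"
    and Phi_ext_eq: "u \<in> Msemi J q \<Longrightarrow> Phi_ext J p q u = gam p (ident q u)"
proof -
  interpret G: comm_group "Gprime p" using p by (rule comm_group_Gprime)
  interpret Q: comm_group "Gprime q" using q by (rule comm_group_Gprime)
  note \<phi> = Phi_prime_hom[OF assms]
  let ?Q = "\<lambda>h. h \<in> hom (Ghat J q) (Gprime p) \<and>
    h \<in> extensional (carrier (Ghat J q)) \<and> (\<forall>x\<in>Msemi J q. h x = Phi_prime p q x)"
  obtain h where h: "h \<in> hom (Ghat J q) (Gprime p)" "\<And>x. x \<in> Msemi J q \<Longrightarrow> h x = Phi_prime p q x"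
  proof (cases "free_elt q")
    case True
    then have eqs: "Ghat J q = integer_group \<times>\<times> Gprime q" "Msemi J q = {1..} \<times> carrier (Gprime q)"
      using q by (simp_all add: Ghat_def Msemi_def)
    obtain h where "h \<in> hom (integer_group \<times>\<times> Gprime q) (Gprime p)"
        "\<And>x. x \<in> {1..} \<times> carrier (Gprime q) \<Longrightarrow> h x = Phi_prime p q x"
      using hom_extension_from_positive[OF Q.is_group G.comm_group_axioms \<phi>[unfolded eqs]] by blast
    then show thesis by (intro that[of h]) (simp_all add: eqs)
  next
    case False
    then have "Msemi J q = carrier (Ghat J q)" using q by (simp add: Msemi_def carrier_Ghat)
    then show thesis using \<phi> that by simp
  qed
  have closed: "x \<otimes>\<^bsub>Ghat J q\<^esub> y \<in> carrier (Ghat J q)"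
    if "x \<in> carrier (Ghat J q)" "y \<in> carrier (Ghat J q)" for x y
    using group_Ghat[OF q] that by (simp add: group.is_monoid monoid.m_closed)
  \<comment> \<open>Truncating \<open>h\<close> outside the carrier turns uniqueness on the carrier
    into uniqueness of the function, as the definite description of \<open>Phi_ext\<close>
    requires.\<close>
  have ex: "?Q (restrict h (carrier (Ghat J q)))"
    using h Msemi_subset_Ghat[OF q] closed by (auto simp: hom_def)
  have "h' = restrict h (carrier (Ghat J q))" if "?Q h'" for h'
  proof (rule extensionalityI[of _ "carrier (Ghat J q)"])
    fix x assume "x \<in> carrier (Ghat J q)"
    then show "h' x = restrict h (carrier (Ghat J q)) x"
      using that ex hom_eq_on_Ghat[OF q G.is_group, of h' "restrict h (carrier (Ghat J q))"] by simp
  qed (use that in auto)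
  with ex have "\<exists>!h. ?Q h" by blast
  then have "?Q (Phi_ext J p q)"
    unfolding Phi_ext_def sys_of_simps by (rule theI')
  then show "Phi_ext J p q \<in> hom (Ghat J q) (Gprime p)"
    and "u \<in> Msemi J q \<Longrightarrow> Phi_ext J p q u = gam p (ident q u)"
    using Phi_prime_eq[OF p] ident_absorbed assms by auto
qed

lemma degrees_nonempty: "degrees p \<noteq> {}"
  by (simp add: degrees_def)

text \<open>For free \<open>q\<close> the argument has degree 0 and lies outside
  \<open>Msemi\<close>. Its image is found by shifting with an element \<open>?e\<close> of M_q and
  cancelling the image of \<open>?e\<close>.\<close>

lemma Phi_ext_zero_gam:
  assumes p: "p \<in> P" and q: "q \<in> P" and lt: "q \<preceq> p" "q \<noteq> p" and x: "x \<in> absorbed q"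
  shows "Phi_ext J p q (0, gam q x) = gam p x"
proof -
  interpret G: comm_group "Gprime p" using p by (rule comm_group_Gprime)
  obtain n where n: "n \<in> degrees q" using degrees_nonempty by blast
  let ?e = "(n, gam q 0)"
  have e: "?e \<in> Msemi J q" using n q by (auto simp: Msemi_J)
  have e': "?e \<in> carrier (Ghat J q)" using e Msemi_subset_Ghat[OF q] by blast
  have z: "(0, gam q x) \<in> carrier (Ghat J q)" using zero_gam_in_Ghat[OF q x] .
  note hom = Phi_ext_hom[OF assms(1-4)] and eq = Phi_ext_eq[OF assms(1-4)]
  have abs: "ident q ?e \<in> absorbed p" using ident_absorbed e assms by blast
  have "x \<preceq> q" using x unfolding absorbed_def mem_Collect_eq
    by (meson alg_le_trans alg_le_add_left alg_le_refl)
  then have xp: "x \<in> absorbed p"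
    using absorbed_mono absorbed_lower assms by blast
  have "gam p (ident q ?e) \<otimes>\<^bsub>Gprime p\<^esub> Phi_ext J p q (0, gam q x)
      = Phi_ext J p q (?e \<otimes>\<^bsub>Ghat J q\<^esub> (0, gam q x))"
    using hom_mult[OF hom e' z] eq[OF e] by simp
  also have "\<dots> = gam p (ident q ?e) \<otimes>\<^bsub>Gprime p\<^esub> gam p x"
    using eq ident_mult_gam[OF q e x] gam_mult[OF p abs xp] by simp
  finally show ?thesis
    using gam_closed[OF p abs] gam_closed[OF p xp] hom_in_carrier[OF hom z] by simp
qed

section \<open>Functoriality, and generation of G_p from below\<close>

lemma Phi_hat_hom:
  assumes p: "p \<in> P" and q: "q \<in> P" and le: "q \<preceq> p"
  shows "Phi_hat J p q \<in> hom (Ghat J q) (Ghat J p)"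
proof (cases "q = p")
  case True
  then show ?thesis
    using comm_group.axioms(2)[OF comm_group_Ghat[OF q]] by (auto simp: Phi_hat_def hom_def)
next
  case False
  have hom: "Phi_ext J p q \<in> hom (Ghat J q) (Gprime p)" using Phi_ext_hom assms False by blast
  show ?thesis
  proof (rule homI)
    show cl: "Phi_hat J p q x \<in> carrier (Ghat J p)" if "x \<in> carrier (Ghat J q)" for x
      using hom_in_carrier[OF hom that] False p by (simp add: Phi_hat_def carrier_Ghat)
    show "Phi_hat J p q (x \<otimes>\<^bsub>Ghat J q\<^esub> y) = Phi_hat J p q x \<otimes>\<^bsub>Ghat J p\<^esub> Phi_hat J p q y"
      if "x \<in> carrier (Ghat J q)" "y \<in> carrier (Ghat J q)" for x y
      using cl[OF that(1)] cl[OF that(2)] hom_mult[OF hom that] False p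
      by (simp add: Phi_hat_def Ghat_mult)
  qed
qed

text \<open>Both sides are homomorphisms, so comparing them on M_i suffices; there each sends
  \<open>v\<close> to the degree-zero class of \<open>ident i v\<close>.\<close>

lemma Phi_hat_comp:
  assumes "i \<in> P" "j \<in> P" "k \<in> P" "i \<preceq> j" "j \<preceq> k" and u: "u \<in> carrier (Ghat J i)"
  shows "Phi_hat J k j (Phi_hat J j i u) = Phi_hat J k i u"
proof (cases "i = j \<or> j = k")
  case True
  then show ?thesis by (auto simp: Phi_hat_def)
next
  case False
  have ik: "i \<preceq> k" using assms alg_le_trans by blast
  have "i \<noteq> k" using assms rep_unique False by blast
  interpret K: comm_group "Ghat J k" using assms(3) by (rule comm_group_Ghat)
  show ?thesis
  proof (rule hom_eq_on_Ghat[OF \<open>i \<in> P\<close> K.is_group, where h = "\<lambda>u. Phi_hat J k j (Phi_hat J j i u)", OF _ _ _ u])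
    show "(\<lambda>u. Phi_hat J k j (Phi_hat J j i u)) \<in> hom (Ghat J i) (Ghat J k)"
      using hom_compose[OF Phi_hat_hom Phi_hat_hom, of j i k] assms by (simp add: o_def)
    show "Phi_hat J k i \<in> hom (Ghat J i) (Ghat J k)"
      using Phi_hat_hom assms ik by blast
    fix v assume v: "v \<in> Msemi J i"
    then show "Phi_hat J k j (Phi_hat J j i v) = Phi_hat J k i v"
      using assms False ik \<open>i \<noteq> k\<close> ident_absorbed[of j i v]
      by (simp add: Phi_hat_def Phi_ext_eq Phi_ext_zero_gam)
  qed
qed

lemma finprod_gam:
  assumes p: "p \<in> P" and "\<forall>l<(n::nat). f l \<in> absorbed p"
  shows "(\<Sum>l<n. f l) \<in> absorbed p \<and> finprod (Gprime p) (\<lambda>l. gam p (f l)) {..<n} = gam p (\<Sum>l<n. f l)"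
proof -
  interpret G: comm_group "Gprime p" using p by (rule comm_group_Gprime)
  show ?thesis using assms(2)
  proof (induction n)
    case 0
    then show ?case by (simp add: one_Gprime p)
  next
    case (Suc n)
    then show ?case
      using p by (simp add: lessThan_Suc G.finprod_insert Pi_def gam_closed gam_mult absorbed_add)
  qed
qed

lemma prime_in_arch_comp: "q \<in> P \<Longrightarrow> q \<preceq> r \<Longrightarrow> r \<preceq> q \<Longrightarrow> r \<in> arch_comp q"
  by (auto simp: arch_comp_iff intro!: exI[of _ 1])

text \<open>The absorbed element \<open>\<alpha>\<close> is a sum of primes. An absorbed element is
  never above a free \<open>p\<close>, so the representatives of these primes lie strictly below
  \<open>p\<close>.\<close>

lemma gam_generated:
  assumes p: "p \<in> P" and free: "free_elt p" and g: "g \<in> carrier (Gprime p)"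
  shows "\<exists>(n::nat) s. (\<forall>l<n. \<exists>k\<in>P. Lt J k p \<and> s l \<in> Phi_prime p k ` Msemi J k) \<and>
    g = finprod (Gprime p) s {..<n}"
proof -
  obtain \<alpha> where \<alpha>: "\<alpha> \<in> absorbed p" "g = gam p \<alpha>" using g carrier_Gprime[OF p] by auto
  obtain ps where ps: "\<forall>r\<in>set ps. prime_elt r" "\<alpha> = sum_list ps" using sum_of_primes by blast
  have abs: "\<forall>l<length ps. ps ! l \<in> absorbed p"
    using \<alpha>(1) absorbed_mono summand_alg_le_sum_list nth_mem ps(2) by metis
  have "g = finprod (Gprime p) (\<lambda>l. gam p (ps ! l)) {..<length ps}"
    using finprod_gam[OF p abs] \<alpha>(2) ps(2) by (simp add: sum_list_sum_nth atLeast0LessThan)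
  moreover have "\<exists>k\<in>P. Lt J k p \<and> gam p (ps ! l) \<in> Phi_prime p k ` Msemi J k" if l: "l < length ps" for l
  proof -
    obtain k where k: "k \<in> P" "k \<preceq> ps ! l" "ps ! l \<preceq> k"
      using rep_exists ps(1) nth_mem[OF l] by metis
    have ab: "ps ! l \<in> absorbed p" using abs l by blast
    then have "ps ! l \<preceq> p"
      unfolding absorbed_def mem_Collect_eq by (meson alg_le_trans alg_le_add_left alg_le_refl)
    then have kp: "k \<preceq> p" using k alg_le_trans by blast
    have "k \<noteq> p" using absorbed_not_ge[OF free ab] k by blast
    obtain u where u: "u \<in> Msemi J k" "ps ! l = ident k u"
      using ident_bij[OF k(1)] prime_in_arch_comp[OF k] unfolding bij_betw_def by blast
    then have "gam p (ps ! l) = Phi_prime p k u"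
      using Phi_prime_eq[OF p] ab by simp
    then show ?thesis
      using k kp \<open>k \<noteq> p\<close> u p by (intro bexI[of _ k]) (auto simp: Lt_def le_star_iff)
  qed
  ultimately show ?thesis
    by (intro exI[of _ "length ps"] exI[of _ "\<lambda>l. gam p (ps ! l)"]) simp
qed

lemma is_isystem_J: "is_isystem J"
  unfolding is_isystem_def sys_of_simps
proof (intro conjI ballI impI)
  show "reflp_on P le_star" "antisymp_on P le_star" "transp_on P le_star"
    by (auto simp: reflp_on_def antisymp_on_def transp_on_def le_star_iff alg_le_refl
        intro: rep_unique alg_le_trans)
  show "Phi_prime j i \<in> hom ((Ghat J i)\<lparr>carrier := Msemi J i\<rparr>) (Gprime j)"
    if "i \<in> P" "j \<in> P" "Lt J i j" for i j
    using that Phi_prime_hom by (simp add: Lt_def le_star_iff)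
  show "Phi_hat J k j (Phi_hat J j i u) = Phi_hat J k i u"
    if "i \<in> P" "j \<in> P" "k \<in> P" "le_star i j" "le_star j k" "u \<in> carrier (Ghat J i)" for i j k u
    using that Phi_hat_comp by (simp add: le_star_iff)
  show "\<exists>(n::nat) s. (\<forall>l<n. \<exists>k\<in>P. Lt J k i \<and> s l \<in> Phi_prime i k ` Msemi J k) \<and>
      g = finprod (Gprime i) s {..<n}"
    if "i \<in> {p \<in> P. free_elt p}" "g \<in> carrier (Gprime i)" for i g
    using that gam_generated by blast
qed (auto intro: comm_group_Gprime)

end

section \<open>Additive functions on generators of a refinement monoid\<close>

text \<open>
  A function on a generating family that is additive along every decomposition of a generator
  into generators extends additively: two expressions of an element have a common refinement.
\<close>

locale additive_on_generators = Q: comm_monoid Q for Q :: "('q, 'r) monoid_scheme" +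
  fixes W :: "'w set" and val :: "'w \<Rightarrow> 'a::comm_monoid_add" and \<Gamma> :: "'w \<Rightarrow> 'q"
  assumes conical: "conical TYPE('a)"
    and refinement: "refinement_monoid TYPE('a)"
    and \<Gamma>_closed: "w \<in> W \<Longrightarrow> \<Gamma> w \<in> carrier Q"
    and val_nonzero: "w \<in> W \<Longrightarrow> \<not> val w \<preceq> 0"
    and decomp: "w \<in> W \<Longrightarrow> t \<preceq> val w \<Longrightarrow> \<exists>ws\<in>lists W. t = sum_list (map val ws)"
    and additive: "w \<in> W \<Longrightarrow> ws \<in> lists W \<Longrightarrow> val w = sum_list (map val ws) \<Longrightarrow>
      \<Gamma> w = foldr (\<lambda>w g. \<Gamma> w \<otimes>\<^bsub>Q\<^esub> g) ws \<one>\<^bsub>Q\<^esub>"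
begin

abbreviation total :: "'w list \<Rightarrow> 'q"
  where "total ws \<equiv> foldr (\<lambda>w g. \<Gamma> w \<otimes>\<^bsub>Q\<^esub> g) ws \<one>\<^bsub>Q\<^esub>"

lemma total_closed: "ws \<in> lists W \<Longrightarrow> total ws \<in> carrier Q"
  by (induction ws) (auto intro: \<Gamma>_closed)

lemma total_append: "us \<in> lists W \<Longrightarrow> vs \<in> lists W \<Longrightarrow> total (us @ vs) = total us \<otimes>\<^bsub>Q\<^esub> total vs"
  by (induction us) (use total_closed \<Gamma>_closed in \<open>auto simp: Q.m_assoc\<close>)

text \<open>Refinement cuts the value of the first generator into \<open>t1 + t2\<close>. By
  \<open>decomp\<close> both pieces are values of lists, and \<open>additive\<close> for the
  concatenation of these lists keeps the total unchanged.\<close>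

lemma total_split:
  assumes "ws \<in> lists W" "sum_list (map val ws) = y + z"
  shows "\<exists>ys\<in>lists W. \<exists>zs\<in>lists W. y = sum_list (map val ys) \<and> z = sum_list (map val zs) \<and>
    total ws = total ys \<otimes>\<^bsub>Q\<^esub> total zs"
  using assms
proof (induction ws arbitrary: y z)
  case Nil
  then have "y + z = 0" by simp
  then have "y = 0" "z = 0" using conical unfolding conical_def by blast+
  then show ?case by (intro bexI[of _ "[]"]) auto
next
  case (Cons w ws)
  then have w: "w \<in> W" and ws: "ws \<in> lists W" by auto
  have "val w + sum_list (map val ws) = y + z" using Cons.prems by simp
  then obtain t1 t2 y' z' where eqs: "val w = t1 + t2" "sum_list (map val ws) = y' + z'"
      "y = t1 + y'" "z = t2 + z'"
    using refinementE[OF refinement] by metis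
  obtain ys zs where IH: "ys \<in> lists W" "zs \<in> lists W" "y' = sum_list (map val ys)"
      "z' = sum_list (map val zs)" "total ws = total ys \<otimes>\<^bsub>Q\<^esub> total zs"
    using Cons.IH[OF eqs(2)] by blast
  have "t1 \<preceq> val w" "t2 \<preceq> val w" using eqs(1) by (auto intro: alg_le_add_left alg_le_add_right alg_le_refl)
  then obtain us vs where uv: "us \<in> lists W" "vs \<in> lists W" "t1 = sum_list (map val us)"
      "t2 = sum_list (map val vs)"
    using decomp[OF w] by metis
  have "\<Gamma> w = total (us @ vs)"
    using additive[OF w, of "us @ vs"] uv eqs(1) by simp
  then have "total (w # ws) = (total us \<otimes>\<^bsub>Q\<^esub> total vs) \<otimes>\<^bsub>Q\<^esub> (total ys \<otimes>\<^bsub>Q\<^esub> total zs)"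
    using uv IH total_append by simp
  also have "\<dots> = total (us @ ys) \<otimes>\<^bsub>Q\<^esub> total (vs @ zs)"
    using uv IH total_append total_closed by (simp add: Q.m_ac)
  finally show ?case
    using uv IH eqs by (intro bexI[of _ "us @ ys"] bexI[of _ "vs @ zs"]) auto
qed

text \<open>Splitting \<open>us\<close> along \<open>val w\<close> plus the rest isolates a list
  with the value of the single generator \<open>w\<close>, to which \<open>additive\<close> applies;
  the rest is compared by induction.\<close>

theorem total_eq:
  assumes "us \<in> lists W" "ws \<in> lists W" "sum_list (map val us) = sum_list (map val ws)"
  shows "total us = total ws"
  using assms
proof (induction ws arbitrary: us)
  case Nil
  then have "us = []"
    using val_nonzero by (cases us) (auto intro: alg_leI simp: alg_le_def)
  then show ?case by simp
next
  case (Cons w ws)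
  have "sum_list (map val us) = val w + sum_list (map val ws)" using Cons.prems by simp
  from total_split[OF Cons.prems(1) this] obtain ys zs where *: "ys \<in> lists W" "zs \<in> lists W" "val w = sum_list (map val ys)"
      "sum_list (map val ws) = sum_list (map val zs)" "total us = total ys \<otimes>\<^bsub>Q\<^esub> total zs"
    by blast
  have "w \<in> W" "ws \<in> lists W" using Cons.prems by auto
  then have "\<Gamma> w = total ys" "total zs = total ws"
    using additive[of w ys] Cons.IH[of zs] * by simp_all
  then show ?case using * by simp
qed

end

section \<open>The components of the monoid of the system\<close>

context prime_system
begin

lemma sum_absorb_idem:
  assumes "finite R" "\<And>i. i \<in> R \<Longrightarrow> f i = 0 \<or> f i + f i = f i \<and> f i \<preceq> (x::'a)"
  shows "sum f R + x = x"
  using assms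
proof (induction R)
  case (insert i R)
  have "f i = 0 \<or> f i + f i = f i \<and> f i \<preceq> x" using insert.prems by blast
  then have "f i + x = x" using idem_absorb[of "f i" x] by auto
  then show ?case using insert by (simp add: add.assoc)
qed simp

lemma bounded_sum:
  assumes "finite T" "\<And>i. i \<in> T \<Longrightarrow> \<exists>n. f i \<preceq> nmult n (e::'a)"
  shows "\<exists>n. sum f T \<preceq> nmult n e"
  using assms
proof (induction T)
  case (insert i T)
  then obtain m n where "f i \<preceq> nmult m e" "sum f T \<preceq> nmult n e" by (metis insertI1 insertI2)
  then have "sum f (insert i T) \<preceq> nmult (m + n) e"
    using insert by (simp add: nmult_add alg_le_add_mono)
  then show ?case ..
qed (auto intro: zero_alg_le)

text \<open>
  \<open>Madm i\<close> holds the coordinates that \<open>H\<^sub>a\<close> allows at a non-maximal \<open>i\<close>. For free \<open>i\<close> this includes the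
  neutral element of \<open>\<widehat>G\<^sub>i\<close>, which lies outside \<open>M\<^sub>i\<close> and contributes nothing to a value;
  for regular \<open>i\<close> the neutral element is the idempotent \<open>i\<close>, and its contribution is absorbed by a
  maximal index above \<open>i\<close>.
\<close>

definition Madm :: "'a \<Rightarrow> (int \<times> 'a grp_elt) set"
  where "Madm i = Msemi J i \<union> (if free_elt i then {\<one>\<^bsub>Ghat J i\<^esub>} else {})"

text \<open>Testing the degree suffices: in \<open>Madm\<close> of a free index only the neutral
  element has degree 0.\<close>

definition ident0 :: "'a \<Rightarrow> int \<times> 'a grp_elt \<Rightarrow> 'a"
  where "ident0 i u = (if free_elt i \<and> fst u = 0 then 0 else ident i u)"

text \<open>Maximal indices stay even at a neutral coordinate: a regular maximal \<open>i\<close>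
  contributes the idempotent \<open>i\<close>, which no other summand need supply.\<close>

definition summands :: "'a set \<Rightarrow> ('a \<Rightarrow> int \<times> 'a grp_elt) \<Rightarrow> 'a set"
  where "summands a z = Max_elts J a \<union> {i \<in> a. z i \<noteq> \<one>\<^bsub>Ghat J i\<^esub>}"

definition eval_at :: "'a set \<Rightarrow> ('a \<Rightarrow> int \<times> 'a grp_elt) \<Rightarrow> 'a"
  where "eval_at a z = (\<Sum>i\<in>summands a z. ident0 i (z i))"

lemma Msemi_Madm: "u \<in> Msemi J i \<Longrightarrow> u \<in> Madm i"
  by (simp add: Madm_def)

lemma ident0_Msemi: "i \<in> P \<Longrightarrow> u \<in> Msemi J i \<Longrightarrow> ident0 i u = ident i u"
  by (auto simp: ident0_def Msemi_def)

lemma ident0_one: "i \<in> P \<Longrightarrow> ident0 i \<one>\<^bsub>Ghat J i\<^esub> = (if free_elt i then 0 else i)"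
  using ident_gam[of i 0 0]
  by (simp add: ident0_def one_Ghat one_Gprime degrees_def base_mult_def)

lemma Madm_Ghat: "i \<in> P \<Longrightarrow> Madm i \<subseteq> carrier (Ghat J i)"
  using Msemi_subset_Ghat comm_group_Ghat[THEN comm_group.axioms(1), THEN comm_monoid.axioms(1), THEN monoid.one_closed]
  by (auto simp: Madm_def)

lemma one_Madm: "i \<in> P \<Longrightarrow> \<one>\<^bsub>Ghat J i\<^esub> \<in> Madm i"
  by (auto simp: Madm_def Msemi_J degrees_def one_Ghat one_Gprime)

lemma Madm_mult_closed:
  assumes i: "i \<in> P" and "u \<in> Madm i" "v \<in> Madm i"
  shows "u \<otimes>\<^bsub>Ghat J i\<^esub> v \<in> Madm i"
    and "u \<in> Msemi J i \<or> v \<in> Msemi J i \<Longrightarrow> u \<otimes>\<^bsub>Ghat J i\<^esub> v \<in> Msemi J i"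
    and "ident0 i (u \<otimes>\<^bsub>Ghat J i\<^esub> v) = ident0 i u + ident0 i v"
proof -
  interpret comm_group "Ghat J i" using i by (rule comm_group_Ghat)
  have uv: "u \<in> carrier (Ghat J i)" "v \<in> carrier (Ghat J i)" using assms Madm_Ghat by auto
  consider "u \<in> Msemi J i" "v \<in> Msemi J i" | "free_elt i" "u = \<one>\<^bsub>Ghat J i\<^esub>"
    | "free_elt i" "v = \<one>\<^bsub>Ghat J i\<^esub>"
    using assms by (auto simp: Madm_def split: if_splits)
  then have "u \<otimes>\<^bsub>Ghat J i\<^esub> v \<in> Madm i \<and> (u \<in> Msemi J i \<or> v \<in> Msemi J i \<longrightarrow> u \<otimes>\<^bsub>Ghat J i\<^esub> v \<in> Msemi J i)
      \<and> ident0 i (u \<otimes>\<^bsub>Ghat J i\<^esub> v) = ident0 i u + ident0 i v"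
  proof cases
    case 1
    then show ?thesis using i Msemi_mult_closed ident_mult by (simp add: Msemi_Madm ident0_Msemi)
  next
    case 2
    have "\<one>\<^bsub>Ghat J i\<^esub> \<notin> Msemi J i" using 2 i by (simp add: Msemi_J degrees_def one_Ghat)
    then show ?thesis using 2 assms uv by (simp add: ident0_one)
  next
    case 3
    have "\<one>\<^bsub>Ghat J i\<^esub> \<notin> Msemi J i" using 3 i by (simp add: Msemi_J degrees_def one_Ghat)
    then show ?thesis using 3 assms uv by (simp add: ident0_one)
  qed
  then show "u \<otimes>\<^bsub>Ghat J i\<^esub> v \<in> Madm i"
    and "u \<in> Msemi J i \<or> v \<in> Msemi J i \<Longrightarrow> u \<otimes>\<^bsub>Ghat J i\<^esub> v \<in> Msemi J i"
    and "ident0 i (u \<otimes>\<^bsub>Ghat J i\<^esub> v) = ident0 i u + ident0 i v" by blast+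
qed

section \<open>Lower sets and their maximal elements\<close>

lemma Lt_iff: "i \<in> P \<Longrightarrow> j \<in> P \<Longrightarrow> Lt J i j \<longleftrightarrow> i \<preceq> j \<and> i \<noteq> j"
  by (simp add: Lt_def le_star_iff)

lemma Max_elts_iff: "a \<subseteq> P \<Longrightarrow> i \<in> Max_elts J a \<longleftrightarrow> i \<in> a \<and> (\<forall>j\<in>a. i \<preceq> j \<longrightarrow> j = i)"
  by (auto simp: Max_elts_def le_star_iff subset_iff)

lemma lower_sets_iff:
  "a \<in> lower_sets J \<longleftrightarrow> a \<subseteq> P \<and> (\<forall>i\<in>a. \<forall>k\<in>P. k \<preceq> i \<longrightarrow> k \<in> a) \<and>
    finite (Max_elts J a) \<and> (\<forall>i\<in>a. \<exists>j\<in>Max_elts J a. i \<preceq> j)"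
  unfolding lower_sets_def
  using Max_elts_iff[of a] by (auto simp: le_star_iff subset_iff; metis)

lemma lower_setsD:
  assumes "a \<in> lower_sets J"
  shows "a \<subseteq> P" "finite (Max_elts J a)" "i \<in> a \<Longrightarrow> k \<in> P \<Longrightarrow> k \<preceq> i \<Longrightarrow> k \<in> a"
    "i \<in> a \<Longrightarrow> \<exists>j\<in>Max_elts J a. i \<preceq> j"
  using assms lower_sets_iff by blast+

lemma Max_elts_subset: "Max_elts J a \<subseteq> a"
  by (auto simp: Max_elts_def)

text \<open>A maximal \<open>j\<close> of \<open>c\<close> stays maximal in the union unless it lies
  in \<open>d\<close>; then a maximal \<open>k\<close> of \<open>d\<close> above \<open>j\<close>
  replaces it. An element of \<open>c\<close> above \<open>k\<close> would put \<open>k\<close> into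
  \<open>c\<close>, forcing \<open>k = j\<close>.\<close>

lemma lower_sets_Un:
  assumes a: "a \<in> lower_sets J" and b: "b \<in> lower_sets J"
  shows "a \<union> b \<in> lower_sets J" and "Max_elts J (a \<union> b) \<subseteq> Max_elts J a \<union> Max_elts J b"
proof -
  show sub: "Max_elts J (a \<union> b) \<subseteq> Max_elts J a \<union> Max_elts J b"
    by (auto simp: Max_elts_def)
  have P: "a \<subseteq> P" "b \<subseteq> P" "a \<union> b \<subseteq> P" using a b lower_setsD by auto
  have "\<exists>j\<in>Max_elts J (a \<union> b). i \<preceq> j" if i: "i \<in> a \<union> b" for i
  proof -
    have *: "\<exists>j\<in>Max_elts J (c \<union> d). i \<preceq> j"
      if c: "c \<in> lower_sets J" and d: "d \<in> lower_sets J" and i: "i \<in> c" for c d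
    proof -
      have cd: "c \<subseteq> P" "d \<subseteq> P" "c \<union> d \<subseteq> P" using c d lower_setsD by auto
      obtain j where j: "j \<in> Max_elts J c" "i \<preceq> j" using lower_setsD(4)[OF c i] by blast
      show ?thesis
      proof (cases "j \<in> d")
        case True
        then obtain k where k: "k \<in> Max_elts J d" "j \<preceq> k" using lower_setsD(4)[OF d] by blast
        have "k \<in> Max_elts J (c \<union> d)"
          unfolding Max_elts_iff[OF cd(3)]
        proof (intro conjI ballI impI)
          show "k \<in> c \<union> d" using k Max_elts_subset by blast
          fix l assume l: "l \<in> c \<union> d" "k \<preceq> l"
          show "l = k"
          proof (cases "l \<in> d")
            case True
            then show ?thesis using k l Max_elts_iff[OF cd(2)] by blast
          next
            case False
            then have lc: "l \<in> c" using l by blast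
            then have "k \<in> c" using lower_setsD(3)[OF c lc] k l cd Max_elts_subset by blast
            then have "k = j" using j k Max_elts_iff[OF cd(1)] by blast
            then show ?thesis using j l lc Max_elts_iff[OF cd(1)] by blast
          qed
        qed
        then show ?thesis using j k alg_le_trans by blast
      next
        case False
        have "j \<in> Max_elts J (c \<union> d)"
          unfolding Max_elts_iff[OF cd(3)]
        proof (intro conjI ballI impI)
          show "j \<in> c \<union> d" using j Max_elts_subset by blast
          fix l assume l: "l \<in> c \<union> d" "j \<preceq> l"
          have "l \<notin> d" using False lower_setsD(3)[OF d, of l j] l j cd Max_elts_subset by blast
          then show "l = j" using l j Max_elts_iff[OF cd(1)] by blast
        qed
        then show ?thesis using j by blast
      qed
    qed
    show ?thesis using *[OF a b] *[OF b a] i by (auto simp: Un_commute)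
  qed
  moreover have "finite (Max_elts J (a \<union> b))"
    using sub lower_setsD(2)[OF a] lower_setsD(2)[OF b] finite_subset by blast
  ultimately show "a \<union> b \<in> lower_sets J"
    unfolding lower_sets_iff using P lower_setsD(3)[OF a] lower_setsD(3)[OF b] by blast
qed

section \<open>The groups Hhat and the semigroups \<open>H_a\<close>\<close>

lemma comm_group_Hhat: assumes "a \<subseteq> P" shows "comm_group (Hhat J a)"
proof -
  have G: "comm_group (Ghat J i)" if "i \<in> a" for i using comm_group_Ghat assms that by blast
  then have "Group.group (Hhat J a)"
    unfolding Hhat_def by (intro sum_group comm_group.axioms(2))
  then show ?thesis
  proof (rule group.group_comm_groupI)
    fix x y assume "x \<in> carrier (Hhat J a)" "y \<in> carrier (Hhat J a)"
    then show "x \<otimes>\<^bsub>Hhat J a\<^esub> y = y \<otimes>\<^bsub>Hhat J a\<^esub> x"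
      using G by (auto simp: Hhat_def carrier_sum_group comm_group.axioms(2) PiE_iff
          intro!: restrict_ext comm_monoid.m_comm[OF comm_group.axioms(1)])
  qed
qed

lemma carrier_Hhat:
  "a \<subseteq> P \<Longrightarrow> carrier (Hhat J a) =
    {x \<in> \<Pi>\<^sub>E i\<in>a. carrier (Ghat J i). finite {i \<in> a. x i \<noteq> \<one>\<^bsub>Ghat J i\<^esub>}}"
  unfolding Hhat_def by (rule carrier_sum_group) (use group_Ghat in blast)

lemma mult_Hhat: "x \<otimes>\<^bsub>Hhat J a\<^esub> y = (\<lambda>i\<in>a. x i \<otimes>\<^bsub>Ghat J i\<^esub> y i)"
  by (simp add: Hhat_def)

lemma one_Hhat: "\<one>\<^bsub>Hhat J a\<^esub> = (\<lambda>i\<in>a. \<one>\<^bsub>Ghat J i\<^esub>)"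
  by (simp add: Hhat_def)

lemma Ghat_one_closed: "i \<in> P \<Longrightarrow> \<one>\<^bsub>Ghat J i\<^esub> \<in> carrier (Ghat J i)"
  using group_Ghat by (simp add: group.is_monoid monoid.one_closed)

lemma chi_closed:
  assumes "a \<subseteq> P" "i \<in> a" "u \<in> carrier (Ghat J i)"
  shows "chi J a i u \<in> carrier (Hhat J a)"
proof -
  have "{k \<in> a. chi J a i u k \<noteq> \<one>\<^bsub>Ghat J k\<^esub>} \<subseteq> {i}" by (auto simp: chi_def)
  then have "finite {k \<in> a. chi J a i u k \<noteq> \<one>\<^bsub>Ghat J k\<^esub>}" using finite_subset by blast
  then show ?thesis
    using assms Ghat_one_closed unfolding carrier_Hhat[OF assms(1)] by (auto simp: chi_def subset_iff)
qed

lemma chi_mult: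
  assumes "a \<subseteq> P" "i \<in> a" "u \<in> carrier (Ghat J i)" "v \<in> carrier (Ghat J i)"
  shows "chi J a i (u \<otimes>\<^bsub>Ghat J i\<^esub> v) = chi J a i u \<otimes>\<^bsub>Hhat J a\<^esub> chi J a i v"
  unfolding mult_Hhat chi_def
  using assms(1) group_Ghat Ghat_one_closed
  by (auto simp: subset_iff group.is_monoid monoid.l_one intro!: restrict_ext)

text \<open>At a regular index both conditions hold automatically, since there \<open>Msemi\<close>
  is all of \<open>Ghat\<close>; stating them for every index avoids a case distinction.\<close>

lemma Hsemi_iff:
  assumes "a \<subseteq> P"
  shows "z \<in> Hsemi J a \<longleftrightarrow> z \<in> carrier (Hhat J a) \<and> (\<forall>i\<in>a. z i \<in> Madm i) \<and>
    (\<forall>i\<in>Max_elts J a. z i \<in> Msemi J i)"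
proof -
  have "(if i \<in> Max_elts J a then z i \<in> {1..} \<times> carrier (Gprime i)
      else z i \<in> {(0, \<one>\<^bsub>Gprime i\<^esub>)} \<union> {1..} \<times> carrier (Gprime i)) \<longleftrightarrow>
      z i \<in> Madm i \<and> (i \<in> Max_elts J a \<longrightarrow> z i \<in> Msemi J i)"
    if "i \<in> a" "free_elt i" for i
    using that assms by (auto simp: Madm_def Msemi_def one_Ghat)
  moreover have "z i \<in> Madm i" "z i \<in> Msemi J i"
    if "z \<in> carrier (Hhat J a)" "i \<in> a" "\<not> free_elt i" for i
    using that assms by (auto simp: Madm_def Msemi_def carrier_Hhat carrier_Ghat PiE_iff subset_iff)
  ultimately show ?thesis
    using assms Max_elts_subset[of a] unfolding Hsemi_def sys_of_simps by blast
qed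

lemma HsemiD:
  assumes "a \<subseteq> P" "z \<in> Hsemi J a"
  shows "z \<in> carrier (Hhat J a)" "i \<in> a \<Longrightarrow> z i \<in> Madm i" "i \<in> Max_elts J a \<Longrightarrow> z i \<in> Msemi J i"
  using assms by (simp_all add: Hsemi_iff)

section \<open>Values of elements of \<open>H_a\<close>\<close>

lemma finite_summands:
  "a \<in> lower_sets J \<Longrightarrow> z \<in> carrier (Hhat J a) \<Longrightarrow> finite (summands a z)"
  using lower_setsD by (simp add: summands_def carrier_Hhat)

lemma summands_subset: "summands a z \<subseteq> a"
  using Max_elts_subset by (auto simp: summands_def)

lemma rep_le_ident0: "i \<in> P \<Longrightarrow> u \<in> Msemi J i \<Longrightarrow> i \<preceq> ident0 i u"
  using rep_le_ident by (simp add: ident0_Msemi)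

lemma Max_sum_le_eval_at:
  assumes a: "a \<in> lower_sets J" and z: "z \<in> Hsemi J a"
  shows "\<Sum>(Max_elts J a) \<preceq> eval_at a z"
proof -
  have aP: "a \<subseteq> P" using a by (rule lower_setsD(1))
  have le: "\<Sum>T \<preceq> (\<Sum>i\<in>T. ident0 i (z i))" if "finite T" "T \<subseteq> Max_elts J a" for T
    using that
  proof (induction T)
    case (insert i T)
    then have i: "i \<in> Max_elts J a" by blast
    then have "i \<in> P" using Max_elts_subset aP by blast
    then have "i \<preceq> ident0 i (z i)" using rep_le_ident0 HsemiD(3)[OF aP z i] by blast
    then show ?case using insert by (simp add: alg_le_add_mono)
  qed (simp add: alg_le_refl)
  have "finite (summands a z)" using finite_summands[OF a HsemiD(1)[OF aP z]] .
  then have "eval_at a z = (\<Sum>i\<in>Max_elts J a. ident0 i (z i)) + (\<Sum>i\<in>summands a z - Max_elts J a. ident0 i (z i))"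
    unfolding eval_at_def by (subst sum.subset_diff[of "Max_elts J a"]) (auto simp: summands_def add.commute)
  then show ?thesis
    using le[OF lower_setsD(2)[OF a] subset_refl] alg_le_add_right by simp
qed

lemma Max_le_eval_at:
  assumes "a \<in> lower_sets J" "z \<in> Hsemi J a" "j \<in> Max_elts J a"
  shows "j \<preceq> eval_at a z"
  using Max_sum_le_eval_at[OF assms(1,2)] summand_alg_le_sum[OF lower_setsD(2)[OF assms(1)] assms(3), of "\<lambda>x. x"]
    alg_le_trans by blast

lemma le_eval_at:
  assumes "a \<in> lower_sets J" "z \<in> Hsemi J a" "i \<in> a"
  shows "i \<preceq> eval_at a z"
  using Max_le_eval_at[OF assms(1,2)] lower_setsD(4)[OF assms(1,3)] alg_le_trans by blast

lemma ident0_absorb: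
  assumes "finite R" "R \<subseteq> a" "a \<in> lower_sets J" "z \<in> Hsemi J a"
  shows "(\<Sum>i\<in>R. ident0 i \<one>\<^bsub>Ghat J i\<^esub>) + eval_at a z = eval_at a z"
proof (rule sum_absorb_idem[OF assms(1)])
  fix i assume "i \<in> R"
  then have "i \<in> a" "i \<in> P" using assms lower_setsD by auto
  then show "ident0 i \<one>\<^bsub>Ghat J i\<^esub> = 0 \<or> ident0 i \<one>\<^bsub>Ghat J i\<^esub> + ident0 i \<one>\<^bsub>Ghat J i\<^esub> = ident0 i \<one>\<^bsub>Ghat J i\<^esub> \<and>
      ident0 i \<one>\<^bsub>Ghat J i\<^esub> \<preceq> eval_at a z"
    using le_eval_at[OF assms(3,4)] not_free_idem by (simp add: ident0_one)
qed

text \<open>Additional indices carry neutral coordinates, worth 0 or the idempotent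
  \<open>i\<close>. Every \<open>i\<close> in \<open>a\<close> is below the value, which absorbs it.
  Two elements can thus be summed over a common index set.\<close>

lemma eval_at_eq:
  assumes a: "a \<in> lower_sets J" and z: "z \<in> Hsemi J a" and T: "finite T" "summands a z \<subseteq> T" "T \<subseteq> a"
  shows "(\<Sum>i\<in>T. ident0 i (z i)) = eval_at a z"
proof -
  have "(\<Sum>i\<in>T. ident0 i (z i)) = (\<Sum>i\<in>T - summands a z. ident0 i (z i)) + eval_at a z"
    unfolding eval_at_def using T by (simp add: sum.subset_diff)
  also have "(\<Sum>i\<in>T - summands a z. ident0 i (z i)) = (\<Sum>i\<in>T - summands a z. ident0 i \<one>\<^bsub>Ghat J i\<^esub>)"
    using T by (intro sum.cong) (auto simp: summands_def)
  also have "\<dots> + eval_at a z = eval_at a z"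
    using T by (intro ident0_absorb[OF _ _ a z]) auto
  finally show ?thesis .
qed

lemma emb_closed:
  assumes "b \<subseteq> P" "a \<subseteq> b" "x \<in> carrier (Hhat J a)"
  shows "emb J a b x \<in> carrier (Hhat J b)"
proof -
  have "a \<subseteq> P" using assms by blast
  have "{i \<in> b. emb J a b x i \<noteq> \<one>\<^bsub>Ghat J i\<^esub>} \<subseteq> {i \<in> a. x i \<noteq> \<one>\<^bsub>Ghat J i\<^esub>}"
    by (auto simp: emb_def split: if_splits)
  then have "finite {i \<in> b. emb J a b x i \<noteq> \<one>\<^bsub>Ghat J i\<^esub>}"
    using assms(3) finite_subset unfolding carrier_Hhat[OF \<open>a \<subseteq> P\<close>] by blast
  then show ?thesis
    using assms Ghat_one_closed unfolding carrier_Hhat[OF \<open>a \<subseteq> P\<close>] carrier_Hhat[OF \<open>b \<subseteq> P\<close>]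
    by (auto simp: emb_def PiE_iff subset_iff)
qed

lemma eval_at_add:
  assumes a: "a \<in> lower_sets J" and b: "b \<in> lower_sets J"
    and x: "x \<in> Hsemi J a" and y: "y \<in> Hsemi J b"
  defines "w \<equiv> emb J a (a \<union> b) x \<otimes>\<^bsub>Hhat J (a \<union> b)\<^esub> emb J b (a \<union> b) y"
  shows "w \<in> Hsemi J (a \<union> b)" and "eval_at (a \<union> b) w = eval_at a x + eval_at b y"
proof -
  let ?c = "a \<union> b" and ?x = "emb J a (a \<union> b) x" and ?y = "emb J b (a \<union> b) y"
  have P: "a \<subseteq> P" "b \<subseteq> P" "?c \<subseteq> P" and c: "?c \<in> lower_sets J"
    using a b lower_setsD lower_sets_Un by auto
  interpret H: comm_group "Hhat J ?c" using P(3) by (rule comm_group_Hhat)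
  have xc: "x \<in> carrier (Hhat J a)" "\<And>i. i \<in> a \<Longrightarrow> x i \<in> Madm i" "\<And>i. i \<in> Max_elts J a \<Longrightarrow> x i \<in> Msemi J i"
    and yc: "y \<in> carrier (Hhat J b)" "\<And>i. i \<in> b \<Longrightarrow> y i \<in> Madm i" "\<And>i. i \<in> Max_elts J b \<Longrightarrow> y i \<in> Msemi J i"
    using HsemiD[OF P(1) x] HsemiD[OF P(2) y] by blast+
  have adm: "?x i \<in> Madm i" "?y i \<in> Madm i" if "i \<in> ?c" for i
    using that xc yc P one_Madm by (auto simp: emb_def)
  have w_i: "w i = ?x i \<otimes>\<^bsub>Ghat J i\<^esub> ?y i" if "i \<in> ?c" for i
    using that by (simp add: w_def mult_Hhat)
  have wc: "w \<in> carrier (Hhat J ?c)"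
    unfolding w_def using emb_closed[OF P(3) _ xc(1)] emb_closed[OF P(3) _ yc(1)] by simp
  have "w i \<in> Msemi J i" if i: "i \<in> Max_elts J ?c" for i
  proof -
    have "i \<in> Max_elts J a \<or> i \<in> Max_elts J b" using i lower_sets_Un(2)[OF a b] by blast
    then have "?x i \<in> Msemi J i \<or> ?y i \<in> Msemi J i"
      using xc(3) yc(3) Max_elts_subset by (auto simp: emb_def subset_iff)
    moreover have "i \<in> ?c" using i Max_elts_subset by blast
    ultimately show ?thesis using Madm_mult_closed(2)[of i "?x i" "?y i"] adm w_i P by auto
  qed
  moreover have "w i \<in> Madm i" if i: "i \<in> ?c" for i
    unfolding w_i[OF i] using i P(3) by (intro Madm_mult_closed(1) adm) blast+
  ultimately show w: "w \<in> Hsemi J ?c" using wc Hsemi_iff[OF P(3)] by blast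
  define T where "T = summands a x \<union> summands b y"
  have T: "finite T" "T \<subseteq> ?c"
    using finite_summands[OF a xc(1)] finite_summands[OF b yc(1)] summands_subset[of a x] summands_subset[of b y]
    by (auto simp: T_def)
  have "summands ?c w \<subseteq> T"
  proof
    fix i assume i: "i \<in> summands ?c w"
    show "i \<in> T"
    proof (rule ccontr)
      assume nT: "i \<notin> T"
      have ic: "i \<in> ?c" using i summands_subset by blast
      then interpret G: comm_group "Ghat J i" using P by (intro comm_group_Ghat) blast
      have "?x i = \<one>\<^bsub>Ghat J i\<^esub>" "?y i = \<one>\<^bsub>Ghat J i\<^esub>"
        using nT ic by (auto simp: T_def summands_def emb_def)
      then have "w i = \<one>\<^bsub>Ghat J i\<^esub>" using w_i[OF ic] by simp
      then show False
        using i nT lower_sets_Un(2)[OF a b] by (auto simp: T_def summands_def)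
    qed
  qed
  then have "eval_at ?c w = (\<Sum>i\<in>T. ident0 i (w i))"
    using eval_at_eq[OF c w T(1) _ T(2)] by simp
  also have "\<dots> = (\<Sum>i\<in>T. ident0 i (?x i) + ident0 i (?y i))"
    using T P adm w_i by (intro sum.cong) (auto simp: Madm_mult_closed(3) subset_iff)
  also have "\<dots> = (\<Sum>i\<in>T. ident0 i (?x i)) + (\<Sum>i\<in>T. ident0 i (?y i))"
    by (rule sum.distrib)
  also have "(\<Sum>i\<in>T. ident0 i (?x i)) = (\<Sum>i\<in>T \<inter> a. ident0 i (x i)) + (\<Sum>i\<in>T - a. ident0 i \<one>\<^bsub>Ghat J i\<^esub>)"
    using T by (subst sum.Int_Diff[of _ _ a]) (auto simp: emb_def intro!: arg_cong2[of _ _ _ _ "(+)"] sum.cong)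
  also have "(\<Sum>i\<in>T \<inter> a. ident0 i (x i)) = eval_at a x"
    using T summands_subset[of a x] by (intro eval_at_eq[OF a x]) (auto simp: T_def)
  also have "(\<Sum>i\<in>T. ident0 i (?y i)) = (\<Sum>i\<in>T \<inter> b. ident0 i (y i)) + (\<Sum>i\<in>T - b. ident0 i \<one>\<^bsub>Ghat J i\<^esub>)"
    using T by (subst sum.Int_Diff[of _ _ b]) (auto simp: emb_def intro!: arg_cong2[of _ _ _ _ "(+)"] sum.cong)
  also have "(\<Sum>i\<in>T \<inter> b. ident0 i (y i)) = eval_at b y"
    using T summands_subset[of b y] by (intro eval_at_eq[OF b y]) (auto simp: T_def)
  \<comment> \<open>Padding \<open>x\<close> outside \<open>a\<close> adds idempotents of indices
    from \<open>b\<close>, and vice versa. The two padding sums are exchanged so that each meets the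
    value that absorbs it.\<close>
  also have "(eval_at a x + (\<Sum>i\<in>T - a. ident0 i \<one>\<^bsub>Ghat J i\<^esub>)) + (eval_at b y + (\<Sum>i\<in>T - b. ident0 i \<one>\<^bsub>Ghat J i\<^esub>))
      = ((\<Sum>i\<in>T - b. ident0 i \<one>\<^bsub>Ghat J i\<^esub>) + eval_at a x) + ((\<Sum>i\<in>T - a. ident0 i \<one>\<^bsub>Ghat J i\<^esub>) + eval_at b y)"
    by (simp only: ac_simps)
  also have "(\<Sum>i\<in>T - b. ident0 i \<one>\<^bsub>Ghat J i\<^esub>) + eval_at a x = eval_at a x"
    using T by (intro ident0_absorb[OF _ _ a x]) auto
  also have "(\<Sum>i\<in>T - a. ident0 i \<one>\<^bsub>Ghat J i\<^esub>) + eval_at b y = eval_at b y"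
    using T by (intro ident0_absorb[OF _ _ b y]) auto
  finally show "eval_at ?c w = eval_at a x + eval_at b y" .
qed

lemma eval_at_mult:
  assumes a: "a \<in> lower_sets J" and x: "x \<in> Hsemi J a" and y: "y \<in> Hsemi J a"
  shows "x \<otimes>\<^bsub>Hhat J a\<^esub> y \<in> Hsemi J a"
    and "eval_at a (x \<otimes>\<^bsub>Hhat J a\<^esub> y) = eval_at a x + eval_at a y"
proof -
  have "emb J a a z = z" if "z \<in> Hsemi J a" for z
    using that lower_setsD(1)[OF a] by (auto simp: emb_def Hsemi_iff carrier_Hhat PiE_iff extensional_def)
  then show "x \<otimes>\<^bsub>Hhat J a\<^esub> y \<in> Hsemi J a"
    and "eval_at a (x \<otimes>\<^bsub>Hhat J a\<^esub> y) = eval_at a x + eval_at a y"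
    using eval_at_add[OF a a x y] x y by simp_all
qed

lemma eval_at_bounded:
  assumes a: "a \<in> lower_sets J" and z: "z \<in> Hsemi J a"
  shows "\<exists>n. eval_at a z \<preceq> nmult n (\<Sum>(Max_elts J a))"
  unfolding eval_at_def
proof (rule bounded_sum)
  have aP: "a \<subseteq> P" using a by (rule lower_setsD(1))
  show "finite (summands a z)" using finite_summands[OF a HsemiD(1)[OF aP z]] .
  fix i assume "i \<in> summands a z"
  then have ia: "i \<in> a" using summands_subset by blast
  then have iP: "i \<in> P" using aP by blast
  obtain j where j: "j \<in> Max_elts J a" "i \<preceq> j" using lower_setsD(4)[OF a ia] by blast
  have je: "j \<preceq> \<Sum>(Max_elts J a)"
    using summand_alg_le_sum[OF lower_setsD(2)[OF a] j(1), of "\<lambda>x. x"] .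
  have "\<exists>n. ident0 i (z i) \<preceq> nmult n i"
  proof (cases "z i \<in> Msemi J i")
    case True
    then have "\<exists>n. ident i (z i) \<preceq> nmult n i"
      using ident_arch_comp[OF iP True] unfolding arch_comp_iff[OF iP] by blast
    then show ?thesis using ident0_Msemi[OF iP True] by simp
  next
    case False
    then have "ident0 i (z i) = 0"
      using HsemiD(2)[OF aP z ia] iP by (auto simp: Madm_def ident0_one split: if_splits)
    then show ?thesis by (auto intro: zero_alg_le)
  qed
  then show "\<exists>n. ident0 i (z i) \<preceq> nmult n (\<Sum>(Max_elts J a))"
    using nmult_mono[OF j(2)] nmult_mono[OF je] alg_le_trans by blast
qed

text \<open>Some multiple of the sum \<open>?e\<close> of the maximal indices is above the value of
  \<open>k\<close>, so \<open>k\<close> is traded for that multiple. All values are above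
  \<open>?e\<close>, and its copies cancel prime by prime.\<close>

lemma eval_at_cancel:
  assumes a: "a \<in> lower_sets J" and x: "x \<in> Hsemi J a" and y: "y \<in> Hsemi J a" and k: "k \<in> Hsemi J a"
    and eq: "eval_at a x + eval_at a k = eval_at a y + eval_at a k"
  shows "eval_at a x = eval_at a y"
proof -
  let ?e = "\<Sum>(Max_elts J a)"
  have P: "Max_elts J a \<subseteq> P" using Max_elts_subset lower_setsD(1)[OF a] by blast
  have e_cancel: "x = y" if "?e + x = ?e + y" "?e \<preceq> x" "?e \<preceq> y" for x y
  proof (rule reps_cancel[of "Max_elts J a" "\<lambda>x. x"])
    show "\<forall>i\<in>Max_elts J a. i \<preceq> x \<and> i \<preceq> y"
      using that summand_alg_le_sum[OF lower_setsD(2)[OF a], of _ "\<lambda>x. x"] alg_le_trans by blast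
  qed (use that P lower_setsD(2)[OF a] in auto)
  obtain n where "eval_at a k \<preceq> nmult n ?e" using eval_at_bounded[OF a k] by blast
  then obtain c where c: "nmult n ?e = eval_at a k + c" by (rule alg_leE)
  have "nmult n ?e + eval_at a x = (eval_at a x + eval_at a k) + c"
    unfolding c by (simp only: ac_simps)
  also have "\<dots> = nmult n ?e + eval_at a y"
    unfolding eq c by (simp only: ac_simps)
  finally have "nmult n ?e + eval_at a x = nmult n ?e + eval_at a y" .
  then show ?thesis
    using nmult_cancel[of ?e n "eval_at a x" "eval_at a y"] e_cancel Max_sum_le_eval_at[OF a] x y by blast
qed

end

section \<open>Elements of \<open>U_a\<close> as differences of equal values\<close>

text \<open>Additively: adding \<open>a - c\<close> exchanges the summand \<open>c\<close> for
  \<open>a\<close>. The difference will be a generator of \<open>Usub\<close>.\<close>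

lemma (in comm_group) mult_inv_swap:
  assumes "a \<in> carrier G" "b \<in> carrier G" "c \<in> carrier G" "d \<in> carrier G" "e \<in> carrier G"
  shows "(a \<otimes> inv c) \<otimes> ((e \<otimes> b) \<otimes> (c \<otimes> d)) = (e \<otimes> (a \<otimes> b)) \<otimes> d"
proof -
  have "(a \<otimes> inv c) \<otimes> ((e \<otimes> b) \<otimes> (c \<otimes> d)) = (inv c \<otimes> c) \<otimes> ((e \<otimes> (a \<otimes> b)) \<otimes> d)"
    using assms inv_closed[OF assms(3)] by (simp only: m_ac m_closed)
  then show ?thesis using assms by simp
qed

context prime_system
begin

text \<open>Only the summand at \<open>i\<close> changes. The two uses are a factor from M_i at any
  index and a degree-zero factor at a maximal index.\<close>

lemma eval_at_mult_chi:
  assumes a: "a \<in> lower_sets J" and w: "w \<in> Hsemi J a" and i: "i \<in> a" and c: "c \<in> carrier (Ghat J i)"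
    and adm: "w i \<otimes>\<^bsub>Ghat J i\<^esub> c \<in> Msemi J i"
    and x: "ident i (w i \<otimes>\<^bsub>Ghat J i\<^esub> c) = ident0 i (w i) + x"
  shows "w \<otimes>\<^bsub>Hhat J a\<^esub> chi J a i c \<in> Hsemi J a \<and> eval_at a (w \<otimes>\<^bsub>Hhat J a\<^esub> chi J a i c) = eval_at a w + x"
proof -
  have aP: "a \<subseteq> P" using a by (rule lower_setsD(1))
  interpret H: comm_group "Hhat J a" using aP by (rule comm_group_Hhat)
  note wc = HsemiD[OF aP w]
  let ?w = "w \<otimes>\<^bsub>Hhat J a\<^esub> chi J a i c"
  have i_eq: "?w i = w i \<otimes>\<^bsub>Ghat J i\<^esub> c" using i by (simp add: mult_Hhat chi_def)
  have k_eq: "?w k = w k" if k: "k \<in> a" "k \<noteq> i" for k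
  proof -
    interpret G: comm_group "Ghat J k" using k aP by (intro comm_group_Ghat) blast
    have "w k \<in> carrier (Ghat J k)" using wc(2)[OF k(1)] Madm_Ghat k aP by blast
    then show ?thesis using k by (simp add: mult_Hhat chi_def)
  qed
  have "?w \<in> carrier (Hhat J a)" using wc(1) chi_closed[OF aP i c] by simp
  moreover have "?w k \<in> Madm k" if "k \<in> a" for k
    using that wc(2) adm Msemi_Madm i_eq k_eq by (cases "k = i") auto
  moreover have "?w k \<in> Msemi J k" if k: "k \<in> Max_elts J a" for k
  proof -
    have "k \<in> a" using k Max_elts_subset by blast
    then show ?thesis using wc(3)[OF k] adm i_eq k_eq by (cases "k = i") auto
  qed
  ultimately have w': "?w \<in> Hsemi J a" using Hsemi_iff[OF aP] by blast
  define T where "T = insert i (summands a w)"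
  have T: "finite T" "T \<subseteq> a" "summands a w \<subseteq> T"
    using finite_summands[OF a wc(1)] summands_subset i by (auto simp: T_def)
  have "summands a ?w \<subseteq> T"
    using k_eq by (auto simp: T_def summands_def)
  then have "eval_at a ?w = (\<Sum>k\<in>T. ident0 k (?w k))"
    using eval_at_eq[OF a w' T(1) _ T(2)] by simp
  also have "\<dots> = (ident0 i (w i) + x) + (\<Sum>k\<in>T - {i}. ident0 k (?w k))"
    using T i aP adm x by (subst sum.remove[of _ i]) (auto simp: T_def i_eq ident0_Msemi)
  also have "(\<Sum>k\<in>T - {i}. ident0 k (?w k)) = (\<Sum>k\<in>T - {i}. ident0 k (w k))"
    using T k_eq by (intro sum.cong) auto
  also have "(ident0 i (w i) + x) + \<dots> = (\<Sum>k\<in>T. ident0 k (w k)) + x"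
    using T by (subst sum.remove[of T i]) (auto simp: T_def ac_simps)
  also have "(\<Sum>k\<in>T. ident0 k (w k)) = eval_at a w"
    using eval_at_eq[OF a w T(1) T(3) T(2)] .
  finally show ?thesis using w' by blast
qed

lemma eval_at_mult_chi_Msemi:
  assumes "a \<in> lower_sets J" "w \<in> Hsemi J a" "i \<in> a" "u \<in> Msemi J i"
  shows "w \<otimes>\<^bsub>Hhat J a\<^esub> chi J a i u \<in> Hsemi J a \<and>
    eval_at a (w \<otimes>\<^bsub>Hhat J a\<^esub> chi J a i u) = eval_at a w + ident i u"
proof -
  have aP: "a \<subseteq> P" using assms(1) by (rule lower_setsD(1))
  then have iP: "i \<in> P" using assms(3) by blast
  have wi: "w i \<in> Madm i" using HsemiD(2)[OF aP assms(2,3)] .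
  have prod: "w i \<otimes>\<^bsub>Ghat J i\<^esub> u \<in> Msemi J i"
    using Madm_mult_closed(2)[OF iP wi Msemi_Madm] assms(4) by blast
  have "ident i (w i \<otimes>\<^bsub>Ghat J i\<^esub> u) = ident0 i (w i) + ident i u"
    using Madm_mult_closed(3)[OF iP wi Msemi_Madm[OF assms(4)]] ident0_Msemi[OF iP] prod assms(4) by simp
  then show ?thesis
    using eval_at_mult_chi[OF assms(1-3) _ prod] Msemi_subset_Ghat[OF iP] assms(4) by blast
qed

text \<open>Maximality of \<open>j\<close> ensures that the coordinate of \<open>w\<close> at
  \<open>j\<close> lies in M_j, where G_j acts. A neutral coordinate at a free index could become
  one of degree 0 that \<open>Hsemi\<close> forbids.\<close>

lemma eval_at_mult_chi_zero_gam:
  assumes "a \<in> lower_sets J" "w \<in> Hsemi J a" "j \<in> Max_elts J a" "x \<in> absorbed j"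
  shows "w \<otimes>\<^bsub>Hhat J a\<^esub> chi J a j (0, gam j x) \<in> Hsemi J a \<and>
    eval_at a (w \<otimes>\<^bsub>Hhat J a\<^esub> chi J a j (0, gam j x)) = eval_at a w + x"
proof -
  have aP: "a \<subseteq> P" using assms(1) by (rule lower_setsD(1))
  have ja: "j \<in> a" using assms(3) Max_elts_subset by blast
  then have jP: "j \<in> P" using aP by blast
  have wj: "w j \<in> Msemi J j" using HsemiD(3)[OF aP assms(2,3)] .
  note prod = ident_mult_gam[OF jP wj assms(4)]
  show ?thesis
    by (rule eval_at_mult_chi[OF assms(1,2) ja zero_gam_in_Ghat[OF jP assms(4)] prod(1)])
      (simp add: prod(2) ident0_Msemi[OF jP wj])
qed

lemma Hsemi_nonempty:
  assumes a: "a \<in> lower_sets J"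
  shows "Hsemi J a \<noteq> {}"
proof -
  have aP: "a \<subseteq> P" using a by (rule lower_setsD(1))
  \<comment> \<open>Degree 1 is the least that \<open>Hsemi\<close> allows at a free maximal index;
    every other coordinate may be neutral.\<close>
  define e where "e = (\<lambda>k\<in>a. if k \<in> Max_elts J a \<and> free_elt k then (1, \<one>\<^bsub>Gprime k\<^esub>) else \<one>\<^bsub>Ghat J k\<^esub>)"
  have e_in: "(1, \<one>\<^bsub>Gprime k\<^esub>) \<in> Msemi J k" if "k \<in> P" "free_elt k" for k
    using that by (auto simp: Msemi_J one_Gprime degrees_def)
  have "{k \<in> a. e k \<noteq> \<one>\<^bsub>Ghat J k\<^esub>} \<subseteq> Max_elts J a"
    by (auto simp: e_def split: if_splits)
  then have "finite {k \<in> a. e k \<noteq> \<one>\<^bsub>Ghat J k\<^esub>}"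
    using lower_setsD(2)[OF a] finite_subset by blast
  moreover have "e \<in> (\<Pi>\<^sub>E i\<in>a. carrier (Ghat J i))"
    using aP e_in Msemi_subset_Ghat Ghat_one_closed by (auto simp: e_def subset_iff)
  moreover have "e k \<in> Madm k" if "k \<in> a" for k
    using that aP e_in one_Madm Msemi_Madm by (auto simp: e_def)
  moreover have "e k \<in> Msemi J k" if "k \<in> Max_elts J a" for k
  proof (cases "free_elt k")
    case False
    have "k \<in> a" using that Max_elts_subset by blast
    then show ?thesis using that False aP by (auto simp: e_def Msemi_J one_Gprime degrees_def one_Ghat)
  next
    case True
    have "k \<in> a" using that Max_elts_subset by blast
    then show ?thesis using that True aP e_in by (auto simp: e_def)
  qed
  ultimately have "e \<in> Hsemi J a"
    unfolding Hsemi_iff[OF aP] carrier_Hhat[OF aP] by blast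
  then show ?thesis by blast
qed

lemma Usub_generators_closed:
  assumes "a \<subseteq> P"
  shows "{chi J a i u \<otimes>\<^bsub>Hhat J a\<^esub> inv\<^bsub>Hhat J a\<^esub> (chi J a j (Phi_hat J j i u)) | i j u.
      i \<in> a \<and> j \<in> Max_elts J a \<and> Lt J i j \<and> u \<in> carrier (Ghat J i)} \<subseteq> carrier (Hhat J a)"
proof -
  interpret H: comm_group "Hhat J a" using assms by (rule comm_group_Hhat)
  have "chi J a i u \<otimes>\<^bsub>Hhat J a\<^esub> inv\<^bsub>Hhat J a\<^esub> (chi J a j (Phi_hat J j i u)) \<in> carrier (Hhat J a)"
    if "i \<in> a" "j \<in> Max_elts J a" "Lt J i j" "u \<in> carrier (Ghat J i)" for i j u
  proof -
    have ij: "i \<in> P" "j \<in> P" "j \<in> a" using that assms Max_elts_subset by blast+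
    have "Phi_hat J j i u \<in> carrier (Ghat J j)"
      using hom_in_carrier[OF Phi_hat_hom] that ij Lt_iff by blast
    then show ?thesis using chi_closed[OF assms] that ij by simp
  qed
  then show ?thesis by blast
qed

lemma subgroup_Usub: "a \<subseteq> P \<Longrightarrow> subgroup (Usub J a) (Hhat J a)"
  unfolding Usub_def
  using Usub_generators_closed comm_group.axioms(2)[OF comm_group_Hhat]
  by (intro group.generate_is_subgroup) auto

text \<open>\<open>h\<close> itself need not have a value, so it is written as a difference of two
  elements of \<open>H_a\<close> with the same value. Inverses exchange the two, and products
  multiply them.\<close>

lemma Usub_imp_eval_eq:
  assumes a: "a \<in> lower_sets J" and h: "h \<in> Usub J a"
  shows "\<exists>y\<in>Hsemi J a. \<exists>z\<in>Hsemi J a. h \<otimes>\<^bsub>Hhat J a\<^esub> y = z \<and> eval_at a y = eval_at a z"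
proof -
  have aP: "a \<subseteq> P" using a by (rule lower_setsD(1))
  interpret H: comm_group "Hhat J a" using aP by (rule comm_group_Hhat)
  note cl = HsemiD(1)[OF aP]
  obtain e where e: "e \<in> Hsemi J a" using Hsemi_nonempty[OF a] by blast
  let ?R = "\<lambda>h. \<exists>y\<in>Hsemi J a. \<exists>z\<in>Hsemi J a. h \<otimes>\<^bsub>Hhat J a\<^esub> y = z \<and> eval_at a y = eval_at a z"
  have inverse: "?R (inv\<^bsub>Hhat J a\<^esub> h)" if "h \<in> carrier (Hhat J a)" "?R h" for h
  proof -
    obtain y z where yz: "y \<in> Hsemi J a" "z \<in> Hsemi J a" "h \<otimes>\<^bsub>Hhat J a\<^esub> y = z" "eval_at a y = eval_at a z"
      using \<open>?R h\<close> by blast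
    have "inv\<^bsub>Hhat J a\<^esub> h \<otimes>\<^bsub>Hhat J a\<^esub> z = y"
      unfolding yz(3)[symmetric] using that(1) cl[OF yz(1)] by (simp add: H.m_assoc[symmetric])
    then show ?thesis using yz(1,2) yz(4)[symmetric] by blast
  qed
  have generator: "?R (chi J a i u \<otimes>\<^bsub>Hhat J a\<^esub> inv\<^bsub>Hhat J a\<^esub> (chi J a j (Phi_hat J j i u)))"
    if i: "i \<in> a" and j: "j \<in> Max_elts J a" and lt: "Lt J i j" and u: "u \<in> carrier (Ghat J i)" for i j u
  proof -
    have P: "i \<in> P" "j \<in> P" and ja: "j \<in> a" using i j aP Max_elts_subset by blast+
    have ij: "i \<preceq> j" "i \<noteq> j" using lt Lt_iff P by auto
    interpret G: comm_group "Ghat J i" using P by (intro comm_group_Ghat)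
    obtain v where v: "v \<in> Msemi J i" "u \<otimes>\<^bsub>Ghat J i\<^esub> v \<in> Msemi J i"
      using Msemi_cofinal[OF P(1) u] .
    have v': "v \<in> carrier (Ghat J i)" using v Msemi_subset_Ghat P by blast
    let ?uv = "u \<otimes>\<^bsub>Ghat J i\<^esub> v" and ?\<phi> = "Phi_hat J j i"
    note hom = Phi_hat_hom[OF P(2,1) ij(1)]
    have eq: "?\<phi> t = (0, gam j (ident i t))" "ident i t \<in> absorbed j" if "t \<in> Msemi J i" for t
      using that Phi_ext_eq[OF P(2,1) ij] ident_absorbed[OF P(2,1) ij] ij by (simp_all add: Phi_hat_def)
    note chi_c = chi_closed[OF aP i] chi_closed[OF aP ja] and \<phi>_c = hom_in_carrier[OF hom]
    have step: "(e \<otimes>\<^bsub>Hhat J a\<^esub> chi J a i s) \<otimes>\<^bsub>Hhat J a\<^esub> chi J a j (?\<phi> t) \<in> Hsemi J a \<and>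
      eval_at a ((e \<otimes>\<^bsub>Hhat J a\<^esub> chi J a i s) \<otimes>\<^bsub>Hhat J a\<^esub> chi J a j (?\<phi> t))
        = eval_at a e + ident i s + ident i t"
      if s: "s \<in> Msemi J i" and t: "t \<in> Msemi J i" for s t
    proof -
      note es = eval_at_mult_chi_Msemi[OF a e i s]
      show ?thesis
        using eval_at_mult_chi_zero_gam[OF a conjunct1[OF es] j eq(2)[OF t]] es unfolding eq(1)[OF t] by simp
    qed
    \<comment> \<open>\<open>?y\<close> has \<open>v\<close> at \<open>i\<close> and the image of
      \<open>u\<close> times \<open>v\<close> at \<open>j\<close>; \<open>?z\<close> has these two
      roles exchanged. Both values exceed that of \<open>e\<close> by the same sum, and the
      generator is their difference.\<close>
    let ?y = "(e \<otimes>\<^bsub>Hhat J a\<^esub> chi J a i v) \<otimes>\<^bsub>Hhat J a\<^esub> chi J a j (?\<phi> ?uv)"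
    let ?z = "(e \<otimes>\<^bsub>Hhat J a\<^esub> chi J a i ?uv) \<otimes>\<^bsub>Hhat J a\<^esub> chi J a j (?\<phi> v)"
    let ?g = "chi J a i u \<otimes>\<^bsub>Hhat J a\<^esub> inv\<^bsub>Hhat J a\<^esub> (chi J a j (?\<phi> u))"
    have "?g \<otimes>\<^bsub>Hhat J a\<^esub> ?y = ?g \<otimes>\<^bsub>Hhat J a\<^esub> ((e \<otimes>\<^bsub>Hhat J a\<^esub> chi J a i v) \<otimes>\<^bsub>Hhat J a\<^esub>
        (chi J a j (?\<phi> u) \<otimes>\<^bsub>Hhat J a\<^esub> chi J a j (?\<phi> v)))"
      using hom_mult[OF hom u v'] chi_mult[OF aP ja \<phi>_c[OF u] \<phi>_c[OF v']] by simp
    also have "\<dots> = ?z"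
      using H.mult_inv_swap chi_c u v' \<phi>_c cl[OF e] chi_mult[OF aP i u v'] by simp
    finally have "?g \<otimes>\<^bsub>Hhat J a\<^esub> ?y = ?z" .
    moreover have "eval_at a ?y = eval_at a ?z"
      using step[OF v] step[OF v(2,1)] by (simp add: ac_simps)
    ultimately show ?thesis using step[OF v] step[OF v(2,1)] by blast
  qed
  show ?thesis
    using h unfolding Usub_def
  proof (induction rule: generate.induct)
    case one
    then show ?case using e cl[OF e] by (intro bexI[of _ e]) auto
  next
    case (incl h)
    then show ?case using generator by blast
  next
    case (inv h)
    then have "?R h" using generator by blast
    then show ?case using inverse inv Usub_generators_closed[OF aP] by blast
  next
    case (eng h1 h2)
    then obtain y1 z1 y2 z2 where *:
        "y1 \<in> Hsemi J a" "z1 \<in> Hsemi J a" "h1 \<otimes>\<^bsub>Hhat J a\<^esub> y1 = z1" "eval_at a y1 = eval_at a z1"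
        "y2 \<in> Hsemi J a" "z2 \<in> Hsemi J a" "h2 \<otimes>\<^bsub>Hhat J a\<^esub> y2 = z2" "eval_at a y2 = eval_at a z2"
      by blast
    have h12: "h1 \<in> carrier (Hhat J a)" "h2 \<in> carrier (Hhat J a)"
      using eng.hyps H.generate_in_carrier[OF Usub_generators_closed[OF aP]] by blast+
    have "(h1 \<otimes>\<^bsub>Hhat J a\<^esub> h2) \<otimes>\<^bsub>Hhat J a\<^esub> (y1 \<otimes>\<^bsub>Hhat J a\<^esub> y2) = z1 \<otimes>\<^bsub>Hhat J a\<^esub> z2"
      using h12 cl[OF *(1)] cl[OF *(5)] by (simp add: H.m_ac flip: *(3,7))
    then show ?case
      using eval_at_mult[OF a *(1,5)] eval_at_mult[OF a *(2,6)] *(4,8) by metis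
  qed
qed

section \<open>Cosets of \<open>U_a\<close> as a function of the value\<close>

definition coset :: "'a set \<Rightarrow> ('a \<Rightarrow> int \<times> 'a grp_elt) \<Rightarrow> ('a \<Rightarrow> int \<times> 'a grp_elt) set"
  where "coset a x = Usub J a #>\<^bsub>Hhat J a\<^esub> x"

lemma comm_group_quotient: "a \<subseteq> P \<Longrightarrow> comm_group (Hhat J a Mod Usub J a)"
  using comm_group.abelian_FactGroup[OF comm_group_Hhat subgroup_Usub] .

lemma coset_closed: "a \<subseteq> P \<Longrightarrow> x \<in> carrier (Hhat J a) \<Longrightarrow> coset a x \<in> carrier (Hhat J a Mod Usub J a)"
  by (auto simp: coset_def carrier_FactGroup)

lemma coset_mult:
  assumes "a \<subseteq> P" "x \<in> carrier (Hhat J a)" "y \<in> carrier (Hhat J a)"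
  shows "coset a (x \<otimes>\<^bsub>Hhat J a\<^esub> y) = coset a x \<otimes>\<^bsub>Hhat J a Mod Usub J a\<^esub> coset a y"
  using normal.rcos_sum[OF comm_group.subgroup_imp_normal[OF comm_group_Hhat subgroup_Usub]] assms
  by (simp add: coset_def)

lemma coset_eq_iff:
  assumes "a \<subseteq> P" "x \<in> carrier (Hhat J a)" "y \<in> carrier (Hhat J a)"
  shows "coset a x = coset a y \<longleftrightarrow> x \<otimes>\<^bsub>Hhat J a\<^esub> inv\<^bsub>Hhat J a\<^esub> y \<in> Usub J a"
proof -
  interpret H: comm_group "Hhat J a" using assms(1) by (rule comm_group_Hhat)
  note U = subgroup_Usub[OF assms(1)]
  show ?thesis
    unfolding coset_def
    using subgroup.rcos_module[OF U H.is_group assms(3,2)] H.repr_independence[OF _ assms(3) U]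
      H.repr_independenceD[OF U assms(2)] by metis
qed

text \<open>The generators of \<open>Usub\<close> only involve maximal targets. For general
  \<open>j\<close> both sides are moved to a maximal \<open>m\<close> above \<open>j\<close> and
  compared by functoriality.\<close>

lemma coset_Phi_hat:
  assumes a: "a \<in> lower_sets J" and i: "i \<in> a" and j: "j \<in> a" and ij: "i \<preceq> j" and u: "u \<in> carrier (Ghat J i)"
  shows "coset a (chi J a i u) = coset a (chi J a j (Phi_hat J j i u))"
proof -
  have aP: "a \<subseteq> P" using a by (rule lower_setsD(1))
  have *: "coset a (chi J a i u) = coset a (chi J a m (Phi_hat J m i u))"
    if i: "i \<in> a" and m: "m \<in> Max_elts J a" and im: "i \<preceq> m" and u: "u \<in> carrier (Ghat J i)" for i m u
  proof (cases "i = m")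
    case False
    have P: "i \<in> P" "m \<in> P" and ma: "m \<in> a" using i m aP Max_elts_subset by blast+
    have "Phi_hat J m i u \<in> carrier (Ghat J m)"
      using hom_in_carrier[OF Phi_hat_hom] P im u by blast
    then have "chi J a m (Phi_hat J m i u) \<in> carrier (Hhat J a)" using chi_closed[OF aP ma] by blast
    moreover have "chi J a i u \<otimes>\<^bsub>Hhat J a\<^esub> inv\<^bsub>Hhat J a\<^esub> (chi J a m (Phi_hat J m i u)) \<in> Usub J a"
      unfolding Usub_def using i m im u False Lt_iff[OF P] by (intro generate.incl) blast
    ultimately show ?thesis
      using coset_eq_iff[OF aP] chi_closed[OF aP i u] by blast
  qed (simp add: Phi_hat_def)
  obtain m where m: "m \<in> Max_elts J a" "j \<preceq> m" using lower_setsD(4)[OF a j] by blast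
  have P: "i \<in> P" "j \<in> P" "m \<in> P" using i j m aP Max_elts_subset by blast+
  have im: "i \<preceq> m" using ij m alg_le_trans by blast
  have "Phi_hat J j i u \<in> carrier (Ghat J j)"
    using hom_in_carrier[OF Phi_hat_hom] P ij u by blast
  then show ?thesis
    using *[OF i m(1) im u] *[OF j m] Phi_hat_comp[OF P ij m(2) u] by simp
qed

text \<open>In a decomposition of \<open>ident p u\<close> every index \<open>q\<close> is below
  \<open>p\<close>, and primality of \<open>p\<close> makes one of them equal to \<open>p\<close>.
  The generator at that index collects all the others.\<close>

lemma coset_additive:
  assumes a: "a \<in> lower_sets J"
  defines "W \<equiv> SIGMA p:a. Msemi J p" and "\<Gamma> \<equiv> \<lambda>(p, u). coset a (chi J a p u)"
  shows "additive_on_generators (Hhat J a Mod Usub J a) W (\<lambda>(p, u). ident p u) \<Gamma>"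
proof -
  have aP: "a \<subseteq> P" using a by (rule lower_setsD(1))
  interpret Q: comm_group "Hhat J a Mod Usub J a" using aP by (rule comm_group_quotient)
  note [simp del] = mult_FactGroup one_FactGroup
  let ?Q = "Hhat J a Mod Usub J a"
  let ?val = "\<lambda>(p, u). ident p u"
  let ?total = "\<lambda>ws. foldr (\<lambda>w g. \<Gamma> w \<otimes>\<^bsub>?Q\<^esub> g) ws \<one>\<^bsub>?Q\<^esub>"
  have \<Gamma>_closed: "\<Gamma> w \<in> carrier ?Q" if w: "w \<in> W" for w
  proof -
    obtain p u where pu: "w = (p, u)" "p \<in> a" "p \<in> P" "u \<in> Msemi J p"
      using w aP by (auto simp: W_def)
    then have "u \<in> carrier (Ghat J p)" using Msemi_subset_Ghat by blast
    then show ?thesis using coset_closed[OF aP chi_closed[OF aP pu(2)]] by (simp add: \<Gamma>_def pu(1))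
  qed
  have total_closed: "?total ws \<in> carrier ?Q" if "ws \<in> lists W" for ws
    using that by (induction ws) (auto intro: \<Gamma>_closed)
  have total_move: "?total (us @ w # vs) = \<Gamma> w \<otimes>\<^bsub>?Q\<^esub> ?total (us @ vs)"
    if "us \<in> lists W" "w \<in> W" "vs \<in> lists W" for us w vs
    using that
  proof (induction us)
    case (Cons w' us)
    then have "\<Gamma> w' \<in> carrier ?Q" "\<Gamma> w \<in> carrier ?Q" "?total (us @ vs) \<in> carrier ?Q"
      using \<Gamma>_closed[of w'] \<Gamma>_closed[of w] total_closed[of "us @ vs"] by auto
    then show ?case using Cons by (simp add: Q.m_lcomm)
  qed simp
  \<comment> \<open>A generator at \<open>q \<preceq> p\<close> is carried to \<open>p\<close> by
    \<open>Phi_hat\<close> and multiplied into \<open>u\<close>: its value is added and its coset is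
    preserved.\<close>
  have absorb: "\<exists>u'\<in>Msemi J p. ident p u' = ident p u + sum_list (map ?val ws) \<and>
      \<Gamma> (p, u') = \<Gamma> (p, u) \<otimes>\<^bsub>?Q\<^esub> ?total ws"
    if "p \<in> a" "u \<in> Msemi J p" "ws \<in> lists W" "\<forall>(q, v)\<in>set ws. q \<preceq> p" for p u ws
    using that(2-)
  proof (induction ws arbitrary: u)
    case Nil
    then show ?case using \<Gamma>_closed[of "(p, u)"] \<open>p \<in> a\<close> by (auto simp: W_def intro!: bexI[of _ u])
  next
    case (Cons w ws)
    obtain q v where w: "w = (q, v)" by (cases w)
    have q: "q \<in> a" "v \<in> Msemi J q" "q \<preceq> p" using Cons.prems w by (auto simp: W_def)
    have P: "p \<in> P" "q \<in> P" using \<open>p \<in> a\<close> q aP by auto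
    have uc: "u \<in> carrier (Ghat J p)" and vc: "v \<in> carrier (Ghat J q)"
      using Cons.prems(1) q P Msemi_subset_Ghat by blast+
    let ?v = "Phi_hat J p q v"
    have vc': "?v \<in> carrier (Ghat J p)" using hom_in_carrier[OF Phi_hat_hom] P q vc by blast
    let ?u = "u \<otimes>\<^bsub>Ghat J p\<^esub> ?v"
    have u': "?u \<in> Msemi J p \<and> ident p ?u = ident p u + ident q v"
    proof (cases "q = p")
      case True
      then show ?thesis
        using Msemi_mult_closed ident_mult P Cons.prems(1) q by (simp add: Phi_hat_def)
    next
      case False
      then show ?thesis
        using ident_mult_gam[OF P(1) Cons.prems(1) ident_absorbed[OF P q(3) False q(2)]]
          Phi_ext_eq[OF P q(3) False q(2)] by (simp add: Phi_hat_def)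
    qed
    have "\<Gamma> (p, ?u) = coset a (chi J a p u \<otimes>\<^bsub>Hhat J a\<^esub> chi J a p ?v)"
      unfolding \<Gamma>_def using chi_mult[OF aP \<open>p \<in> a\<close> uc vc'] by simp
    also have "\<dots> = coset a (chi J a p u) \<otimes>\<^bsub>?Q\<^esub> coset a (chi J a p ?v)"
      using coset_mult[OF aP] chi_closed[OF aP \<open>p \<in> a\<close>] uc vc' by blast
    also have "coset a (chi J a p ?v) = \<Gamma> w"
      using coset_Phi_hat[OF a q(1) \<open>p \<in> a\<close> q(3) vc] by (simp add: \<Gamma>_def w)
    finally have \<Gamma>_eq: "\<Gamma> (p, ?u) = \<Gamma> (p, u) \<otimes>\<^bsub>?Q\<^esub> \<Gamma> w" by (simp add: \<Gamma>_def)
    have "ws \<in> lists W" "\<forall>(q, v)\<in>set ws. q \<preceq> p" using Cons.prems by auto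
    from Cons.IH[OF conjunct1[OF u'] this] obtain u2 where u2: "u2 \<in> Msemi J p"
        "ident p u2 = ident p ?u + sum_list (map ?val ws)" "\<Gamma> (p, u2) = \<Gamma> (p, ?u) \<otimes>\<^bsub>?Q\<^esub> ?total ws"
      by blast
    have "\<Gamma> (p, u) \<in> carrier ?Q" "\<Gamma> w \<in> carrier ?Q" "?total ws \<in> carrier ?Q"
      using \<Gamma>_closed total_closed Cons.prems \<open>p \<in> a\<close> by (auto simp: W_def)
    then show ?case
      using u2 u' \<Gamma>_eq w by (intro bexI[of _ u2]) (auto simp: Q.m_assoc add.assoc)
  qed
  show ?thesis
  proof
    show "conical TYPE('a)" "refinement_monoid TYPE('a)" by (fact conical, fact refinement)
    show "\<Gamma> w \<in> carrier ?Q" if "w \<in> W" for w using that by (rule \<Gamma>_closed)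
    show "\<not> ?val w \<preceq> 0" if w: "w \<in> W" for w
    proof -
      obtain p u where pu: "w = (p, u)" "p \<in> P" "u \<in> Msemi J p" using w aP by (auto simp: W_def)
      have "\<not> ident p u \<preceq> 0"
        using rep_le_ident[OF pu(2,3)] alg_le_trans prime_elt_not_le_0[OF rep_prime[OF pu(2)]] by blast
      then show ?thesis by (simp add: pu(1))
    qed
    show "\<exists>ws\<in>lists W. t = sum_list (map ?val ws)" if w: "w \<in> W" and t: "t \<preceq> ?val w" for w t
    proof -
      obtain p u where pu: "w = (p, u)" "p \<in> a" "p \<in> P" "u \<in> Msemi J p" using w aP by (auto simp: W_def)
      obtain rs where rs: "\<forall>r\<in>set rs. prime_elt r" "t = sum_list rs" using sum_of_primes by blast
      have "r \<in> ?val ` W" if r: "r \<in> set rs" for r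
      proof -
        obtain k where k: "k \<in> P" "k \<preceq> r" "r \<preceq> k" using rep_exists rs(1) r by metis
        obtain m where "ident p u \<preceq> nmult m p" using ident_arch_comp pu arch_comp_iff by blast
        then have "k \<preceq> nmult m p"
          using k(2) summand_alg_le_sum_list[OF r] rs(2) t pu(1) alg_le_trans by (metis case_prod_conv)
        then have "k \<preceq> p" using prime_elt_nmult rep_prime k by blast
        then have ka: "k \<in> a" using lower_setsD(3)[OF a pu(2)] k by blast
        obtain v where "v \<in> Msemi J k" "r = ident k v"
          using ident_bij[OF k(1)] prime_in_arch_comp[OF k] unfolding bij_betw_def by blast
        then show ?thesis using ka by (force simp: W_def)
      qed
      then have "rs \<in> lists (?val ` W)" by blast
      then show ?thesis using rs(2) by (auto simp: lists_image)
    qed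
    show "\<Gamma> w = ?total ws" if w: "w \<in> W" and ws: "ws \<in> lists W" and eq: "?val w = sum_list (map ?val ws)" for w ws
    proof -
      obtain p u where pu: "w = (p, u)" "p \<in> a" "p \<in> P" "u \<in> Msemi J p" using w aP by (auto simp: W_def)
      have eq': "ident p u = sum_list (map ?val ws)" using eq pu by simp
      obtain m where m: "ident p u \<preceq> nmult m p" using ident_arch_comp pu arch_comp_iff by blast
      have le: "q \<preceq> p" if qv: "(q, v) \<in> set ws" for q v
      proof -
        have "(q, v) \<in> W" using qv ws by auto
        then have q: "q \<in> P" "v \<in> Msemi J q" using aP by (auto simp: W_def)
        have "ident q v \<preceq> sum_list (map ?val ws)"
          using qv by (intro summand_alg_le_sum_list) (force simp: image_iff)
        then have "q \<preceq> nmult m p"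
          using rep_le_ident[OF q] m eq' alg_le_trans by metis
        then show ?thesis using prime_elt_nmult rep_prime q by blast
      qed
      have "p \<preceq> sum_list (map ?val ws)" using rep_le_ident pu eq' by metis
      then obtain q v where qv: "(q, v) \<in> set ws" "p \<preceq> ident q v"
        using prime_elt_sum_list[OF rep_prime[OF pu(3)]] by fastforce
      have "(q, v) \<in> W" using qv ws by auto
      then have q: "q \<in> P" "v \<in> Msemi J q" using aP by (auto simp: W_def)
      then have "p \<preceq> q"
        using qv(2) ident_arch_comp arch_comp_iff prime_elt_nmult[OF rep_prime[OF pu(3)]] alg_le_trans by metis
      then have "q = p" using le[OF qv(1)] rep_unique q pu by blast
      then obtain us vs where split: "ws = us @ (p, v) # vs" using split_list qv(1) by metis
      have lists: "us \<in> lists W" "vs \<in> lists W" "us @ vs \<in> lists W" "(p, v) \<in> W" using ws split by auto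
      have "\<forall>(q, v)\<in>set (us @ vs). q \<preceq> p" using le split by auto
      then obtain u' where u': "u' \<in> Msemi J p" "ident p u' = ident p v + sum_list (map ?val (us @ vs))"
          "\<Gamma> (p, u') = \<Gamma> (p, v) \<otimes>\<^bsub>?Q\<^esub> ?total (us @ vs)"
        using absorb[OF pu(2) _ lists(3)] q \<open>q = p\<close> by blast
      have "ident p u' = ident p u" unfolding u'(2) eq' split by (simp add: ac_simps)
      \<comment> \<open>Injectivity of \<open>ident p\<close> turns equal values into equal
        coordinates, hence equal cosets.\<close>
      then have "u' = u" using ident_bij[OF pu(3)] u' pu unfolding bij_betw_def by (meson inj_onD)
      then show ?thesis using u'(3) pu(1) total_move[OF lists(1,4,2)] split by simp
    qed
  qed
qed

text \<open>\<open>z\<close> is the product of its single-coordinate elements over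
  \<open>summands\<close>, assembled through the truncations \<open>cut T\<close>. Neutral
  coordinates at free indices give no generator; they change neither value nor coset.\<close>

lemma coset_eq_total:
  assumes a: "a \<in> lower_sets J" and z: "z \<in> Hsemi J a"
  shows "\<exists>ws\<in>lists (SIGMA p:a. Msemi J p). eval_at a z = sum_list (map (\<lambda>(p, u). ident p u) ws) \<and>
    coset a z = foldr (\<lambda>w g. (\<lambda>(p, u). coset a (chi J a p u)) w \<otimes>\<^bsub>Hhat J a Mod Usub J a\<^esub> g) ws
      \<one>\<^bsub>Hhat J a Mod Usub J a\<^esub>"
proof -
  have aP: "a \<subseteq> P" using a by (rule lower_setsD(1))
  interpret H: comm_group "Hhat J a" using aP by (rule comm_group_Hhat)
  note zc = HsemiD[OF aP z]
  define cut where "cut T = (\<lambda>k\<in>a. if k \<in> T then z k else \<one>\<^bsub>Ghat J k\<^esub>)" for T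
  have zG: "z k \<in> carrier (Ghat J k)" if "k \<in> a" for k using that zc(2) Madm_Ghat aP by blast
  have cut_closed: "cut T \<in> carrier (Hhat J a)" for T
  proof -
    have "{k \<in> a. cut T k \<noteq> \<one>\<^bsub>Ghat J k\<^esub>} \<subseteq> {k \<in> a. z k \<noteq> \<one>\<^bsub>Ghat J k\<^esub>}" by (auto simp: cut_def)
    then have "finite {k \<in> a. cut T k \<noteq> \<one>\<^bsub>Ghat J k\<^esub>}"
      using zc(1) finite_subset unfolding carrier_Hhat[OF aP] by blast
    then show ?thesis
      using aP zG Ghat_one_closed unfolding carrier_Hhat[OF aP] by (auto simp: cut_def subset_iff)
  qed
  let ?R = "\<lambda>x h. \<exists>ws\<in>lists (SIGMA p:a. Msemi J p). x = sum_list (map (\<lambda>(p, u). ident p u) ws) \<and>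
    coset a h = foldr (\<lambda>w g. (\<lambda>(p, u). coset a (chi J a p u)) w \<otimes>\<^bsub>Hhat J a Mod Usub J a\<^esub> g) ws
      \<one>\<^bsub>Hhat J a Mod Usub J a\<^esub>"
  have R: "?R (\<Sum>i\<in>T. ident0 i (z i)) (cut T)" if "finite T" "T \<subseteq> a" for T
    using that
  proof (induction T)
    case empty
    have "cut {} = \<one>\<^bsub>Hhat J a\<^esub>" by (simp add: cut_def one_Hhat)
    moreover have "coset a \<one>\<^bsub>Hhat J a\<^esub> = Usub J a"
      using H.coset_mult_one subgroup.subset[OF subgroup_Usub[OF aP]] by (simp add: coset_def)
    ultimately show ?case by (intro bexI[of _ "[]"]) auto
  next
    case (insert i T)
    then have i: "i \<in> a" "i \<in> P" using aP by auto
    obtain ws where ws: "ws \<in> lists (SIGMA p:a. Msemi J p)"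
        "(\<Sum>i\<in>T. ident0 i (z i)) = sum_list (map (\<lambda>(p, u). ident p u) ws)"
        "coset a (cut T) = foldr (\<lambda>w g. (\<lambda>(p, u). coset a (chi J a p u)) w \<otimes>\<^bsub>Hhat J a Mod Usub J a\<^esub> g) ws
          \<one>\<^bsub>Hhat J a Mod Usub J a\<^esub>"
      using insert by auto
    show ?case
    proof (cases "z i \<in> Msemi J i")
      case True
      have "cut (insert i T) k = (chi J a i (z i) \<otimes>\<^bsub>Hhat J a\<^esub> cut T) k" for k
      proof (cases "k \<in> a")
        case True
        then interpret G: comm_group "Ghat J k" using aP by (intro comm_group_Ghat) blast
        show ?thesis
          using True insert.hyps(2) G.r_one[OF zG[OF True]] G.l_one[OF zG[OF True]] G.l_one[OF G.one_closed]
          by (auto simp: cut_def mult_Hhat chi_def)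
      qed (simp add: cut_def mult_Hhat)
      then have "cut (insert i T) = chi J a i (z i) \<otimes>\<^bsub>Hhat J a\<^esub> cut T" ..
      then have "coset a (cut (insert i T)) = coset a (chi J a i (z i)) \<otimes>\<^bsub>Hhat J a Mod Usub J a\<^esub> coset a (cut T)"
        using coset_mult[OF aP chi_closed[OF aP i(1) zG[OF i(1)]] cut_closed] by simp
      moreover have "(\<Sum>k\<in>insert i T. ident0 k (z k)) = ident i (z i) + (\<Sum>i\<in>T. ident0 i (z i))"
        using insert.hyps ident0_Msemi[OF i(2) True] by simp
      ultimately show ?thesis
        using ws True i by (intro bexI[of _ "(i, z i) # ws"]) auto
    next
      case False
      then have "z i = \<one>\<^bsub>Ghat J i\<^esub>" "free_elt i"
        using zc(2)[OF i(1)] by (auto simp: Madm_def split: if_splits)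
      then have "cut (insert i T) = cut T" "ident0 i (z i) = 0"
        using i by (auto simp: cut_def ident0_one)
      then show ?thesis using ws insert.hyps by auto
    qed
  qed
  have "cut (summands a z) = z"
    using zc(1) unfolding carrier_Hhat[OF aP]
    by (auto simp: cut_def summands_def PiE_iff extensional_def)
  then show ?thesis
    using R[OF finite_summands[OF a zc(1)] summands_subset] by (simp add: eval_at_def)
qed

theorem sim_iff:
  assumes a: "a \<in> lower_sets J" and x: "x \<in> Hsemi J a" and y: "y \<in> Hsemi J a"
  shows "(x, y) \<in> sim J a \<longleftrightarrow> eval_at a x = eval_at a y"
proof -
  have aP: "a \<subseteq> P" using a by (rule lower_setsD(1))
  interpret H: comm_group "Hhat J a" using aP by (rule comm_group_Hhat)
  note cl = HsemiD(1)[OF aP]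
  have "eval_at a x = eval_at a y" if U: "x \<otimes>\<^bsub>Hhat J a\<^esub> inv\<^bsub>Hhat J a\<^esub> y \<in> Usub J a"
  proof -
    obtain s t where st: "s \<in> Hsemi J a" "t \<in> Hsemi J a"
        "x \<otimes>\<^bsub>Hhat J a\<^esub> inv\<^bsub>Hhat J a\<^esub> y \<otimes>\<^bsub>Hhat J a\<^esub> s = t" "eval_at a s = eval_at a t"
      using Usub_imp_eval_eq[OF a U] by blast
    have "x \<otimes>\<^bsub>Hhat J a\<^esub> s = y \<otimes>\<^bsub>Hhat J a\<^esub> inv\<^bsub>Hhat J a\<^esub> y \<otimes>\<^bsub>Hhat J a\<^esub> (x \<otimes>\<^bsub>Hhat J a\<^esub> s)"
      using cl[OF x] cl[OF y] cl[OF st(1)] by simp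
    also have "\<dots> = y \<otimes>\<^bsub>Hhat J a\<^esub> t"
      using cl[OF x] cl[OF y] cl[OF st(1)] by (simp only: H.m_ac H.m_closed H.inv_closed flip: st(3))
    finally have "eval_at a x + eval_at a s = eval_at a y + eval_at a t"
      using eval_at_mult(2)[OF a x st(1)] eval_at_mult(2)[OF a y st(2)] by simp
    then show ?thesis using eval_at_cancel[OF a x y st(1)] st(4) by simp
  qed
  moreover have "x \<otimes>\<^bsub>Hhat J a\<^esub> inv\<^bsub>Hhat J a\<^esub> y \<in> Usub J a" if eq: "eval_at a x = eval_at a y"
  proof -
    interpret additive_on_generators "Hhat J a Mod Usub J a" "SIGMA p:a. Msemi J p" "\<lambda>(p, u). ident p u"
        "\<lambda>(p, u). coset a (chi J a p u)"
      using a by (rule coset_additive)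
    have "coset a x = coset a y"
      using coset_eq_total[OF a x] coset_eq_total[OF a y] total_eq eq by metis
    then show ?thesis using coset_eq_iff[OF aP cl[OF x] cl[OF y]] by blast
  qed
  ultimately show ?thesis using x y by (auto simp: sim_def)
qed

end

section \<open>The isomorphism\<close>

context prime_system
begin

lemma sim_class:
  assumes "a \<in> lower_sets J" "x \<in> Hsemi J a"
  shows "sim J a `` {x} = {y \<in> Hsemi J a. eval_at a y = eval_at a x}"
proof -
  have "sim J a `` {x} \<subseteq> Hsemi J a" by (auto simp: sim_def)
  then show ?thesis using sim_iff[OF assms] by auto
qed

text \<open>\<open>eval_at a\<close> is constant on each class, so the image is a singleton.\<close>

definition realize :: "'a set \<times> ('a \<Rightarrow> int \<times> 'a grp_elt) set \<Rightarrow> 'a"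
  where "realize = (\<lambda>(a, X). the_elem (eval_at a ` X))"

lemma realize_cls:
  assumes "a \<in> lower_sets J" "x \<in> Hsemi J a"
  shows "realize (cls J a x) = eval_at a x"
proof -
  have "eval_at a ` (sim J a `` {x}) = {eval_at a x}"
    using assms by (auto simp: sim_class)
  then show ?thesis by (simp add: realize_def cls_def)
qed

lemma carrier_sys_monoid:
  "A \<in> carrier (sys_monoid J) \<longleftrightarrow> (\<exists>a\<in>lower_sets J. \<exists>x\<in>Hsemi J a. A = cls J a x)"
  by (auto simp: sys_monoid_def cls_def quotient_def)

lemma cls_mult:
  assumes a: "a \<in> lower_sets J" and b: "b \<in> lower_sets J" and x: "x \<in> Hsemi J a" and y: "y \<in> Hsemi J b"
  shows "cls J a x \<otimes>\<^bsub>sys_monoid J\<^esub> cls J b y =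
    cls J (a \<union> b) (emb J a (a \<union> b) x \<otimes>\<^bsub>Hhat J (a \<union> b)\<^esub> emb J b (a \<union> b) y)"
proof -
  let ?m = "\<lambda>x y. emb J a (a \<union> b) x \<otimes>\<^bsub>Hhat J (a \<union> b)\<^esub> emb J b (a \<union> b) y"
  note c = lower_sets_Un(1)[OF a b]
  have eq: "sim J (a \<union> b) `` {?m x' y'} = sim J (a \<union> b) `` {?m x y}"
    if "x' \<in> sim J a `` {x}" "y' \<in> sim J b `` {y}" for x' y'
  proof -
    have xy: "x' \<in> Hsemi J a" "y' \<in> Hsemi J b" "eval_at a x' = eval_at a x" "eval_at b y' = eval_at b y"
      using that sim_class[OF a x] sim_class[OF b y] by auto
    note e1 = eval_at_add[OF a b x y] and e2 = eval_at_add[OF a b xy(1,2)]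
    show ?thesis
      unfolding sim_class[OF c e1(1)] sim_class[OF c e2(1)] e1(2) e2(2) xy(3,4) ..
  qed
  have "x \<in> sim J a `` {x}" "y \<in> sim J b `` {y}"
    using x y by (auto simp: sim_class[OF a x] sim_class[OF b y])
  then have "(\<Union>x'\<in>sim J a `` {x}. \<Union>y'\<in>sim J b `` {y}. sim J (a \<union> b) `` {?m x' y'})
      = sim J (a \<union> b) `` {?m x y}"
    using eq by (intro SUP_eq_const) blast+
  then show ?thesis by (simp add: sys_monoid_def cls_def)
qed

lemma realize_hom: "realize \<in> hom (sys_monoid J) as_monoid"
proof (rule homI)
  fix A B assume "A \<in> carrier (sys_monoid J)" "B \<in> carrier (sys_monoid J)"
  then obtain a x b y where *: "a \<in> lower_sets J" "x \<in> Hsemi J a" "A = cls J a x"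
      "b \<in> lower_sets J" "y \<in> Hsemi J b" "B = cls J b y"
    unfolding carrier_sys_monoid by blast
  then show "realize (A \<otimes>\<^bsub>sys_monoid J\<^esub> B) = realize A \<otimes>\<^bsub>as_monoid\<^esub> realize B"
    using eval_at_add[OF *(1,4,2,5)] lower_sets_Un(1)[OF *(1,4)]
    by (simp add: cls_mult realize_cls as_monoid_def)
qed (simp add: as_monoid_def)

lemma sys_monoid_mult_closed:
  assumes "A \<in> carrier (sys_monoid J)" "B \<in> carrier (sys_monoid J)"
  shows "A \<otimes>\<^bsub>sys_monoid J\<^esub> B \<in> carrier (sys_monoid J)"
  using assms cls_mult eval_at_add(1) lower_sets_Un(1) unfolding carrier_sys_monoid by metis

text \<open>The value is bounded by a multiple of the sum of the maximal indices, so a prime below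
  it is below one of these.\<close>

lemma lower_set_of_eval_at:
  assumes a: "a \<in> lower_sets J" and x: "x \<in> Hsemi J a"
  shows "a = {p \<in> P. p \<preceq> eval_at a x}"
proof (intro equalityI subsetI)
  fix p assume "p \<in> a"
  then show "p \<in> {p \<in> P. p \<preceq> eval_at a x}"
    using le_eval_at[OF a x] lower_setsD(1)[OF a] by blast
next
  fix p assume "p \<in> {p \<in> P. p \<preceq> eval_at a x}"
  then have p: "p \<in> P" "p \<preceq> eval_at a x" by auto
  obtain n where "eval_at a x \<preceq> nmult n (\<Sum>(Max_elts J a))" using eval_at_bounded[OF a x] by blast
  then have "p \<preceq> \<Sum>(Max_elts J a)"
    using prime_elt_nmult[OF rep_prime[OF p(1)]] p(2) alg_le_trans by blast
  then obtain j where "j \<in> Max_elts J a" "p \<preceq> j"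
    using prime_elt_sum[OF rep_prime[OF p(1)] lower_setsD(2)[OF a], of "\<lambda>x. x"] by auto
  then show "p \<in> a" using lower_setsD(3)[OF a _ p(1)] Max_elts_subset by blast
qed

lemma realize_inj: "inj_on realize (carrier (sys_monoid J))"
proof (rule inj_onI)
  fix A B assume "A \<in> carrier (sys_monoid J)" "B \<in> carrier (sys_monoid J)" and eq: "realize A = realize B"
  then obtain a x b y where *: "a \<in> lower_sets J" "x \<in> Hsemi J a" "A = cls J a x"
      "b \<in> lower_sets J" "y \<in> Hsemi J b" "B = cls J b y"
    unfolding carrier_sys_monoid by blast
  then have ev: "eval_at a x = eval_at b y" using eq by (simp add: realize_cls)
  then have "a = b" using lower_set_of_eval_at[OF *(1,2)] lower_set_of_eval_at[OF *(4,5)] by simp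
  then show "A = B"
    using * ev by (simp add: cls_def sim_class)
qed

section \<open>Canonical generators and surjectivity\<close>

lemma down_iff: "p \<in> P \<Longrightarrow> k \<in> down J p \<longleftrightarrow> k \<in> P \<and> k \<preceq> p"
  by (auto simp: down_def le_star_iff)

lemma down_lower_set:
  assumes p: "p \<in> P"
  shows "down J p \<in> lower_sets J" and "Max_elts J (down J p) = {p}"
proof -
  have sub: "down J p \<subseteq> P" by (auto simp: down_def)
  show Max: "Max_elts J (down J p) = {p}"
    using Max_elts_iff[OF sub] down_iff[OF p] p rep_unique alg_le_refl by blast
  show "down J p \<in> lower_sets J"
    unfolding lower_sets_iff Max using sub down_iff[OF p] alg_le_trans by blast
qed

lemma chi_down:
  assumes p: "p \<in> P" and u: "u \<in> Msemi J p"
  shows "chi J (down J p) p u \<in> Hsemi J (down J p)" and "eval_at (down J p) (chi J (down J p) p u) = ident p u"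
proof -
  note low = down_lower_set[OF p]
  have sub: "down J p \<subseteq> P" using low(1) by (rule lower_setsD(1))
  have pd: "p \<in> down J p" using down_iff p alg_le_refl by blast
  have "u \<in> carrier (Ghat J p)" using u Msemi_subset_Ghat[OF p] by blast
  then show "chi J (down J p) p u \<in> Hsemi J (down J p)"
    unfolding Hsemi_iff[OF sub] low(2)
    using chi_closed[OF sub pd] pd u Msemi_Madm one_Madm sub by (auto simp: chi_def)
  have "summands (down J p) (chi J (down J p) p u) = {p}"
    using low(2) by (auto simp: summands_def chi_def)
  then show "eval_at (down J p) (chi J (down J p) p u) = ident p u"
    using pd u p by (simp add: eval_at_def chi_def ident0_Msemi)
qed

lemma gen_elt_closed: "p \<in> P \<Longrightarrow> u \<in> Msemi J p \<Longrightarrow> gen_elt J p u \<in> carrier (sys_monoid J)"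
  using chi_down(1) down_lower_set(1) unfolding carrier_sys_monoid gen_elt_def by blast

lemma realize_gen_elt: "p \<in> P \<Longrightarrow> u \<in> Msemi J p \<Longrightarrow> realize (gen_elt J p u) = ident p u"
  by (simp add: gen_elt_def realize_cls chi_down down_lower_set)

lemma one_sys_monoid: "\<one>\<^bsub>sys_monoid J\<^esub> \<in> carrier (sys_monoid J) \<and> realize \<one>\<^bsub>sys_monoid J\<^esub> = 0"
proof -
  have low: "{} \<in> lower_sets J" by (simp add: lower_sets_iff Max_elts_def)
  interpret H: comm_group "Hhat J {}" by (rule comm_group_Hhat) simp
  have h: "\<one>\<^bsub>Hhat J {}\<^esub> \<in> Hsemi J {}"
    by (subst Hsemi_iff) (simp_all add: Max_elts_def)
  have "summands {} \<one>\<^bsub>Hhat J {}\<^esub> = {}" by (simp add: summands_def Max_elts_def)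
  then have "eval_at {} \<one>\<^bsub>Hhat J {}\<^esub> = 0" by (simp add: eval_at_def)
  moreover have "\<one>\<^bsub>sys_monoid J\<^esub> = cls J {} \<one>\<^bsub>Hhat J {}\<^esub>" by (simp add: sys_monoid_def)
  ultimately show ?thesis using realize_cls[OF low h] low h unfolding carrier_sys_monoid by auto
qed

lemma realize_surj: "x \<in> realize ` carrier (sys_monoid J)"
proof -
  obtain rs where rs: "\<forall>r\<in>set rs. prime_elt r" "x = sum_list rs" using sum_of_primes by blast
  from rs(1) have "sum_list rs \<in> realize ` carrier (sys_monoid J)"
  proof (induction rs)
    case Nil
    then show ?case using one_sys_monoid by (auto intro: rev_image_eqI)
  next
    case (Cons r rs)
    then obtain A where A: "A \<in> carrier (sys_monoid J)" "sum_list rs = realize A" by auto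
    obtain k where k: "k \<in> P" "k \<preceq> r" "r \<preceq> k" using rep_exists Cons.prems by (metis list.set_intros(1))
    obtain u where u: "u \<in> Msemi J k" "r = ident k u"
      using ident_bij[OF k(1)] prime_in_arch_comp[OF k] unfolding bij_betw_def by blast
    let ?B = "gen_elt J k u"
    have "realize (?B \<otimes>\<^bsub>sys_monoid J\<^esub> A) = sum_list (r # rs)"
      using hom_mult[OF realize_hom gen_elt_closed[OF k(1) u(1)] A(1)] realize_gen_elt[OF k(1) u(1)] A(2) u(2)
      by (simp add: as_monoid_def)
    then show ?case
      using sys_monoid_mult_closed[OF gen_elt_closed[OF k(1) u(1)] A(1)] by (metis image_eqI)
  qed
  then show ?thesis using rs(2) by simp
qed

lemma realize_iso: "realize \<in> iso (sys_monoid J) as_monoid"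
  unfolding iso_def bij_betw_def
  using realize_hom realize_inj realize_surj by (auto simp: as_monoid_def)

end

text \<open>\<open>iso\<close> asks for bijectivity and multiplicativity only, so the unit is
  treated separately. Naturality is expressed by the values on the canonical images of the
  semigroups M_p.\<close>

theorem theorem2p7:
  fixes P :: "'a::comm_monoid_add set"
  assumes "conical TYPE('a)" and "refinement_monoid TYPE('a)" and "primely_generated TYPE('a)"
    and "prime_reps P"
  shows "is_isystem (sys_of P) \<and>
    (\<exists>F. F \<in> iso (sys_monoid (sys_of P)) (as_monoid :: 'a monoid) \<and>
      F \<one>\<^bsub>sys_monoid (sys_of P)\<^esub> = 0 \<and>
      (\<forall>p\<in>P. \<forall>u\<in>Msemi (sys_of P) p. F (gen_elt (sys_of P) p u) = ident p u))"
proof -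
  interpret prime_system P using assms by unfold_locales
  show ?thesis
    using is_isystem_J realize_iso one_sys_monoid realize_gen_elt by blast
qed

end
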